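(* Let $s>\frac{3}{2}$ and let $z_0=(u_0,v_0,w_0)\in H^s(\mathbb{R})\times H^s(\mathbb{R})\times H^s(\mathbb{R})$. Let $T$ be the lifespan (maximal existence time) of the strong solution $z=(u,v,w)\in\mathcal{C}([0,T);(H^s)^3)\cap\mathcal{C}^1([0,T);(H^{s-1})^3)$ of the three-component Camassa--Holm system (written in nonlocal form below) with initial data $z_0$. Set $E_0=\|u_0\|_{H^1}^2+\|v_0\|_{H^1}^2+\|w_0\|_{H^1}^2$ and $Q(0)=\int_{\mathbb{R}}(u_{0x}+v_{0x}+w_{0x})^3\,dx$. If $$Q(0)<-9E_0\sqrt{2E_0},$$ then the corresponding solution $z$ blows up in finite time, and the lifespan satisfies $$T\leq\frac{\sqrt{2E_0}}{3E_0}\log\left(\frac{Q(0)-9E_0\sqrt{2E_0}}{Q(0)+9E_0\sqrt{2E_0}}\right).$$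
   Context: The system (for unknowns $u,v,w$ of $(t,x)\in\mathbb{R}^+\times\mathbb{R}$) is $m_t-m_xu+2mu_x+(mv+mw)_x+nv_x+lw_x=0$, $n_t-n_xv+2nv_x+(nu+nw)_x+mu_x+lw_x=0$, $l_t-l_xw+2lw_x+(lu+lv)_x+mu_x+nv_x=0$, with $m=u-u_{xx}$, $n=v-v_{xx}$, $l=w-w_{xx}$, which is treated in the equivalent nonlocal form $u_t+(u+v+w)u_x+G*(uv_x+uw_x)+\partial_xG*f=0$, $v_t+(u+v+w)v_x+G*(vu_x+vw_x)+\partial_xG*g=0$, $w_t+(u+v+w)w_x+G*(wu_x+wv_x)+\partial_xG*h=0$, $(u,v,w)|_{t=0}=(u_0,v_0,w_0)$, where $G(x)=\frac12e^{-|x|}$ (so $G*F=(1-\partial_x^2)^{-1}F$) and $f=u^2+\frac12u_x^2+u_xv_x+u_xw_x+\frac12v^2-\frac12v_x^2+\frac12w^2-\frac12w_x^2$, $g=v^2+\frac12v_x^2+u_xv_x+w_xv_x+\frac12u^2-\frac12u_x^2+\frac12w^2-\frac12w_x^2$, $h=w^2+\frac12w_x^2+u_xw_x+v_xw_x+\frac12u^2-\frac12u_x^2+\frac12v^2-\frac12v_x^2$. For such data a unique strong solution exists locally in time; "blows up in finite time" means the maximal existence time $T$ is finite. *)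

theory Defs
  imports "HOL-Analysis.Analysis"
begin

definition test_fun :: "(real \<Rightarrow> real) \<Rightarrow> bool" where
  "test_fun \<phi> \<longleftrightarrow> (\<forall>k x. ((deriv ^^ k) \<phi>) differentiable (at x)) \<and> bounded {x. \<phi> x \<noteq> 0}"

definition fourier :: "(real \<Rightarrow> real) \<Rightarrow> real \<Rightarrow> complex" where
  "fourier \<phi> \<xi> = integral\<^sup>L lborel (\<lambda>x. complex_of_real (\<phi> x) * cis (- (x * \<xi>)))"

text \<open>F is (a representative of) the distributional Fourier transform of f and
  (1+xi^2)^(s/2) F is square integrable.\<close>
definition Hs_rep :: "real \<Rightarrow> (real \<Rightarrow> real) \<Rightarrow> (real \<Rightarrow> complex) \<Rightarrow> bool" where
  "Hs_rep s f F \<longleftrightarrow> F \<in> borel_measurable lborel \<and>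
     integrable lborel (\<lambda>\<xi>. (1 + \<xi>\<^sup>2) powr s * (cmod (F \<xi>))\<^sup>2) \<and>
     (\<forall>\<phi>. test_fun \<phi> \<longrightarrow>
        integral\<^sup>L lborel (\<lambda>x. complex_of_real (f x) * fourier \<phi> x)
        = integral\<^sup>L lborel (\<lambda>\<xi>. F \<xi> * complex_of_real (\<phi> \<xi>)))"

definition in_Hs :: "real \<Rightarrow> (real \<Rightarrow> real) \<Rightarrow> bool" where
  "in_Hs s f \<longleftrightarrow> f \<in> borel_measurable lborel \<and> integrable lborel (\<lambda>x. (f x)\<^sup>2) \<and> (\<exists>F. Hs_rep s f F)"

text \<open>H^s norm, normalised so that the H^1 norm squared is int (f^2 + f_x^2) dx.\<close>
definition Hs_norm :: "real \<Rightarrow> (real \<Rightarrow> real) \<Rightarrow> real" where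
  "Hs_norm s f = sqrt (integral\<^sup>L lborel
      (\<lambda>\<xi>. (1 + \<xi>\<^sup>2) powr s * (cmod ((SOME F. Hs_rep s f F) \<xi>))\<^sup>2) / (2 * pi))"

definition Hs_continuous :: "real \<Rightarrow> real \<Rightarrow> (real \<Rightarrow> real \<Rightarrow> real) \<Rightarrow> bool" where
  "Hs_continuous s T u \<longleftrightarrow> (\<forall>t\<in>{0..<T}.
     ((\<lambda>t'. Hs_norm s (\<lambda>x. u t' x - u t x)) \<longlongrightarrow> 0) (at t within {0..<T}))"

definition Hs_time_deriv :: "real \<Rightarrow> real \<Rightarrow> (real \<Rightarrow> real \<Rightarrow> real) \<Rightarrow> (real \<Rightarrow> real \<Rightarrow> real) \<Rightarrow> bool" where
  "Hs_time_deriv s T u ut \<longleftrightarrow> (\<forall>t\<in>{0..<T}.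
     ((\<lambda>t'. Hs_norm s (\<lambda>x. (u t' x - u t x) / (t' - t) - ut t x)) \<longlongrightarrow> 0) (at t within {0..<T}))"

definition Gconv :: "(real \<Rightarrow> real) \<Rightarrow> real \<Rightarrow> real" where
  "Gconv F x = integral\<^sup>L lborel (\<lambda>y. (1/2) * exp (- \<bar>x - y\<bar>) * F y)"

definition Gxconv :: "(real \<Rightarrow> real) \<Rightarrow> real \<Rightarrow> real" where
  "Gxconv F x = integral\<^sup>L lborel (\<lambda>y. - (1/2) * sgn (x - y) * exp (- \<bar>x - y\<bar>) * F y)"

definition fnl :: "real \<Rightarrow> real \<Rightarrow> real \<Rightarrow> real \<Rightarrow> real \<Rightarrow> real \<Rightarrow> real" where
  "fnl u v w ux vx wx = u\<^sup>2 + ux\<^sup>2 / 2 + ux * vx + ux * wx + v\<^sup>2 / 2 - vx\<^sup>2 / 2 + w\<^sup>2 / 2 - wx\<^sup>2 / 2"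

definition gnl :: "real \<Rightarrow> real \<Rightarrow> real \<Rightarrow> real \<Rightarrow> real \<Rightarrow> real \<Rightarrow> real" where
  "gnl u v w ux vx wx = v\<^sup>2 + vx\<^sup>2 / 2 + ux * vx + wx * vx + u\<^sup>2 / 2 - ux\<^sup>2 / 2 + w\<^sup>2 / 2 - wx\<^sup>2 / 2"

definition hnl :: "real \<Rightarrow> real \<Rightarrow> real \<Rightarrow> real \<Rightarrow> real \<Rightarrow> real \<Rightarrow> real" where
  "hnl u v w ux vx wx = w\<^sup>2 + wx\<^sup>2 / 2 + ux * wx + vx * wx + u\<^sup>2 / 2 - ux\<^sup>2 / 2 + v\<^sup>2 / 2 - vx\<^sup>2 / 2"

text \<open>z = (u,v,w) in C([0,T);(H^s)^3) \<inter> C^1([0,T);(H^(s-1))^3) solving the nonlocal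
  system (as an identity in H^(s-1), i.e. a.e. in x) with initial data (u0,v0,w0).
  Functions are taken with their (C^1) representative in x, so that u_x is the classical derivative.\<close>
definition strong_solution :: "real \<Rightarrow> (real \<Rightarrow> real) \<Rightarrow> (real \<Rightarrow> real) \<Rightarrow> (real \<Rightarrow> real) \<Rightarrow> real
    \<Rightarrow> (real \<Rightarrow> real \<Rightarrow> real) \<Rightarrow> (real \<Rightarrow> real \<Rightarrow> real) \<Rightarrow> (real \<Rightarrow> real \<Rightarrow> real) \<Rightarrow> bool" where
  "strong_solution s u0 v0 w0 T u v w \<longleftrightarrow> 0 < T \<and>
     (\<forall>t\<in>{0..<T}. in_Hs s (u t) \<and> in_Hs s (v t) \<and> in_Hs s (w t) \<and>
        (\<forall>x. u t differentiable (at x) \<and> v t differentiable (at x) \<and> w t differentiable (at x))) \<and>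
     Hs_continuous s T u \<and> Hs_continuous s T v \<and> Hs_continuous s T w \<and>
     (\<exists>ut vt wt.
        (\<forall>t\<in>{0..<T}. in_Hs (s - 1) (ut t) \<and> in_Hs (s - 1) (vt t) \<and> in_Hs (s - 1) (wt t)) \<and>
        Hs_continuous (s - 1) T ut \<and> Hs_continuous (s - 1) T vt \<and> Hs_continuous (s - 1) T wt \<and>
        Hs_time_deriv (s - 1) T u ut \<and> Hs_time_deriv (s - 1) T v vt \<and> Hs_time_deriv (s - 1) T w wt \<and>
        (\<forall>t\<in>{0..<T}.
          let ux = deriv (u t); vx = deriv (v t); wx = deriv (w t);
              f = (\<lambda>y. fnl (u t y) (v t y) (w t y) (ux y) (vx y) (wx y));
              g = (\<lambda>y. gnl (u t y) (v t y) (w t y) (ux y) (vx y) (wx y));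
              h = (\<lambda>y. hnl (u t y) (v t y) (w t y) (ux y) (vx y) (wx y))
          in AE x in lborel.
            ut t x + (u t x + v t x + w t x) * ux x
              + Gconv (\<lambda>y. u t y * vx y + u t y * wx y) x + Gxconv f x = 0 \<and>
            vt t x + (u t x + v t x + w t x) * vx x
              + Gconv (\<lambda>y. v t y * ux y + v t y * wx y) x + Gxconv g x = 0 \<and>
            wt t x + (u t x + v t x + w t x) * wx x
              + Gconv (\<lambda>y. w t y * ux y + w t y * vx y) x + Gxconv h x = 0)) \<and>
     (AE x in lborel. u 0 x = u0 x \<and> v 0 x = v0 x \<and> w 0 x = w0 x)"

definition lifespan :: "real \<Rightarrow> (real \<Rightarrow> real) \<Rightarrow> (real \<Rightarrow> real) \<Rightarrow> (real \<Rightarrow> real) \<Rightarrow> ereal" where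
  "lifespan s u0 v0 w0 = Sup {ereal T | T. \<exists>u v w. strong_solution s u0 v0 w0 T u v w}"

end

theory Submission
  imports Defs "HOL-Probability.Probability"
begin

text \<open>
  Along a strong solution the energy \<open>E\<close>, the sum of the three squared \<open>H\<^sup>1\<close> norms, is conserved, and
  \<open>p = u\<^sub>x + v\<^sub>x + w\<^sub>x\<close> satisfies \<open>p\<^sub>t + (u + v + w) p\<^sub>x \<le> - p\<^sup>2 / 2 + 9 E / 4\<close>. Integrating \<open>3 p\<^sup>2\<close> times
  this inequality and using \<open>(\<integral> p\<^sup>3)\<^sup>2 \<le> 3 E \<integral> p\<^sup>4\<close> gives a Riccati inequality for \<open>Q = \<integral> p\<^sup>3\<close>, which cannot
  persist beyond the stated time. Since \<open>u\<^sub>x\<close> need not be differentiable, both balance laws are first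
  derived exactly for the difference quotients \<open>(u(x + e) - u(x)) / e\<close>; these are differentiable in \<open>x\<close>
  and dominated in mean square by \<open>u\<^sub>x\<close>, so that \<open>e \<longrightarrow> 0\<close> is harmless.
  From the Fourier side only three facts are needed: \<open>H\<^sup>s\<close> functions with \<open>s > 3/2\<close> have bounded
  continuous derivatives, the Sobolev norms dominate the mean-square norms of \<open>f\<close> and \<open>f\<^sub>x\<close>, and
  Fourier inversion holds for continuous \<open>f\<close>.
\<close>

section \<open>Integration on the real line\<close>

text \<open>The obstacle is low regularity in both variables: the time derivative of u_x lies only
  in H^(s-2), which for s < 2 is not a space of square-integrable functions. At fixed e the
  difference quotient is a bounded operator on L^2, so it inherits the time derivative of u; its
  discrete Leibniz rule leaves one dangerous term S d_x, with S = u + v + w, and integration by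
  parts moves that derivative onto S. In the limit only time-integrated laws survive, so the Riccati
  step compares Q with a primitive of its upper bound instead of differentiating Q. Two
  cancellations carry the algebra. The energy balance of one component is not closed; the remainders
  vanish only in the sum of all three. The derivatives of the three nonlocal terms add up to G*F - F
  for a single quadratic F, and the positivity of G bounds this from below. E_0 is defined on the
  Fourier side. Bessel's inequality gives E(0) \<le> E_0, and this is the direction in which the
  Riccati bound is monotone.\<close>

lemma integrable_mult_of_square:
  fixes f g :: "'a \<Rightarrow> real"
  assumes [measurable]: "f \<in> borel_measurable M" "g \<in> borel_measurable M"
    and "integrable M (\<lambda>x. (f x)\<^sup>2)" "integrable M (\<lambda>x. (g x)\<^sup>2)"
  shows "integrable M (\<lambda>x. f x * g x)"
proof (rule Bochner_Integration.integrable_bound)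
  show "integrable M (\<lambda>x. (f x)\<^sup>2 + (g x)\<^sup>2)" using assms by simp
  show "AE x in M. norm (f x * g x) \<le> norm ((f x)\<^sup>2 + (g x)\<^sup>2)"
  proof (rule AE_I2)
    fix x
    have "0 \<le> (\<bar>f x\<bar> - \<bar>g x\<bar>)\<^sup>2" by simp
    then have "2 * (\<bar>f x\<bar> * \<bar>g x\<bar>) \<le> (f x)\<^sup>2 + (g x)\<^sup>2" by (simp add: power2_diff)
    moreover have "0 \<le> \<bar>f x\<bar> * \<bar>g x\<bar>" by simp
    ultimately have "\<bar>f x\<bar> * \<bar>g x\<bar> \<le> (f x)\<^sup>2 + (g x)\<^sup>2" by linarith
    then show "norm (f x * g x) \<le> norm ((f x)\<^sup>2 + (g x)\<^sup>2)" by (simp add: abs_mult)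
  qed
qed measurable

lemma square_add_le: "((a::real) + b)\<^sup>2 \<le> 2 * a\<^sup>2 + 2 * b\<^sup>2"
proof -
  have "0 \<le> (a - b)\<^sup>2" by simp
  then show ?thesis by (simp add: power2_sum power2_diff)
qed

lemma integrable_square_add:
  fixes f g :: "'a \<Rightarrow> real"
  assumes [measurable]: "f \<in> borel_measurable M" "g \<in> borel_measurable M"
    and "integrable M (\<lambda>x. (f x)\<^sup>2)" "integrable M (\<lambda>x. (g x)\<^sup>2)"
  shows "integrable M (\<lambda>x. (f x + g x)\<^sup>2)"
proof (rule Bochner_Integration.integrable_bound)
  show "integrable M (\<lambda>x. 2 * (f x)\<^sup>2 + 2 * (g x)\<^sup>2)" using assms by simp
  show "AE x in M. norm ((f x + g x)\<^sup>2) \<le> norm (2 * (f x)\<^sup>2 + 2 * (g x)\<^sup>2)"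
    using square_add_le by auto
qed measurable

lemma integrable_square_bounded_mult:
  fixes f g :: "'a \<Rightarrow> real"
  assumes [measurable]: "f \<in> borel_measurable M" "g \<in> borel_measurable M"
    and "integrable M (\<lambda>x. (g x)\<^sup>2)" "\<And>x. \<bar>f x\<bar> \<le> C"
  shows "integrable M (\<lambda>x. (f x * g x)\<^sup>2)"
proof (rule Bochner_Integration.integrable_bound)
  show "integrable M (\<lambda>x. C\<^sup>2 * (g x)\<^sup>2)" using assms by simp
  show "AE x in M. norm ((f x * g x)\<^sup>2) \<le> norm (C\<^sup>2 * (g x)\<^sup>2)"
  proof (rule AE_I2)
    fix x
    have "(f x)\<^sup>2 \<le> C\<^sup>2" using power_mono[OF assms(4)[of x], of 2] by simp
    then have "(f x)\<^sup>2 * (g x)\<^sup>2 \<le> C\<^sup>2 * (g x)\<^sup>2" by (rule mult_right_mono) simp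
    then show "norm ((f x * g x)\<^sup>2) \<le> norm (C\<^sup>2 * (g x)\<^sup>2)" by (simp add: power_mult_distrib)
  qed
qed measurable

lemma Cauchy_Schwarz_integral:
  fixes f g :: "'a \<Rightarrow> real"
  assumes [measurable]: "f \<in> borel_measurable M" "g \<in> borel_measurable M"
    and f: "integrable M (\<lambda>x. (f x)\<^sup>2)" and g: "integrable M (\<lambda>x. (g x)\<^sup>2)"
  shows "(\<integral>x. f x * g x \<partial>M)\<^sup>2 \<le> (\<integral>x. (f x)\<^sup>2 \<partial>M) * (\<integral>x. (g x)\<^sup>2 \<partial>M)"
proof -
  have fg: "integrable M (\<lambda>x. f x * g x)" by (rule integrable_mult_of_square) fact+
  define A B C where "A = (\<integral>x. (f x)\<^sup>2 \<partial>M)" and "B = (\<integral>x. f x * g x \<partial>M)" and "C = (\<integral>x. (g x)\<^sup>2 \<partial>M)"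
  have q: "0 \<le> a\<^sup>2 * A - 2 * a * b * B + b\<^sup>2 * C" for a b
  proof -
    have "0 \<le> (\<integral>x. (a * f x - b * g x)\<^sup>2 \<partial>M)" by simp
    also have "\<dots> = (\<integral>x. a\<^sup>2 * (f x)\<^sup>2 - 2 * a * b * (f x * g x) + b\<^sup>2 * (g x)\<^sup>2 \<partial>M)"
      by (rule Bochner_Integration.integral_cong) (auto simp: power2_eq_square algebra_simps)
    also have "\<dots> = a\<^sup>2 * A - 2 * a * b * B + b\<^sup>2 * C"
      using f g fg by (simp add: A_def B_def C_def)
    finally show ?thesis .
  qed
  have "C \<ge> 0" by (simp add: C_def)
  show ?thesis
  proof (cases "C = 0")
    case True
    have "B = 0"
    proof (rule ccontr)
      assume "B \<noteq> 0"
      \<comment> \<open>With \<open>C = 0\<close> the form is linear in b, and this b gives it the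
        value -1.\<close>
      with q[of 1 "(A + 1) / (2 * B)"] True show False by simp
    qed
    then show ?thesis using True by (simp add: A_def B_def C_def)
  next
    case False
    then have "C > 0" using \<open>C \<ge> 0\<close> by simp
    \<comment> \<open>Up to scaling, this choice of a and b minimises the form.\<close>
    have "0 \<le> C * (C * A - B\<^sup>2)" using q[of C B] by (simp add: power2_eq_square algebra_simps)
    then have "0 \<le> C * A - B\<^sup>2" using \<open>C > 0\<close> by (simp add: zero_le_mult_iff)
    then show ?thesis by (simp add: A_def B_def C_def mult.commute)
  qed
qed

text \<open>Fatou's lemma, with integrability of the limit as part of the conclusion: it follows
  from the bound on the integrals. It serves the limits below for which no majorant is at
  hand.\<close>

lemma integrable_liminf_bound:
  fixes f :: "nat \<Rightarrow> 'a \<Rightarrow> real"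
  assumes [measurable]: "\<And>n. f n \<in> borel_measurable M" "F \<in> borel_measurable M"
    and int: "\<And>n. integrable M (f n)" and nn: "\<And>n x. 0 \<le> f n x"
    and lim: "\<And>x. (\<lambda>n. f n x) \<longlonglongrightarrow> F x"
    and c: "\<And>n. (\<integral>x. f n x \<partial>M) \<le> c n" and cl: "c \<longlonglongrightarrow> C"
  shows "integrable M F" "(\<integral>x. F x \<partial>M) \<le> C"
proof -
  have Fnn: "0 \<le> F x" for x by (rule LIMSEQ_le_const[OF lim]) (use nn in auto)
  have c0: "0 \<le> c n" for n by (rule order_trans[OF Bochner_Integration.integral_nonneg c]) (use nn in auto)
  have C0: "0 \<le> C" by (rule LIMSEQ_le_const[OF cl]) (use c0 in auto)
  have "(\<integral>\<^sup>+x. ennreal (F x) \<partial>M) = (\<integral>\<^sup>+x. liminf (\<lambda>n. ennreal (f n x)) \<partial>M)"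
    by (intro nn_integral_cong lim_imp_Liminf[symmetric]) (auto intro!: tendsto_ennrealI lim)
  also have "\<dots> \<le> liminf (\<lambda>n. (\<integral>\<^sup>+x. ennreal (f n x) \<partial>M))"
    by (rule nn_integral_liminf) measurable
  also have "\<dots> \<le> liminf (\<lambda>n. ennreal (c n))"
    by (intro Liminf_mono always_eventually allI)
       (use c c0 int nn in \<open>auto simp: nn_integral_eq_integral\<close>)
  also have "\<dots> = ennreal C"
    by (intro lim_imp_Liminf) (auto intro!: tendsto_ennrealI cl)
  finally have *: "(\<integral>\<^sup>+x. ennreal (F x) \<partial>M) \<le> ennreal C" .
  show "integrable M F"
    by (rule integrableI_nonneg) (use Fnn * in \<open>auto simp: less_top[symmetric] top_unique\<close>)
  then have "ennreal (\<integral>x. F x \<partial>M) \<le> ennreal C"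
    using * Fnn by (subst (asm) nn_integral_eq_integral) auto
  then show "(\<integral>x. F x \<partial>M) \<le> C" using C0 by simp
qed

text \<open>Fatou's lemma for \<open>g n + f n\<close> and for \<open>g n - f n\<close> bounds the
  integral of F from both sides. The majorants may move with n: below they are sums of squared
  difference quotients, whose integrals stay below that of their limit.\<close>

lemma generalized_dominated_convergence:
  fixes f g :: "nat \<Rightarrow> 'a \<Rightarrow> real"
  assumes m[measurable]: "\<And>n. f n \<in> borel_measurable M" "F \<in> borel_measurable M"
    and gi: "\<And>n. integrable M (g n)" and Gi: "integrable M G"
    and fg: "\<And>n x. \<bar>f n x\<bar> \<le> g n x"
    and f: "\<And>x. (\<lambda>n. f n x) \<longlonglongrightarrow> F x" and g: "\<And>x. (\<lambda>n. g n x) \<longlonglongrightarrow> G x"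
    and le: "\<And>n. (\<integral>x. g n x \<partial>M) \<le> (\<integral>x. G x \<partial>M)"
  shows "(\<lambda>n. \<integral>x. f n x \<partial>M) \<longlonglongrightarrow> (\<integral>x. F x \<partial>M)"
proof -
  have [measurable]: "\<And>n. g n \<in> borel_measurable M" "G \<in> borel_measurable M" using gi Gi by auto
  have FG: "\<bar>F x\<bar> \<le> G x" for x
    by (rule LIMSEQ_le[OF tendsto_rabs[OF f] g]) (use fg in auto)
  have fi: "integrable M (f n)" for n
    by (rule Bochner_Integration.integrable_bound[OF gi[of n]]) (use order_trans[OF fg abs_ge_self] in auto)
  have Fi: "integrable M F"
    by (rule Bochner_Integration.integrable_bound[OF Gi]) (use order_trans[OF FG abs_ge_self] in auto)
  have key: "eventually (\<lambda>n. (\<integral>x. s * F x \<partial>M) - e < (\<integral>x. s * f n x \<partial>M)) sequentially"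
    if s: "\<bar>s\<bar> = 1" and e: "e > 0" for s e :: real
  proof (rule ccontr)
    assume "\<not> ?thesis"
    then have "frequently (\<lambda>n. (\<integral>x. s * f n x \<partial>M) \<le> (\<integral>x. s * F x \<partial>M) - e) sequentially"
      by (simp add: not_eventually not_less)
    then have "infinite {n. (\<integral>x. s * f n x \<partial>M) \<le> (\<integral>x. s * F x \<partial>M) - e}"
      unfolding cofinite_eq_sequentially[symmetric] frequently_cofinite .
    from infinite_enumerate[OF this] obtain r :: "nat \<Rightarrow> nat" where r: "strict_mono r"
      and r_le: "\<And>k. r k \<in> {n. (\<integral>x. s * f n x \<partial>M) \<le> (\<integral>x. s * F x \<partial>M) - e}"
      by metis
    have le1: "\<bar>s * y\<bar> = \<bar>y\<bar>" for y using s by (simp add: abs_mult)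
    \<comment> \<open>Fatou along the subsequence on which the claim fails; adding \<open>g\<close>
      makes the integrands nonnegative. The resulting inequality loses \<open>e\<close> and is
      absurd.\<close>
    have "(\<integral>x. G x + s * F x \<partial>M) \<le> (\<integral>x. G x \<partial>M) + ((\<integral>x. s * F x \<partial>M) - e)"
    proof (rule integrable_liminf_bound(2)[where f = "\<lambda>k x. g (r k) x + s * f (r k) x" and c = "\<lambda>_. (\<integral>x. G x \<partial>M) + ((\<integral>x. s * F x \<partial>M) - e)"])
      show "0 \<le> g (r n) x + s * f (r n) x" for n x using fg[of "r n" x] le1[of "f (r n) x"] by linarith
      show "(\<lambda>n. g (r n) x + s * f (r n) x) \<longlonglongrightarrow> G x + s * F x" for x
        using LIMSEQ_subseq_LIMSEQ[OF g[of x] r] LIMSEQ_subseq_LIMSEQ[OF f[of x] r]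
        by (auto simp: o_def intro!: tendsto_intros)
      show "(\<integral>x. g (r n) x + s * f (r n) x \<partial>M) \<le> (\<integral>x. G x \<partial>M) + ((\<integral>x. s * F x \<partial>M) - e)" for n
        using gi[of "r n"] fi[of "r n"] le[of "r n"] r_le[of n] by simp
    qed (use gi fi in auto)
    then show False using Gi Fi e by simp
  qed
  show ?thesis
  proof (rule LIMSEQ_I)
    fix e :: real assume e: "0 < e"
    have "eventually (\<lambda>n. norm ((\<integral>x. f n x \<partial>M) - (\<integral>x. F x \<partial>M)) < e) sequentially"
      using eventually_conj[OF key[of 1 e] key[of "-1" e]] e by (auto elim!: eventually_mono)
    then show "\<exists>no. \<forall>n\<ge>no. norm ((\<integral>x. f n x \<partial>M) - (\<integral>x. F x \<partial>M)) < e"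
      by (simp add: eventually_sequentially)
  qed
qed

text \<open>An integrable function need not tend to 0, but it is small at some arbitrarily large
  points: otherwise a multiple of the indicator of a half-line would be integrable. This is enough
  to discard boundary terms.\<close>

lemma integrable_small_value:
  fixes k :: "real \<Rightarrow> real"
  assumes k: "integrable lborel k" and e: "0 < e"
  shows "\<exists>N\<ge>N0. \<bar>k N\<bar> < e"
proof (rule ccontr)
  assume "\<not> ?thesis"
  then have ge: "\<And>N. N \<ge> N0 \<Longrightarrow> e \<le> \<bar>k N\<bar>" by force
  have "integrable lborel (\<lambda>x. e * indicator {N0..} x)"
    by (rule Bochner_Integration.integrable_bound[OF integrable_norm[OF k]])
       (use ge e in \<open>auto split: split_indicator\<close>)
  then have "integrable lborel (indicator {N0..} :: real \<Rightarrow> real)" using e by simp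
  then have "emeasure lborel {N0..} < \<infinity>" by (simp add: integrable_indicator_iff)
  moreover have "emeasure lborel {N0..} \<ge> emeasure lborel {N0..N0 + real n}" for n
    by (intro emeasure_mono) auto
  ultimately obtain c where c: "0 \<le> c" "emeasure lborel {N0..} = ennreal c"
    by (cases "emeasure lborel {N0..}") (auto simp: less_top)
  obtain n :: nat where "c < real n" using reals_Archimedean2 by blast
  with \<open>emeasure lborel {N0..N0 + real n} \<le> _\<close> c show False by (simp add: ennreal_le_iff)
qed

lemma integral_on_symmetric_interval_tendsto:
  fixes h :: "real \<Rightarrow> real"
  assumes h: "integrable lborel h"
  shows "((\<lambda>N. \<integral>x. indicator {-N..N} x * h x \<partial>lborel) \<longlongrightarrow> (\<integral>x. h x \<partial>lborel)) at_top"
proof (rule integral_dominated_convergence_at_top[where w = "\<lambda>x. \<bar>h x\<bar>"])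
  show "AE x in lborel. ((\<lambda>N. indicat_real {-N..N} x * h x) \<longlongrightarrow> h x) at_top"
  proof (rule AE_I2)
    fix x
    have "eventually (\<lambda>N. indicat_real {-N..N} x * h x = h x) at_top"
      using eventually_ge_at_top[of "\<bar>x\<bar>"] by eventually_elim (auto split: split_indicator)
    then show "((\<lambda>N. indicat_real {-N..N} x * h x) \<longlongrightarrow> h x) at_top" by (rule tendsto_eventually)
  qed
qed (use h in \<open>auto intro!: always_eventually split: split_indicator\<close>)

lemma DERIV_everywhere_continuous:
  fixes f f' :: "real \<Rightarrow> real"
  assumes "\<And>x. (f has_real_derivative f' x) (at x)"
  shows "continuous_on UNIV f"
  by (rule DERIV_continuous_on) (use assms in simp)

lemma integral_derivative_interval:
  fixes h h' :: "real \<Rightarrow> real"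
  assumes "\<And>x. (h has_real_derivative h' x) (at x)" "continuous_on UNIV h'" "a \<le> b"
  shows "(\<integral>x. indicator {a..b} x * h' x \<partial>lborel) = h b - h a"
  using integral_FTC_atLeastAtMost[of a b h h'] assms
  by (auto simp: mult.commute has_real_derivative_iff_has_vector_derivative
      intro: has_vector_derivative_at_within continuous_on_subset)

text \<open>Boundary terms are made small at one well-chosen N only; the symmetric integrals
  converge anyway because \<open>h'\<close> is integrable.\<close>

lemma integral_derivative_zero:
  fixes h h' :: "real \<Rightarrow> real"
  assumes d: "\<And>x. (h has_real_derivative h' x) (at x)" and c: "continuous_on UNIV h'"
    and hi: "integrable lborel h" and hi': "integrable lborel h'"
  shows "(\<integral>x. h' x \<partial>lborel) = 0"
proof (rule ccontr)
  let ?L = "\<integral>x. h' x \<partial>lborel"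
  assume L: "?L \<noteq> 0"
  \<comment> \<open>Adding the reflected function makes one N good for both ends.\<close>
  have k: "integrable lborel (\<lambda>x. \<bar>h x\<bar> + \<bar>h (0 + (-1) * x)\<bar>)"
    using lborel_integrable_real_affine[OF hi, of "-1" 0] hi by auto
  have "eventually (\<lambda>N. dist (\<integral>x. indicator {-N..N} x * h' x \<partial>lborel) ?L < \<bar>?L\<bar> / 2) at_top"
    using tendstoD[OF integral_on_symmetric_interval_tendsto[OF hi'], of "\<bar>?L\<bar>/2"] L by simp
  then obtain N0 where N0: "\<And>N. N \<ge> N0 \<Longrightarrow> dist (\<integral>x. indicator {-N..N} x * h' x \<partial>lborel) ?L < \<bar>?L\<bar> / 2"
    by (auto simp: eventually_at_top_linorder)
  obtain N where N: "N \<ge> max 0 N0" "\<bar>\<bar>h N\<bar> + \<bar>h (0 + (-1) * N)\<bar>\<bar> < \<bar>?L\<bar> / 2"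
    using integrable_small_value[OF k, of "\<bar>?L\<bar>/2" "max 0 N0"] L by auto
  have "(\<integral>x. indicator {-N..N} x * h' x \<partial>lborel) = h N - h (-N)"
    by (rule integral_derivative_interval[OF d c]) (use N in auto)
  moreover have "\<bar>h N - h (-N) - ?L\<bar> < \<bar>?L\<bar> / 2"
    using N0[of N] N(1) calculation by (simp add: dist_real_def)
  moreover have "\<bar>h N\<bar> + \<bar>h (-N)\<bar> < \<bar>?L\<bar> / 2" using N(2) by simp
  ultimately show False by linarith
qed

text \<open>The factor 1/2 comes from reaching x by integrating \<open>h'\<close> from the left and
  from the right and averaging the two. It is responsible for the constant in
  \<open>sup_square_le\<close>.\<close>

lemma abs_le_half_integral_derivative:
  fixes h h' :: "real \<Rightarrow> real"
  assumes d: "\<And>x. (h has_real_derivative h' x) (at x)" and c: "continuous_on UNIV h'"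
    and hi: "integrable lborel h" and hi': "integrable lborel h'"
  shows "\<bar>h x\<bar> \<le> (\<integral>x. \<bar>h' x\<bar> \<partial>lborel) / 2"
proof (rule field_le_epsilon)
  fix e :: real assume e: "0 < e"
  let ?L = "\<integral>x. \<bar>h' x\<bar> \<partial>lborel"
  have k: "integrable lborel (\<lambda>x. \<bar>h x\<bar> + \<bar>h (0 + (-1) * x)\<bar>)"
    using lborel_integrable_real_affine[OF hi, of "-1" 0] hi by auto
  obtain N where N: "N \<ge> \<bar>x\<bar>" "\<bar>\<bar>h N\<bar> + \<bar>h (0 + (-1) * N)\<bar>\<bar> < e"
    using integrable_small_value[OF k e] by auto
  have ii: "integrable lborel (\<lambda>y. indicator {a..b} y * h' y)" for a b :: real
    by (rule Bochner_Integration.integrable_bound[OF hi']) (use hi' in \<open>auto split: split_indicator\<close>)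
  have 1: "(\<integral>y. indicator {-N..x} y * h' y \<partial>lborel) = h x - h (-N)"
    by (rule integral_derivative_interval[OF d c]) (use N in auto)
  have 2: "(\<integral>y. indicator {x..N} y * h' y \<partial>lborel) = h N - h x"
    by (rule integral_derivative_interval[OF d c]) (use N in auto)
  have "2 * h x - h N - h (-N) = (\<integral>y. (indicator {-N..x} y - indicator {x..N} y) * h' y \<partial>lborel)"
    using 1 2 ii by (simp add: left_diff_distrib)
  also have "\<bar>\<dots>\<bar> \<le> ?L"
    by (rule integral_abs_bound_integral)
       (use hi' ii[of "-N" x] ii[of x N] in \<open>auto simp: left_diff_distrib split: split_indicator\<close>)
  finally have "\<bar>2 * h x - h N - h (-N)\<bar> \<le> ?L" .
  then show "\<bar>h x\<bar> \<le> ?L / 2 + e" using N(2) by auto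
qed

section \<open>Difference quotients and mean-square derivatives\<close>

definition diffq :: "real \<Rightarrow> (real \<Rightarrow> real) \<Rightarrow> real \<Rightarrow> real" where
  "diffq e f x = (f (x + e) - f x) / e"

text \<open>One number bounds the sup norms and the squared L^2 norms alike, so that a bound uniform
  in time can be carried as a single parameter.\<close>

definition regular :: "real \<Rightarrow> (real \<Rightarrow> real) \<Rightarrow> (real \<Rightarrow> real) \<Rightarrow> bool" where
  "regular M f f' \<longleftrightarrow> (\<forall>x. (f has_real_derivative f' x) (at x)) \<and> continuous_on UNIV f' \<and>
     (\<forall>x. \<bar>f x\<bar> \<le> M \<and> \<bar>f' x\<bar> \<le> M) \<and>
     integrable lborel (\<lambda>x. (f x)\<^sup>2) \<and> integrable lborel (\<lambda>x. (f' x)\<^sup>2) \<and>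
     (\<integral>x. (f x)\<^sup>2 \<partial>lborel) \<le> M \<and> (\<integral>x. (f' x)\<^sup>2 \<partial>lborel) \<le> M"

lemma regularD:
  assumes "regular M f f'"
  shows "(f has_real_derivative f' x) (at x)" "continuous_on UNIV f'" "\<bar>f x\<bar> \<le> M" "\<bar>f' x\<bar> \<le> M"
    "integrable lborel (\<lambda>x. (f x)\<^sup>2)" "integrable lborel (\<lambda>x. (f' x)\<^sup>2)"
    "(\<integral>x. (f x)\<^sup>2 \<partial>lborel) \<le> M" "(\<integral>x. (f' x)\<^sup>2 \<partial>lborel) \<le> M"
    "continuous_on UNIV f" "f \<in> borel_measurable borel" "f' \<in> borel_measurable borel" "0 \<le> M"
proof -
  show *: "(f has_real_derivative f' x) (at x)" "continuous_on UNIV f'" "\<bar>f x\<bar> \<le> M" "\<bar>f' x\<bar> \<le> M"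
    "integrable lborel (\<lambda>x. (f x)\<^sup>2)" "integrable lborel (\<lambda>x. (f' x)\<^sup>2)"
    "(\<integral>x. (f x)\<^sup>2 \<partial>lborel) \<le> M" "(\<integral>x. (f' x)\<^sup>2 \<partial>lborel) \<le> M" for x
    using assms by (auto simp: regular_def)
  show c: "continuous_on UNIV f" by (rule DERIV_everywhere_continuous[OF *(1)])
  show "f \<in> borel_measurable borel" "f' \<in> borel_measurable borel"
    using c *(2) by (auto intro: borel_measurable_continuous_onI)
  show "0 \<le> M" using *(3)[of 0] by linarith
qed

lemma diffq_measurable[measurable]:
  assumes [measurable]: "f \<in> borel_measurable borel"
  shows "diffq e f \<in> borel_measurable borel"
  unfolding diffq_def[abs_def] by measurable

lemma diffq_abs_le:
  assumes "\<And>x. (f has_real_derivative f' x) (at x)" "\<And>x. \<bar>f' x\<bar> \<le> M" "0 < e"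
  shows "\<bar>diffq e f x\<bar> \<le> M"
proof -
  obtain z where "f (x + e) - f x = (x + e - x) * f' z"
    using MVT2[of x "x + e" f f'] assms by auto
  then have "diffq e f x = f' z" using assms by (simp add: diffq_def)
  then show ?thesis using assms by simp
qed

lemma diffq_tendsto:
  assumes "(f has_real_derivative d) (at x)"
  shows "(\<lambda>n. diffq (1 / real (Suc n)) f x) \<longlonglongrightarrow> d"
proof -
  have "((\<lambda>h. (f (x + h) - f x) / h) \<longlongrightarrow> d) (at 0)" using assms by (simp add: DERIV_def)
  moreover have "filterlim (\<lambda>n. 1 / real (Suc n)) (at 0) sequentially"
    using LIMSEQ_Suc[OF lim_1_over_n] by (auto simp: filterlim_at simp del: of_nat_Suc)
  ultimately show ?thesis unfolding diffq_def by (rule filterlim_compose)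
qed

lemma nn_integral_translate:
  fixes f :: "real \<Rightarrow> ennreal"
  assumes "f \<in> borel_measurable borel"
  shows "(\<integral>\<^sup>+x. f (x + t) \<partial>lborel) = (\<integral>\<^sup>+x. f x \<partial>lborel)"
  using nn_integral_real_affine[of f 1 t] assms by (simp add: add.commute)

text \<open>A difference quotient is the mean of \<open>f'\<close> over \<open>[x, x + e]\<close>.
  By Cauchy-Schwarz its square is at most the mean of the squares, and Fubini with translation
  invariance integrates this in x. That the constant is exactly 1 matters:
  \<open>generalized_dominated_convergence\<close> wants the integrals of the majorants not to
  exceed that of their limit.\<close>

lemma diffq_square_integral_le:
  assumes d: "\<And>x. (f has_real_derivative f' x) (at x)" and c: "continuous_on UNIV f'"
    and i: "integrable lborel (\<lambda>x. (f' x)\<^sup>2)" and e: "0 < e"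
  shows "integrable lborel (\<lambda>x. (diffq e f x)\<^sup>2)"
    "(\<integral>x. (diffq e f x)\<^sup>2 \<partial>lborel) \<le> (\<integral>x. (f' x)\<^sup>2 \<partial>lborel)"
proof -
  have [measurable]: "f' \<in> borel_measurable borel" using c by (rule borel_measurable_continuous_onI)
  have "continuous_on UNIV f" by (rule DERIV_everywhere_continuous[OF d])
  then have [measurable]: "f \<in> borel_measurable borel" by (rule borel_measurable_continuous_onI)
  have cI: "continuous_on {0..e} (\<lambda>\<theta>. f' (x + \<theta>))" for x
    by (intro continuous_on_compose2[OF c] continuous_intros) auto
  have pw: "ennreal ((diffq e f x)\<^sup>2) \<le> (\<integral>\<^sup>+\<theta>. ennreal (indicator {0..e} \<theta> / e) * ennreal ((f' (x + \<theta>))\<^sup>2) \<partial>lborel)" for x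
  proof -
    have ind2: "(indicat_real {0..e} \<theta>)\<^sup>2 = indicat_real {0..e} \<theta>" for \<theta> by (auto split: split_indicator)
    have ib: "integrable lborel (\<lambda>\<theta>. indicator {0..e} \<theta> * g (x + \<theta>))" if "continuous_on UNIV g" for g :: "real \<Rightarrow> real"
    proof -
      have "set_integrable lborel {0..e} (\<lambda>\<theta>. g (x + \<theta>))"
        by (rule borel_integrable_atLeastAtMost') (intro continuous_on_compose2[OF that] continuous_intros, auto)
      then show ?thesis by (simp add: set_integrable_def)
    qed
    have sh: "((\<lambda>\<theta>. f (x + \<theta>)) has_real_derivative f' (x + \<theta>)) (at \<theta>)" for \<theta>
      using d[of "\<theta> + x"] unfolding DERIV_shift by (simp add: add.commute)
    have "(\<integral>\<theta>. indicator {0..e} \<theta> * f' (x + \<theta>) \<partial>lborel) = f (x + e) - f (x + 0)"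
      using e c by (intro integral_derivative_interval[where h = "\<lambda>\<theta>. f (x + \<theta>)"])
        (auto intro!: continuous_on_compose2[OF c] continuous_intros sh)
    \<comment> \<open>The indicator is doubled so that each factor of Cauchy-Schwarz receives a
      copy; the square integral of the first factor is then \<open>e\<close>.\<close>
    then have D: "diffq e f x = (\<integral>\<theta>. indicator {0..e} \<theta> * (indicator {0..e} \<theta> * f' (x + \<theta>)) \<partial>lborel) / e"
      by (simp add: diffq_def indicator_inter_arith[symmetric] mult.assoc[symmetric])
    have c2: "continuous_on UNIV (\<lambda>y. (f' y)\<^sup>2)" by (intro continuous_intros c)
    have sq: "integrable lborel (\<lambda>\<theta>. (indicator {0..e} \<theta> * f' (x + \<theta>))\<^sup>2)"
      "(\<lambda>\<theta>. (indicator {0..e} \<theta> * f' (x + \<theta>))\<^sup>2) = (\<lambda>\<theta>. indicator {0..e} \<theta> * (f' (x + \<theta>))\<^sup>2)"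
      using ib[OF c2] by (auto simp: power_mult_distrib ind2)
    have "(diffq e f x)\<^sup>2 \<le> ((\<integral>\<theta>. (indicat_real {0..e} \<theta>)\<^sup>2 \<partial>lborel) * (\<integral>\<theta>. (indicator {0..e} \<theta> * f' (x + \<theta>))\<^sup>2 \<partial>lborel)) / e\<^sup>2"
      unfolding D power_divide using e sq
      by (intro divide_right_mono Cauchy_Schwarz_integral) (auto simp: ind2)
    also have "\<dots> = (\<integral>\<theta>. indicator {0..e} \<theta> / e * (f' (x + \<theta>))\<^sup>2 \<partial>lborel)"
      using e by (simp add: sq(2) ind2 power2_eq_square[of e])
    finally have "ennreal ((diffq e f x)\<^sup>2) \<le> ennreal (\<integral>\<theta>. indicator {0..e} \<theta> / e * (f' (x + \<theta>))\<^sup>2 \<partial>lborel)"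
      using e by (intro ennreal_leI)
    also have "\<dots> = (\<integral>\<^sup>+\<theta>. ennreal (indicator {0..e} \<theta> / e * (f' (x + \<theta>))\<^sup>2) \<partial>lborel)"
      using ib[OF c2] e by (intro nn_integral_eq_integral[symmetric]) auto
    finally show ?thesis using e by (simp add: ennreal_mult[symmetric])
  qed
  have "(\<integral>\<^sup>+x. ennreal ((diffq e f x)\<^sup>2) \<partial>lborel) \<le>
      (\<integral>\<^sup>+x. (\<integral>\<^sup>+\<theta>. ennreal (indicator {0..e} \<theta> / e) * ennreal ((f' (x + \<theta>))\<^sup>2) \<partial>lborel) \<partial>lborel)"
    by (intro nn_integral_mono pw)
  also have "\<dots> = (\<integral>\<^sup>+\<theta>. (\<integral>\<^sup>+x. ennreal (indicator {0..e} \<theta> / e) * ennreal ((f' (x + \<theta>))\<^sup>2) \<partial>lborel) \<partial>lborel)"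
    by (rule lborel_pair.Fubini') measurable
  also have "\<dots> = (\<integral>\<^sup>+\<theta>. ennreal (indicator {0..e} \<theta> / e) * (\<integral>\<^sup>+x. ennreal ((f' x)\<^sup>2) \<partial>lborel) \<partial>lborel)"
    by (intro nn_integral_cong) (simp add: nn_integral_cmult nn_integral_translate[where f = "\<lambda>x. ennreal ((f' x)\<^sup>2)"])
  also have "\<dots> = (\<integral>\<^sup>+\<theta>. ennreal (1 / e) * indicator {0..e} \<theta> \<partial>lborel) * (\<integral>\<^sup>+x. ennreal ((f' x)\<^sup>2) \<partial>lborel)"
    by (subst nn_integral_multc[symmetric]) (auto intro!: nn_integral_cong split: split_indicator)
  also have "\<dots> = (\<integral>\<^sup>+x. ennreal ((f' x)\<^sup>2) \<partial>lborel)"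
    using e by (subst nn_integral_cmult_indicator) (auto simp: ennreal_mult'[symmetric])
  also have "\<dots> = ennreal (\<integral>x. (f' x)\<^sup>2 \<partial>lborel)"
    using i by (intro nn_integral_eq_integral) auto
  finally have *: "(\<integral>\<^sup>+x. ennreal ((diffq e f x)\<^sup>2) \<partial>lborel) \<le> ennreal (\<integral>x. (f' x)\<^sup>2 \<partial>lborel)" .
  show ii: "integrable lborel (\<lambda>x. (diffq e f x)\<^sup>2)"
    by (rule integrableI_nonneg) (use * in \<open>auto simp: less_top[symmetric] top_unique\<close>)
  show "(\<integral>x. (diffq e f x)\<^sup>2 \<partial>lborel) \<le> (\<integral>x. (f' x)\<^sup>2 \<partial>lborel)"
    using * by (subst (asm) nn_integral_eq_integral[OF ii]) auto
qed

lemma integrable_translate: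
  fixes f :: "real \<Rightarrow> real"
  shows "integrable lborel f \<Longrightarrow> integrable lborel (\<lambda>x. f (x + t))"
  using lborel_integrable_real_affine[of f 1 t] by (simp add: add.commute)

lemma integral_translate:
  fixes f :: "real \<Rightarrow> real"
  shows "(\<integral>x. f (x + t) \<partial>lborel) = (\<integral>x. f x \<partial>lborel)"
  using lborel_integral_real_affine[of 1 f t] by (simp add: add.commute)

text \<open>The constant blows up as e tends to 0, but no derivative of f enters: the bound is
  applied at fixed e to errors that are controlled in L^2 only.\<close>

lemma diffq_square_crude:
  assumes [measurable]: "f \<in> borel_measurable borel" and i: "integrable lborel (\<lambda>x. (f x)\<^sup>2)" and e: "0 < e"
  shows "integrable lborel (\<lambda>x. (diffq e f x)\<^sup>2)"
    "(\<integral>x. (diffq e f x)\<^sup>2 \<partial>lborel) \<le> 4 / e\<^sup>2 * (\<integral>x. (f x)\<^sup>2 \<partial>lborel)"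
proof -
  note it = integrable_translate[OF i, of e]
  have le: "(diffq e f x)\<^sup>2 \<le> (2 * (f (x + e))\<^sup>2 + 2 * (f x)\<^sup>2) / e\<^sup>2" for x
    using square_add_le[of "f (x + e)" "- f x"] e by (auto simp: diffq_def power_divide intro!: divide_right_mono)
  have ib: "integrable lborel (\<lambda>x. (2 * (f (x + e))\<^sup>2 + 2 * (f x)\<^sup>2) / e\<^sup>2)" using i it by simp
  show ii: "integrable lborel (\<lambda>x. (diffq e f x)\<^sup>2)"
    by (rule Bochner_Integration.integrable_bound[OF ib]) (use le order_trans[OF le abs_ge_self] in auto)
  have "(\<integral>x. (diffq e f x)\<^sup>2 \<partial>lborel) \<le> (\<integral>x. (2 * (f (x + e))\<^sup>2 + 2 * (f x)\<^sup>2) / e\<^sup>2 \<partial>lborel)"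
    by (intro integral_mono ii ib le)
  also have "\<dots> = 4 / e\<^sup>2 * (\<integral>x. (f x)\<^sup>2 \<partial>lborel)"
    using i it integral_translate[of "\<lambda>x. (f x)\<^sup>2" e] by simp
  finally show "(\<integral>x. (diffq e f x)\<^sup>2 \<partial>lborel) \<le> 4 / e\<^sup>2 * (\<integral>x. (f x)\<^sup>2 \<partial>lborel)" .
qed

text \<open>The second part concerns the derivative of the polynomial in the first. With
  \<open>a = 1, b = 0\<close> it is the energy, with \<open>a = 0, b = 1\<close> the cubic
  functional, so that both balance laws share one proof.\<close>

lemma integrable_poly_of_square:
  fixes f :: "'a \<Rightarrow> real"
  assumes [measurable]: "f \<in> borel_measurable M" and i: "integrable M (\<lambda>x. (f x)\<^sup>2)"
    and b: "\<And>x. \<bar>f x\<bar> \<le> C"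
  shows "integrable M (\<lambda>x. a * (f x)\<^sup>2 + b * (f x) ^ 3)" "integrable M (\<lambda>x. (2 * a * f x + 3 * b * (f x)\<^sup>2)\<^sup>2)"
proof -
  have "integrable M (\<lambda>x. f x * f x * f x)"
  proof (rule Bochner_Integration.integrable_bound)
    show "integrable M (\<lambda>x. C * (f x)\<^sup>2)" using i by simp
    show "AE x in M. norm (f x * f x * f x) \<le> norm (C * (f x)\<^sup>2)"
    proof (rule AE_I2)
      fix x
      have "\<bar>f x\<bar> * (f x)\<^sup>2 \<le> \<bar>C\<bar> * (f x)\<^sup>2" using b[of x] by (intro mult_right_mono) auto
      then show "norm (f x * f x * f x) \<le> norm (C * (f x)\<^sup>2)" by (simp add: abs_mult power2_eq_square mult_ac)
    qed
  qed measurable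
  then show "integrable M (\<lambda>x. a * (f x)\<^sup>2 + b * (f x) ^ 3)"
    using i by (auto simp: power3_eq_cube)
  have "integrable M (\<lambda>x. ((2 * a + 3 * b * f x) * f x)\<^sup>2)"
  proof (rule integrable_square_bounded_mult)
    show "\<bar>2 * a + 3 * b * f x\<bar> \<le> 2 * \<bar>a\<bar> + 3 * \<bar>b\<bar> * C" for x
    proof -
      have "\<bar>b\<bar> * \<bar>f x\<bar> \<le> \<bar>b\<bar> * C" by (intro mult_left_mono b) auto
      then show ?thesis using abs_triangle_ineq[of "2 * a" "3 * b * f x"] by (simp add: abs_mult)
    qed
  qed (use i in measurable)
  then show "integrable M (\<lambda>x. (2 * a * f x + 3 * b * (f x)\<^sup>2)\<^sup>2)"
    by (simp add: power2_eq_square algebra_simps)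
qed

text \<open>Chain rule for a curve that is differentiable at t only in mean square. The sup bound M
  controls the cubic term, for which L^2 information alone would not do.\<close>

lemma has_derivative_integral_of_L2_derivative:
  fixes G :: "real \<Rightarrow> real \<Rightarrow> real" and g :: "real \<Rightarrow> real" and a b t M :: real
  assumes t: "t \<in> J"
    and m: "\<And>s. s \<in> J \<Longrightarrow> G s \<in> borel_measurable borel"
    and i: "\<And>s. s \<in> J \<Longrightarrow> integrable lborel (\<lambda>x. (G s x)\<^sup>2)"
    and M: "\<And>s x. s \<in> J \<Longrightarrow> \<bar>G s x\<bar> \<le> M"
    and gm[measurable]: "g \<in> borel_measurable borel" and gi: "integrable lborel (\<lambda>x. (g x)\<^sup>2)"
    and lim: "((\<lambda>s. \<integral>x. ((G s x - G t x) / (s - t) - g x)\<^sup>2 \<partial>lborel) \<longlongrightarrow> 0) (at t within J)"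
  shows "((\<lambda>s. \<integral>x. a * (G s x)\<^sup>2 + b * (G s x) ^ 3 \<partial>lborel) has_real_derivative
     (\<integral>x. (2 * a * G t x + 3 * b * (G t x)\<^sup>2) * g x \<partial>lborel)) (at t within J)"
proof -
  note [measurable] = m[OF t]
  define r where "r s = (\<integral>x. ((G s x - G t x) / (s - t) - g x)\<^sup>2 \<partial>lborel)" for s
  define p where "p x = 2 * a * G t x + 3 * b * (G t x)\<^sup>2" for x
  define P where "P = (\<integral>x. (p x)\<^sup>2 \<partial>lborel)"
  define C where "C = \<bar>a\<bar> + 3 * \<bar>b\<bar> * M"
  define N where "N s = (\<integral>x. a * (G s x)\<^sup>2 + b * (G s x) ^ 3 \<partial>lborel)" for s
  \<comment> \<open>The first term is Cauchy-Schwarz for \<open>p * (q - g)\<close>; the second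
    estimates the Taylor remainder \<open>R\<close> by splitting \<open>q\<close> into
    \<open>q - g\<close> and \<open>g\<close>.\<close>
  define B where "B s = sqrt (P * r s) + \<bar>s - t\<bar> * (C * (2 * r s + 2 * (\<integral>x. (g x)\<^sup>2 \<partial>lborel)))" for s
  have [measurable]: "p \<in> borel_measurable borel" unfolding p_def by measurable
  have pi: "integrable lborel (\<lambda>x. (p x)\<^sup>2)"
    unfolding p_def by (rule integrable_poly_of_square) (use t i M in auto)
  have bound: "\<bar>(N s - N t) / (s - t) - (\<integral>x. p x * g x \<partial>lborel)\<bar> \<le> B s" if s: "s \<in> J" "s \<noteq> t" for s
  proof -
    note [measurable] = m[OF s(1)]
    define q where "q x = (G s x - G t x) / (s - t)" for x
    have [measurable]: "q \<in> borel_measurable borel" unfolding q_def by measurable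
    have qi: "integrable lborel (\<lambda>x. (q x)\<^sup>2)"
    proof -
      have "integrable lborel (\<lambda>x. (G s x + - G t x)\<^sup>2)"
        by (rule integrable_square_add) (use i s t in auto)
      then have "integrable lborel (\<lambda>x. (G s x + - G t x)\<^sup>2 / (s - t)\<^sup>2)" by simp
      then show ?thesis by (simp add: q_def power_divide)
    qed
    have qgi: "integrable lborel (\<lambda>x. (q x - g x)\<^sup>2)"
      using integrable_square_add[of q lborel "\<lambda>x. - g x"] qi gi by simp
    have pq: "integrable lborel (\<lambda>x. p x * (q x - g x))"
      by (rule integrable_mult_of_square) (use pi qgi in auto)
    have pg: "integrable lborel (\<lambda>x. p x * g x)"
      by (rule integrable_mult_of_square) (use pi gi in auto)
    define R where "R x = (s - t) * ((a + b * (G s x + 2 * G t x)) * (q x)\<^sup>2)" for x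
    have ab: "\<bar>a + b * (G s x + 2 * G t x)\<bar> \<le> C" for x
    proof -
      have "\<bar>b\<bar> * \<bar>G s x + 2 * G t x\<bar> \<le> \<bar>b\<bar> * (3 * M)"
        using M[OF s(1), of x] M[OF t, of x] by (intro mult_left_mono) auto
      then show ?thesis unfolding C_def using abs_triangle_ineq[of a "b * (G s x + 2 * G t x)"] by (simp add: abs_mult)
    qed
    have Cq: "\<bar>(a + b * (G s x + 2 * G t x)) * (q x)\<^sup>2\<bar> \<le> C * (q x)\<^sup>2" for x
      using ab[of x] by (auto simp: abs_mult intro!: mult_right_mono)
    have "integrable lborel (\<lambda>x. (a + b * (G s x + 2 * G t x)) * (q x)\<^sup>2)"
    proof (rule Bochner_Integration.integrable_bound[of lborel "\<lambda>x. C * (q x)\<^sup>2"])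
      show "AE x in lborel. norm ((a + b * (G s x + 2 * G t x)) * (q x)\<^sup>2) \<le> norm (C * (q x)\<^sup>2)"
        using order_trans[OF Cq abs_ge_self] by simp
    qed (use qi in auto)
    then have Ri: "integrable lborel R" unfolding R_def by simp
    \<comment> \<open>Exact Taylor expansion about \<open>G t x\<close>: with
      \<open>G s = G t + (s - t) * q\<close> the second and third order terms combine to
      \<open>R\<close>.\<close>
    have alg: "(a * (G s x)\<^sup>2 + b * (G s x) ^ 3 - (a * (G t x)\<^sup>2 + b * (G t x) ^ 3)) / (s - t)
        = p x * (q x - g x) + p x * g x + R x" for x
    proof -
      have Gs: "G s x = G t x + (s - t) * q x" using s by (simp add: q_def)
      have "a * (G s x)\<^sup>2 + b * (G s x) ^ 3 - (a * (G t x)\<^sup>2 + b * (G t x) ^ 3)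
         = (s - t) * (p x * (q x - g x) + p x * g x + R x)"
        unfolding R_def p_def Gs by (simp add: algebra_simps power2_eq_square power3_eq_cube)
      then show ?thesis using s by simp
    qed
    have "(N s - N t) / (s - t) = (\<integral>x. (a * (G s x)\<^sup>2 + b * (G s x) ^ 3 - (a * (G t x)\<^sup>2 + b * (G t x) ^ 3)) / (s - t) \<partial>lborel)"
      unfolding N_def
      using integrable_poly_of_square(1)[OF _ i[OF s(1)] M[OF s(1)], of a b]
        integrable_poly_of_square(1)[OF _ i[OF t] M[OF t], of a b] by simp
    also have "\<dots> = (\<integral>x. p x * (q x - g x) \<partial>lborel) + (\<integral>x. p x * g x \<partial>lborel) + (\<integral>x. R x \<partial>lborel)"
      unfolding alg using pq pg Ri by simp
    finally have eq: "(N s - N t) / (s - t) - (\<integral>x. p x * g x \<partial>lborel)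
        = (\<integral>x. p x * (q x - g x) \<partial>lborel) + (\<integral>x. R x \<partial>lborel)" by simp
    have "(\<integral>x. p x * (q x - g x) \<partial>lborel)\<^sup>2 \<le> P * r s"
      using Cauchy_Schwarz_integral[OF _ _ pi qgi] by (simp add: P_def r_def q_def)
    then have 1: "\<bar>\<integral>x. p x * (q x - g x) \<partial>lborel\<bar> \<le> sqrt (P * r s)"
      using real_sqrt_le_mono by fastforce
    have q2: "(q x)\<^sup>2 \<le> 2 * (q x - g x)\<^sup>2 + 2 * (g x)\<^sup>2" for x
      using square_add_le[of "q x - g x" "g x"] by simp
    have C0: "0 \<le> C" using ab[of 0] by linarith
    have "\<bar>\<integral>x. R x \<partial>lborel\<bar> = \<bar>s - t\<bar> * \<bar>\<integral>x. (a + b * (G s x + 2 * G t x)) * (q x)\<^sup>2 \<partial>lborel\<bar>"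
      unfolding R_def by (simp add: abs_mult)
    also have "\<bar>\<integral>x. (a + b * (G s x + 2 * G t x)) * (q x)\<^sup>2 \<partial>lborel\<bar> \<le> (\<integral>x. C * (2 * (q x - g x)\<^sup>2 + 2 * (g x)\<^sup>2) \<partial>lborel)"
    proof (rule integral_abs_bound_integral)
      show "integrable lborel (\<lambda>x. (a + b * (G s x + 2 * G t x)) * (q x)\<^sup>2)"
        using Ri s unfolding R_def by simp
      show "\<bar>(a + b * (G s x + 2 * G t x)) * (q x)\<^sup>2\<bar> \<le> C * (2 * (q x - g x)\<^sup>2 + 2 * (g x)\<^sup>2)" for x
        using Cq[of x] mult_left_mono[OF q2 C0] by (rule order_trans)
    qed (use qgi gi in auto)
    also have "\<dots> = C * (2 * r s + 2 * (\<integral>x. (g x)\<^sup>2 \<partial>lborel))"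
      using qgi gi by (simp add: r_def q_def)
    finally have 2: "\<bar>\<integral>x. R x \<partial>lborel\<bar> \<le> \<bar>s - t\<bar> * (C * (2 * r s + 2 * (\<integral>x. (g x)\<^sup>2 \<partial>lborel)))"
      by (simp add: mult_left_mono)
    show ?thesis unfolding eq B_def using 1 2 by linarith
  qed
  have r0: "(r \<longlongrightarrow> 0) (at t within J)" using lim unfolding r_def .
  have "(B \<longlongrightarrow> sqrt (P * 0) + \<bar>t - t\<bar> * (C * (2 * 0 + 2 * (\<integral>x. (g x)\<^sup>2 \<partial>lborel)))) (at t within J)"
    unfolding B_def by (intro tendsto_intros r0)
  then have B0: "(B \<longlongrightarrow> 0) (at t within J)" by simp
  have "((\<lambda>s. (N s - N t) / (s - t) - (\<integral>x. p x * g x \<partial>lborel)) \<longlongrightarrow> 0) (at t within J)"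
    by (rule Lim_null_comparison[OF _ B0]) (use bound in \<open>auto simp: eventually_at_filter\<close>)
  then have "((\<lambda>s. (N s - N t) / (s - t)) \<longlongrightarrow> (\<integral>x. p x * g x \<partial>lborel)) (at t within J)"
    by (rule LIM_zero_cancel)
  then show ?thesis unfolding has_field_derivative_iff N_def p_def .
qed

section \<open>Transport equations\<close>

lemma integrable_bounded_mult:
  fixes f g :: "'a \<Rightarrow> real"
  assumes [measurable]: "f \<in> borel_measurable M" and g: "integrable M g" and b: "\<And>x. \<bar>f x\<bar> \<le> C"
  shows "integrable M (\<lambda>x. f x * g x)"
proof (rule Bochner_Integration.integrable_bound)
  show "integrable M (\<lambda>x. C * \<bar>g x\<bar>)" using g by simp
  show "AE x in M. norm (f x * g x) \<le> norm (C * \<bar>g x\<bar>)"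
  proof (rule AE_I2)
    fix x
    have "\<bar>f x\<bar> * \<bar>g x\<bar> \<le> \<bar>C\<bar> * \<bar>g x\<bar>" using b[of x] by (intro mult_right_mono) auto
    then show "norm (f x * g x) \<le> norm (C * \<bar>g x\<bar>)" by (simp add: abs_mult)
  qed
qed (use g in measurable)

lemma abs_mult_le_sum_squares: "\<bar>(a::real) * b\<bar> \<le> a\<^sup>2 + b\<^sup>2"
proof -
  have "0 \<le> (\<bar>a\<bar> - \<bar>b\<bar>)\<^sup>2" by simp
  then have "2 * (\<bar>a\<bar> * \<bar>b\<bar>) \<le> a\<^sup>2 + b\<^sup>2" by (simp add: power2_diff)
  moreover have "0 \<le> \<bar>a\<bar> * \<bar>b\<bar>" by simp
  ultimately show ?thesis unfolding abs_mult by linarith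
qed

text \<open>To be read with d, q, r the difference quotients of c, S, A, with z a shifted value of
  \<open>c\<^sub>x\<close> and m a value of \<open>S\<^sub>x\<close>. The bound is linear in
  \<open>d\<^sup>2\<close>, \<open>q\<^sup>2\<close>, \<open>r\<^sup>2\<close>, whose integrals are
  controlled uniformly in e; all else is absorbed by sup bounds.\<close>

lemma transport_integrand_bound:
  fixes d q r z m M a b :: real
  assumes "\<bar>d\<bar> \<le> M" "\<bar>m\<bar> \<le> M" "\<bar>z\<bar> \<le> M" "0 \<le> M"
  shows "\<bar>m * (a * d\<^sup>2 + b * d ^ 3) - (2 * a * d + 3 * b * d\<^sup>2) * (q * z + r)\<bar>
    \<le> (M + 2 * M + 2) * (\<bar>a\<bar> + 3 * \<bar>b\<bar> * M + \<bar>a\<bar>) * (d\<^sup>2 + q\<^sup>2 + r\<^sup>2)"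
proof -
  \<comment> \<open>One constant for two factors: it bounds \<open>a + b * d\<close> as well as
    \<open>2 * a + 3 * b * d\<close>.\<close>
  define K where "K = \<bar>a\<bar> + 3 * \<bar>b\<bar> * M + \<bar>a\<bar>"
  have K0: "0 \<le> K" using assms unfolding K_def by simp
  have bd: "\<bar>b\<bar> * \<bar>d\<bar> \<le> \<bar>b\<bar> * M" using assms by (intro mult_left_mono) auto
  have 1: "\<bar>a + b * d\<bar> \<le> K"
    using abs_triangle_ineq[of a "b * d"] bd mult_nonneg_nonneg[OF abs_ge_zero[of b] assms(4)]
    unfolding K_def abs_mult by linarith
  have 2: "\<bar>2 * a + 3 * b * d\<bar> \<le> K"
    using abs_triangle_ineq[of "2 * a" "3 * b * d"] bd unfolding K_def by (simp add: abs_mult)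
  have t1: "\<bar>m * (a * d\<^sup>2 + b * d ^ 3)\<bar> \<le> M * (K * d\<^sup>2)"
  proof -
    have "m * (a * d\<^sup>2 + b * d ^ 3) = m * ((a + b * d) * d\<^sup>2)" by (simp add: algebra_simps power2_eq_square power3_eq_cube)
    moreover have "\<bar>m * ((a + b * d) * d\<^sup>2)\<bar> \<le> M * (K * d\<^sup>2)"
      unfolding abs_mult using assms 1 K0 by (intro mult_mono) auto
    ultimately show ?thesis by (simp only:)
  qed
  have qz: "\<bar>d * (q * z + r)\<bar> \<le> M * (d\<^sup>2 + q\<^sup>2) + (d\<^sup>2 + r\<^sup>2)"
  proof -
    have "\<bar>d * (q * z)\<bar> = \<bar>z\<bar> * \<bar>d * q\<bar>" by (simp add: abs_mult)
    also have "\<dots> \<le> M * (d\<^sup>2 + q\<^sup>2)" using assms abs_mult_le_sum_squares by (intro mult_mono) auto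
    finally show ?thesis using abs_mult_le_sum_squares[of d r] abs_triangle_ineq[of "d * (q * z)" "d * r"]
      unfolding distrib_left[of d] by linarith
  qed
  have t2: "\<bar>(2 * a * d + 3 * b * d\<^sup>2) * (q * z + r)\<bar> \<le> K * (M * (d\<^sup>2 + q\<^sup>2) + (d\<^sup>2 + r\<^sup>2))"
  proof -
    have "(2 * a * d + 3 * b * d\<^sup>2) * (q * z + r) = (2 * a + 3 * b * d) * (d * (q * z + r))"
      by (simp add: algebra_simps power2_eq_square)
    moreover have "\<bar>(2 * a + 3 * b * d) * (d * (q * z + r))\<bar> \<le> K * (M * (d\<^sup>2 + q\<^sup>2) + (d\<^sup>2 + r\<^sup>2))"
      unfolding abs_mult[of "2 * a + 3 * b * d"] using 2 qz K0 by (intro mult_mono) auto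
    ultimately show ?thesis by (simp only:)
  qed
  have "M * (K * d\<^sup>2) + K * (M * (d\<^sup>2 + q\<^sup>2) + (d\<^sup>2 + r\<^sup>2))
      = K * (M * d\<^sup>2 + M * (d\<^sup>2 + q\<^sup>2) + (d\<^sup>2 + r\<^sup>2))" by (simp add: algebra_simps)
  also have "\<dots> \<le> K * ((M + 2 * M + 2) * (d\<^sup>2 + q\<^sup>2 + r\<^sup>2))"
  proof (rule mult_left_mono[OF _ K0])
    have "0 \<le> M * d\<^sup>2" "0 \<le> M * q\<^sup>2" "0 \<le> M * r\<^sup>2" "0 \<le> d\<^sup>2" "0 \<le> q\<^sup>2" "0 \<le> r\<^sup>2" using assms by auto
    then show "M * d\<^sup>2 + M * (d\<^sup>2 + q\<^sup>2) + (d\<^sup>2 + r\<^sup>2) \<le> (M + 2 * M + 2) * (d\<^sup>2 + q\<^sup>2 + r\<^sup>2)"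
      by (simp add: algebra_simps)
  qed
  also have "\<dots> = (M + 2 * M + 2) * K * (d\<^sup>2 + q\<^sup>2 + r\<^sup>2)" by (simp add: mult.assoc mult.left_commute)
  finally have "M * (K * d\<^sup>2) + K * (M * (d\<^sup>2 + q\<^sup>2) + (d\<^sup>2 + r\<^sup>2)) \<le> (M + 2 * M + 2) * K * (d\<^sup>2 + q\<^sup>2 + r\<^sup>2)" .
  then have "\<bar>m * (a * d\<^sup>2 + b * d ^ 3)\<bar> + \<bar>(2 * a * d + 3 * b * d\<^sup>2) * (q * z + r)\<bar>
      \<le> (M + 2 * M + 2) * K * (d\<^sup>2 + q\<^sup>2 + r\<^sup>2)"
    by (rule order_trans[OF add_mono[OF t1 t2]])
  then show ?thesis unfolding K_def by (rule order_trans[OF abs_triangle_ineq4])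
qed

lemma diffq_DERIV:
  assumes "\<And>x. (f has_real_derivative f' x) (at x)"
  shows "(diffq e f has_real_derivative diffq e f' x) (at x)"
proof -
  have "((\<lambda>x. f (x + e)) has_real_derivative f' (x + e)) (at x)"
    using assms[of "x + e"] by (simp add: DERIV_shift)
  then show ?thesis unfolding diffq_def[abs_def] using assms[of x]
    by (auto intro!: derivative_eq_intros DERIV_cdivide)
qed

lemma regular_rhs:
  assumes S: "regular M S Sx" and c: "regular M c cx" and A: "regular M A Ax"
  shows "integrable lborel (\<lambda>x. (S x * cx x + A x)\<^sup>2)"
  using regularD[OF S] regularD[OF c] regularD[OF A]
  by (intro integrable_square_add integrable_square_bounded_mult) auto

lemma diffq_mean_tendsto:
  assumes c: "regular M c cx" and S: "regular M S Sx" and A: "regular M A Ax"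
    and m: "\<And>n. f n \<in> borel_measurable borel" "F \<in> borel_measurable borel"
    and b: "\<And>n x. \<bar>f n x\<bar> \<le> C * ((diffq (1 / real (Suc n)) c x)\<^sup>2 + (diffq (1 / real (Suc n)) S x)\<^sup>2
       + (diffq (1 / real (Suc n)) A x)\<^sup>2)" and C: "0 \<le> C"
    and l: "\<And>x. (\<lambda>n. f n x) \<longlonglongrightarrow> F x"
  shows "(\<lambda>n. \<integral>x. f n x \<partial>lborel) \<longlonglongrightarrow> (\<integral>x. F x \<partial>lborel)"
proof (rule generalized_dominated_convergence[OF _ _ _ _ b l])
  let ?e = "\<lambda>n. 1 / real (Suc n)"
  have e: "0 < ?e n" for n by simp
  note cs = diffq_square_integral_le[OF regularD(1,2,6)[OF c] e]
  note Ss = diffq_square_integral_le[OF regularD(1,2,6)[OF S] e]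
  note As = diffq_square_integral_le[OF regularD(1,2,6)[OF A] e]
  show "integrable lborel (\<lambda>x. C * ((diffq (?e n) c x)\<^sup>2 + (diffq (?e n) S x)\<^sup>2 + (diffq (?e n) A x)\<^sup>2))" for n
    using cs(1) Ss(1) As(1) by simp
  show "integrable lborel (\<lambda>x. C * ((cx x)\<^sup>2 + (Sx x)\<^sup>2 + (Ax x)\<^sup>2))"
    using regularD(6)[OF c] regularD(6)[OF S] regularD(6)[OF A] by simp
  show "(\<lambda>n. C * ((diffq (?e n) c x)\<^sup>2 + (diffq (?e n) S x)\<^sup>2 + (diffq (?e n) A x)\<^sup>2))
      \<longlonglongrightarrow> C * ((cx x)\<^sup>2 + (Sx x)\<^sup>2 + (Ax x)\<^sup>2)" for x
    by (intro tendsto_intros diffq_tendsto regularD(1)[OF c] regularD(1)[OF S] regularD(1)[OF A])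
  have "(\<integral>x. (diffq (?e n) c x)\<^sup>2 + (diffq (?e n) S x)\<^sup>2 + (diffq (?e n) A x)\<^sup>2 \<partial>lborel)
      \<le> (\<integral>x. (cx x)\<^sup>2 + (Sx x)\<^sup>2 + (Ax x)\<^sup>2 \<partial>lborel)" for n
    using cs[of n] Ss[of n] As[of n] regularD(6)[OF c] regularD(6)[OF S] regularD(6)[OF A] by simp
  then show "(\<integral>x. C * ((diffq (?e n) c x)\<^sup>2 + (diffq (?e n) S x)\<^sup>2 + (diffq (?e n) A x)\<^sup>2) \<partial>lborel)
      \<le> (\<integral>x. C * ((cx x)\<^sup>2 + (Sx x)\<^sup>2 + (Ax x)\<^sup>2) \<partial>lborel)" for n
    using C by (simp only: integral_mult_right_zero mult_left_mono)
qed (use m in auto)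

text \<open>The assumption \<open>dt\<close> states \<open>c\<^sub>t = - (S c\<^sub>x + A)\<close> in mean square.\<close>
locale transport =
  fixes t1 M :: real and c cx S Sx A Ax :: "real \<Rightarrow> real \<Rightarrow> real"
  assumes t1: "0 \<le> t1"
    and c: "\<And>t. t \<in> {0..t1} \<Longrightarrow> regular M (c t) (cx t)"
    and S: "\<And>t. t \<in> {0..t1} \<Longrightarrow> regular M (S t) (Sx t)"
    and A: "\<And>t. t \<in> {0..t1} \<Longrightarrow> regular M (A t) (Ax t)"
    and dt: "\<And>t. t \<in> {0..t1} \<Longrightarrow>
       ((\<lambda>s. \<integral>x. ((c s x - c t x) / (s - t) + (S t x * cx t x + A t x))\<^sup>2 \<partial>lborel) \<longlongrightarrow> 0) (at t within {0..t1})"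
begin

text \<open>For c itself the right-hand side of the equation already lies in L^2, so this law holds
  without difference quotients.\<close>

lemma square_has_integral:
  "((\<lambda>t. - 2 * (\<integral>x. c t x * (S t x * cx t x + A t x) \<partial>lborel)) has_integral
     ((\<integral>x. (c t1 x)\<^sup>2 \<partial>lborel) - (\<integral>x. (c 0 x)\<^sup>2 \<partial>lborel))) {0..t1}"
proof (rule fundamental_theorem_of_calculus[OF t1])
  fix t assume t: "t \<in> {0..t1}"
  have "((\<lambda>s. \<integral>x. 1 * (c s x)\<^sup>2 + 0 * (c s x) ^ 3 \<partial>lborel) has_real_derivative
     (\<integral>x. (2 * 1 * c t x + 3 * 0 * (c t x)\<^sup>2) * (- (S t x * cx t x + A t x)) \<partial>lborel)) (at t within {0..t1})"
  proof (rule has_derivative_integral_of_L2_derivative[OF t])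
    show "integrable lborel (\<lambda>x. (- (S t x * cx t x + A t x))\<^sup>2)"
      using regular_rhs[OF S[OF t] c[OF t] A[OF t]] by (simp add: power2_eq_square algebra_simps)
    show "((\<lambda>s. \<integral>x. ((c s x - c t x) / (s - t) - - (S t x * cx t x + A t x))\<^sup>2 \<partial>lborel) \<longlongrightarrow> 0) (at t within {0..t1})"
      using dt[OF t] by (simp only: diff_minus_eq_add)
    show "(\<lambda>x. - (S t x * cx t x + A t x)) \<in> borel_measurable borel"
      using regularD(10,11)[OF S[OF t]] regularD(10,11)[OF c[OF t]] regularD(10,11)[OF A[OF t]] by measurable
  qed (rule regularD[OF c], assumption)+
  also have "(\<integral>x. (2 * 1 * c t x + 3 * 0 * (c t x)\<^sup>2) * (- (S t x * cx t x + A t x)) \<partial>lborel)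
     = (\<integral>x. - 2 * (c t x * (S t x * cx t x + A t x)) \<partial>lborel)"
    by (rule Bochner_Integration.integral_cong) (auto simp: algebra_simps)
  also have "\<dots> = - 2 * (\<integral>x. c t x * (S t x * cx t x + A t x) \<partial>lborel)"
    by (rule integral_mult_right_zero)
  finally show "((\<lambda>s. \<integral>x. (c s x)\<^sup>2 \<partial>lborel) has_vector_derivative
      - 2 * (\<integral>x. c t x * (S t x * cx t x + A t x) \<partial>lborel)) (at t within {0..t1})"
    by (simp add: has_real_derivative_iff_has_vector_derivative)
qed

text \<open>The rate of change of the integral of \<open>a * d\<^sup>2 + b * d ^ 3\<close>, with d
  the difference quotient of \<open>c t\<close>, after \<open>S d\<^sub>x\<close> has been
  integrated by parts. The argument \<open>x + e\<close> comes from the discrete Leibniz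
  rule.\<close>

definition flux :: "real \<Rightarrow> real \<Rightarrow> real \<Rightarrow> real \<Rightarrow> real \<Rightarrow> real" where
  "flux a b e t x = Sx t x * (a * (diffq e (c t) x)\<^sup>2 + b * (diffq e (c t) x) ^ 3)
     - (2 * a * diffq e (c t) x + 3 * b * (diffq e (c t) x)\<^sup>2) * (diffq e (S t) x * cx t (x + e) + diffq e (A t) x)"

lemma flux_bound:
  assumes t: "t \<in> {0..t1}" and e: "0 < e"
  shows "\<bar>flux a b e t x\<bar> \<le> (M + 2 * M + 2) * (\<bar>a\<bar> + 3 * \<bar>b\<bar> * M + \<bar>a\<bar>) *
     ((diffq e (c t) x)\<^sup>2 + (diffq e (S t) x)\<^sup>2 + (diffq e (A t) x)\<^sup>2)"
  unfolding flux_def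
  by (rule transport_integrand_bound)
    (use diffq_abs_le[OF regularD(1,4)[OF c[OF t]] e] regularD(4,12)[OF c[OF t]] regularD(4)[OF S[OF t]] in auto)

lemma flux_measurable:
  assumes t: "t \<in> {0..t1}"
  shows "flux a b e t \<in> borel_measurable borel"
proof -
  note [measurable] = regularD(10,11)[OF S[OF t]] regularD(10,11)[OF c[OF t]] regularD(10,11)[OF A[OF t]]
  show ?thesis unfolding flux_def[abs_def] by measurable
qed

text \<open>The bound in the second part is free of e and t, as dominated convergence in time
  requires.\<close>

lemma flux_integral:
  assumes t: "t \<in> {0..t1}" and e: "0 < e"
  shows "integrable lborel (flux a b e t)"
    "\<bar>\<integral>x. flux a b e t x \<partial>lborel\<bar> \<le> (M + 2 * M + 2) * (\<bar>a\<bar> + 3 * \<bar>b\<bar> * M + \<bar>a\<bar>) * (M + M + M)"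
proof -
  note cs = diffq_square_integral_le[OF regularD(1,2,6)[OF c[OF t]] e]
  note Ss = diffq_square_integral_le[OF regularD(1,2,6)[OF S[OF t]] e]
  note As = diffq_square_integral_le[OF regularD(1,2,6)[OF A[OF t]] e]
  let ?K = "(M + 2 * M + 2) * (\<bar>a\<bar> + 3 * \<bar>b\<bar> * M + \<bar>a\<bar>)"
  let ?B = "\<lambda>x. ?K * ((diffq e (c t) x)\<^sup>2 + (diffq e (S t) x)\<^sup>2 + (diffq e (A t) x)\<^sup>2)"
  have Bi: "integrable lborel ?B" using cs(1) Ss(1) As(1) by (intro integrable_mult_right Bochner_Integration.integrable_add)
  show i: "integrable lborel (flux a b e t)"
    by (rule Bochner_Integration.integrable_bound[OF Bi])
      (use flux_measurable[OF t] order_trans[OF flux_bound[OF t e] abs_ge_self] in auto)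
  have "\<bar>\<integral>x. flux a b e t x \<partial>lborel\<bar> \<le> (\<integral>x. ?B x \<partial>lborel)"
    by (rule integral_abs_bound_integral[OF i Bi flux_bound[OF t e]])
  also have "\<dots> = ?K * ((\<integral>x. (diffq e (c t) x)\<^sup>2 \<partial>lborel) + (\<integral>x. (diffq e (S t) x)\<^sup>2 \<partial>lborel) + (\<integral>x. (diffq e (A t) x)\<^sup>2 \<partial>lborel))"
    using cs(1) Ss(1) As(1) by simp
  also have "\<dots> \<le> ?K * (M + M + M)"
  proof (rule mult_left_mono)
    show "0 \<le> ?K" using regularD(12)[OF c[OF t]] by simp
  qed (use cs(2) Ss(2) As(2) regularD(8)[OF c[OF t]] regularD(8)[OF S[OF t]] regularD(8)[OF A[OF t]] in linarith)
  finally show "\<bar>\<integral>x. flux a b e t x \<partial>lborel\<bar> \<le> ?K * (M + M + M)" .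
qed

text \<open>At fixed e the difference quotient is bounded on L^2 and so commutes with the
  mean-square time derivative. Applied to \<open>S c\<^sub>x + A\<close> it leaves one term with a
  derivative of d, namely \<open>S d\<^sub>x\<close>; paired with
  \<open>2 * a * d + 3 * b * d\<^sup>2\<close> this is S times the derivative of
  \<open>a * d\<^sup>2 + b * d ^ 3\<close>.\<close>

lemma diffq_integral_derivative:
  assumes t: "t \<in> {0..t1}" and e: "0 < e"
  shows "((\<lambda>s. \<integral>x. a * (diffq e (c s) x)\<^sup>2 + b * (diffq e (c s) x) ^ 3 \<partial>lborel) has_real_derivative
     (\<integral>x. flux a b e t x \<partial>lborel)) (at t within {0..t1})"
proof -
  note ct = regularD[OF c[OF t]] and St = regularD[OF S[OF t]] and At = regularD[OF A[OF t]]
  note [measurable] = ct(10,11) St(10,11) At(10,11)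
  define R where "R x = S t x * cx t x + A t x" for x
  have [measurable]: "R \<in> borel_measurable borel" unfolding R_def by measurable
  have Ri: "integrable lborel (\<lambda>x. (R x)\<^sup>2)"
    unfolding R_def by (rule regular_rhs[OF S[OF t] c[OF t] A[OF t]])
  have "((\<lambda>s. \<integral>x. a * (diffq e (c s) x)\<^sup>2 + b * (diffq e (c s) x) ^ 3 \<partial>lborel) has_real_derivative
     (\<integral>x. (2 * a * diffq e (c t) x + 3 * b * (diffq e (c t) x)\<^sup>2) * (- diffq e R x) \<partial>lborel)) (at t within {0..t1})"
  proof (rule has_derivative_integral_of_L2_derivative[OF t])
    fix s assume s: "s \<in> {0..t1}"
    show "diffq e (c s) \<in> borel_measurable borel" using regularD(10)[OF c[OF s]] by measurable
    show "integrable lborel (\<lambda>x. (diffq e (c s) x)\<^sup>2)"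
      by (rule diffq_square_crude[OF regularD(10,5)[OF c[OF s]] e])
    show "\<bar>diffq e (c s) x\<bar> \<le> M" for x
      by (rule diffq_abs_le[OF regularD(1,4)[OF c[OF s]] e])
  next
    show "(\<lambda>x. - diffq e R x) \<in> borel_measurable borel" by measurable
    show "integrable lborel (\<lambda>x. (- diffq e R x)\<^sup>2)" using diffq_square_crude(1)[OF _ Ri e] by simp
    \<comment> \<open>The error of the time derivative of c. By linearity its difference quotient is
      the error for the difference quotient of c.\<close>
    define k where "k s x = (c s x - c t x) / (s - t) + R x" for s x
    have k: "k s \<in> borel_measurable borel" "integrable lborel (\<lambda>x. (k s x)\<^sup>2)" if s: "s \<in> {0..t1}" for s
    proof -
      note [measurable] = regularD(10)[OF c[OF s]]
      show "k s \<in> borel_measurable borel" unfolding k_def by measurable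
      have "integrable lborel (\<lambda>x. (c s x + - c t x)\<^sup>2)"
        by (rule integrable_square_add) (use regularD(5)[OF c[OF s]] ct(5) in auto)
      then have "integrable lborel (\<lambda>x. ((c s x - c t x) / (s - t))\<^sup>2)" by (simp add: power_divide)
      then show "integrable lborel (\<lambda>x. (k s x)\<^sup>2)"
        unfolding k_def using Ri by (intro integrable_square_add) auto
    qed
    have k0: "((\<lambda>s. \<integral>x. (k s x)\<^sup>2 \<partial>lborel) \<longlongrightarrow> 0) (at t within {0..t1})"
      using dt[OF t] unfolding k_def R_def .
    have "((\<lambda>s. \<integral>x. (diffq e (k s) x)\<^sup>2 \<partial>lborel) \<longlongrightarrow> 0) (at t within {0..t1})"
    proof (rule Lim_null_comparison)
      show "((\<lambda>s. 4 / e\<^sup>2 * (\<integral>x. (k s x)\<^sup>2 \<partial>lborel)) \<longlongrightarrow> 0) (at t within {0..t1})"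
        using tendsto_mult_left[OF k0, of "4 / e\<^sup>2"] by simp
      show "\<forall>\<^sub>F s in at t within {0..t1}. norm (\<integral>x. (diffq e (k s) x)\<^sup>2 \<partial>lborel) \<le> 4 / e\<^sup>2 * (\<integral>x. (k s x)\<^sup>2 \<partial>lborel)"
        using diffq_square_crude(2)[OF k e] by (auto simp: eventually_at_filter)
    qed
    moreover have "(diffq e (c s) x - diffq e (c t) x) / (s - t) - - diffq e R x = diffq e (k s) x" for s x
      by (simp add: diffq_def k_def add_divide_distrib diff_divide_distrib algebra_simps)
    ultimately show "((\<lambda>s. \<integral>x. ((diffq e (c s) x - diffq e (c t) x) / (s - t) - - diffq e R x)\<^sup>2 \<partial>lborel) \<longlongrightarrow> 0) (at t within {0..t1})"
      by simp
  qed
  moreover have "(\<integral>x. (2 * a * diffq e (c t) x + 3 * b * (diffq e (c t) x)\<^sup>2) * (- diffq e R x) \<partial>lborel)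
     = (\<integral>x. flux a b e t x \<partial>lborel)"
  proof -
    define d where "d = diffq e (c t)"
    define d' where "d' = diffq e (cx t)"
    have [measurable]: "d \<in> borel_measurable borel" "d' \<in> borel_measurable borel" unfolding d_def d'_def by measurable
    \<comment> \<open>\<open>h'\<close> below is the derivative of \<open>h\<close> and so
      integrates to 0; this trades the term with \<open>d'\<close> for one with
      \<open>Sx\<close>.\<close>
    define h where "h x = S t x * (a * (d x)\<^sup>2 + b * (d x) ^ 3)" for x
    define h' where "h' x = Sx t x * (a * (d x)\<^sup>2 + b * (d x) ^ 3) + S t x * ((2 * a * d x + 3 * b * (d x)\<^sup>2) * d' x)" for x
    have dd: "(d has_real_derivative d' x) (at x)" for x
      unfolding d_def d'_def by (rule diffq_DERIV[OF ct(1)])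
    have dc: "continuous_on UNIV d" by (rule DERIV_everywhere_continuous[OF dd])
    have d'c: "continuous_on UNIV d'" unfolding d'_def diffq_def
      using e by (intro continuous_intros continuous_on_compose2[OF ct(2)]) auto
    have di: "integrable lborel (\<lambda>x. (d x)\<^sup>2)" unfolding d_def by (rule diffq_square_crude[OF ct(10,5) e])
    have d'i: "integrable lborel (\<lambda>x. (d' x)\<^sup>2)" unfolding d'_def by (rule diffq_square_crude[OF ct(11,6) e])
    have db: "\<bar>d x\<bar> \<le> M" for x unfolding d_def by (rule diffq_abs_le[OF ct(1,4) e])
    have dm: "d \<in> borel_measurable lborel" by measurable
    note pol = integrable_poly_of_square[OF dm di db, of a b]
    have i1: "integrable lborel h" unfolding h_def
      by (rule integrable_bounded_mult[OF _ pol(1) St(3)]) measurable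
    have "integrable lborel (\<lambda>x. (2 * a * d x + 3 * b * (d x)\<^sup>2) * d' x)"
      by (rule integrable_mult_of_square[OF _ _ pol(2) d'i]) measurable
    then have "integrable lborel (\<lambda>x. S t x * ((2 * a * d x + 3 * b * (d x)\<^sup>2) * d' x))"
      by (rule integrable_bounded_mult[rotated, OF _ St(3)]) measurable
    moreover have "integrable lborel (\<lambda>x. Sx t x * (a * (d x)\<^sup>2 + b * (d x) ^ 3))"
      by (rule integrable_bounded_mult[OF _ pol(1) St(4)]) measurable
    ultimately have i2: "integrable lborel h'" unfolding h'_def by (rule Bochner_Integration.integrable_add[rotated])
    have "(\<integral>x. h' x \<partial>lborel) = 0"
    proof (rule integral_derivative_zero[OF _ _ i1 i2])
      show "(h has_real_derivative h' x) (at x)" for x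
        unfolding h_def h'_def
        by (auto intro!: derivative_eq_intros St(1) dd simp: algebra_simps power2_eq_square power3_eq_cube)
      show "continuous_on UNIV h'" unfolding h'_def by (intro continuous_intros St(2,9) dc d'c)
    qed
    moreover have "(2 * a * d x + 3 * b * (d x)\<^sup>2) * (- diffq e R x) = flux a b e t x - h' x" for x
    proof -
      \<comment> \<open>Discrete Leibniz rule, arranged so that the coefficient of \<open>d'\<close>
        is the unshifted \<open>S t x\<close>; the shift goes to \<open>cx\<close>, which is
        harmless because \<open>cx\<close> is continuous.\<close>
      have "diffq e R x = S t x * d' x + diffq e (S t) x * cx t (x + e) + diffq e (A t) x"
        unfolding R_def d'_def diffq_def using e by (simp add: field_simps)
      then show ?thesis unfolding flux_def h'_def d_def by (simp add: algebra_simps)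
    qed
    ultimately show ?thesis
      using flux_integral(1)[OF t e, of a b] i2 unfolding d_def by simp
  qed
  ultimately show ?thesis by simp
qed

text \<open>The time-integrated law is exact for every e, and e tends to 0 by domination twice: in x
  through \<open>diffq_mean_tendsto\<close>, in t through the bound of \<open>flux_integral\<close>.
  Nothing is claimed about continuity of the integrand in t, and \<open>riccati_blowup_time\<close>
  is stated accordingly.\<close>

lemma power_has_integral:
  "((\<lambda>t. \<integral>x. Sx t x * (a * (cx t x)\<^sup>2 + b * (cx t x) ^ 3)
       - (2 * a * cx t x + 3 * b * (cx t x)\<^sup>2) * (Sx t x * cx t x + Ax t x) \<partial>lborel) has_integral
     ((\<integral>x. a * (cx t1 x)\<^sup>2 + b * (cx t1 x) ^ 3 \<partial>lborel) - (\<integral>x. a * (cx 0 x)\<^sup>2 + b * (cx 0 x) ^ 3 \<partial>lborel))) {0..t1}"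
proof -
  let ?K = "(M + 2 * M + 2) * (\<bar>a\<bar> + 3 * \<bar>b\<bar> * M + \<bar>a\<bar>)"
  define \<epsilon> where "\<epsilon> n = 1 / real (Suc n)" for n
  have e: "0 < \<epsilon> n" for n by (simp add: \<epsilon>_def)
  have e0: "\<epsilon> \<longlonglongrightarrow> 0" unfolding \<epsilon>_def using LIMSEQ_Suc[OF lim_1_over_n] by simp
  have K0: "0 \<le> ?K" using regularD(12)[OF c[of 0]] t1 by simp
  define X where "X t = (\<integral>x. Sx t x * (a * (cx t x)\<^sup>2 + b * (cx t x) ^ 3)
       - (2 * a * cx t x + 3 * b * (cx t x)\<^sup>2) * (Sx t x * cx t x + Ax t x) \<partial>lborel)" for t
  define N where "N n t = (\<integral>x. a * (diffq (\<epsilon> n) (c t) x)\<^sup>2 + b * (diffq (\<epsilon> n) (c t) x) ^ 3 \<partial>lborel)" for n t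
  define N0 where "N0 t = (\<integral>x. a * (cx t x)\<^sup>2 + b * (cx t x) ^ 3 \<partial>lborel)" for t
  have hi: "((\<lambda>t. \<integral>x. flux a b (\<epsilon> n) t x \<partial>lborel) has_integral (N n t1 - N n 0)) {0..t1}" for n
    unfolding N_def using diffq_integral_derivative[OF _ e]
    by (intro fundamental_theorem_of_calculus[OF t1])
      (auto simp: has_real_derivative_iff_has_vector_derivative[symmetric])
  have Xl: "(\<lambda>n. \<integral>x. flux a b (\<epsilon> n) t x \<partial>lborel) \<longlonglongrightarrow> X t" if t: "t \<in> {0..t1}" for t
    unfolding X_def
  proof (rule diffq_mean_tendsto[OF c[OF t] S[OF t] A[OF t], where C = ?K])
    note ct = regularD[OF c[OF t]] and St = regularD[OF S[OF t]] and At = regularD[OF A[OF t]]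
    note [measurable] = ct(10,11) St(10,11) At(10,11)
    show "flux a b (\<epsilon> n) t \<in> borel_measurable borel" for n by (rule flux_measurable[OF t])
    show "(\<lambda>x. Sx t x * (a * (cx t x)\<^sup>2 + b * cx t x ^ 3) - (2 * a * cx t x + 3 * b * (cx t x)\<^sup>2) *
            (Sx t x * cx t x + Ax t x)) \<in> borel_measurable borel" by measurable
    show "\<bar>flux a b (\<epsilon> n) t x\<bar> \<le> ?K * ((diffq (1 / real (Suc n)) (c t) x)\<^sup>2 +
          (diffq (1 / real (Suc n)) (S t) x)\<^sup>2 + (diffq (1 / real (Suc n)) (A t) x)\<^sup>2)" for n x
      using flux_bound[OF t e[of n], of a b x] unfolding \<epsilon>_def .
    have "(\<lambda>n. cx t (x + \<epsilon> n)) \<longlonglongrightarrow> cx t x" for x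
    proof -
      have "(\<lambda>n. x + \<epsilon> n) \<longlonglongrightarrow> x + 0" by (intro tendsto_intros e0)
      then show ?thesis using continuous_on_tendsto_compose[OF ct(2), of "\<lambda>n. x + \<epsilon> n" x] by simp
    qed
    moreover have "(\<lambda>n. diffq (\<epsilon> n) (c t) x) \<longlonglongrightarrow> cx t x" "(\<lambda>n. diffq (\<epsilon> n) (S t) x) \<longlonglongrightarrow> Sx t x"
      "(\<lambda>n. diffq (\<epsilon> n) (A t) x) \<longlonglongrightarrow> Ax t x" for x
      unfolding \<epsilon>_def by (rule diffq_tendsto, fact)+
    ultimately show "(\<lambda>n. flux a b (\<epsilon> n) t x) \<longlonglongrightarrow> Sx t x * (a * (cx t x)\<^sup>2 + b * cx t x ^ 3) -
         (2 * a * cx t x + 3 * b * (cx t x)\<^sup>2) * (Sx t x * cx t x + Ax t x)" for x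
      unfolding flux_def by (intro tendsto_intros)
  qed (rule K0)
  have Nl: "(\<lambda>n. N n t) \<longlonglongrightarrow> N0 t" if t: "t \<in> {0..t1}" for t
    unfolding N_def N0_def
  \<comment> \<open>Only c enters here, so it fills all three slots of the majorant.\<close>
  proof (rule diffq_mean_tendsto[OF c[OF t] c[OF t] c[OF t], where C = "\<bar>a\<bar> + \<bar>b\<bar> * M"])
    note ct = regularD[OF c[OF t]]
    note [measurable] = ct(10,11)
    show "(\<lambda>x. a * (diffq (\<epsilon> n) (c t) x)\<^sup>2 + b * (diffq (\<epsilon> n) (c t) x) ^ 3) \<in> borel_measurable borel" for n by measurable
    show "(\<lambda>x. a * (cx t x)\<^sup>2 + b * cx t x ^ 3) \<in> borel_measurable borel" by measurable
    show "0 \<le> \<bar>a\<bar> + \<bar>b\<bar> * M" using ct(12) by simp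
    show "\<bar>a * (diffq (\<epsilon> n) (c t) x)\<^sup>2 + b * diffq (\<epsilon> n) (c t) x ^ 3\<bar>
       \<le> (\<bar>a\<bar> + \<bar>b\<bar> * M) * ((diffq (1 / real (Suc n)) (c t) x)\<^sup>2 + (diffq (1 / real (Suc n)) (c t) x)\<^sup>2 +
           (diffq (1 / real (Suc n)) (c t) x)\<^sup>2)" for n x
    proof -
      define d where "d = diffq (\<epsilon> n) (c t) x"
      have db: "\<bar>d\<bar> \<le> M" unfolding d_def by (rule diffq_abs_le[OF ct(1,4) e])
      have "\<bar>b\<bar> * \<bar>d\<bar> \<le> \<bar>b\<bar> * M" using db by (intro mult_left_mono) auto
      then have "\<bar>a + b * d\<bar> \<le> \<bar>a\<bar> + \<bar>b\<bar> * M" using abs_triangle_ineq[of a "b * d"] by (simp add: abs_mult)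
      then have "\<bar>a + b * d\<bar> * d\<^sup>2 \<le> (\<bar>a\<bar> + \<bar>b\<bar> * M) * (d\<^sup>2 + d\<^sup>2 + d\<^sup>2)"
        by (intro mult_mono) auto
      moreover have "a * d\<^sup>2 + b * d ^ 3 = (a + b * d) * d\<^sup>2" by (simp add: algebra_simps power2_eq_square power3_eq_cube)
      ultimately show ?thesis unfolding d_def[symmetric] \<epsilon>_def[symmetric] by (simp add: abs_mult)
    qed
    show "(\<lambda>n. a * (diffq (\<epsilon> n) (c t) x)\<^sup>2 + b * diffq (\<epsilon> n) (c t) x ^ 3) \<longlonglongrightarrow> a * (cx t x)\<^sup>2 + b * cx t x ^ 3" for x
      unfolding \<epsilon>_def by (intro tendsto_intros diffq_tendsto ct(1))
  qed
  have fi: "(\<lambda>t. \<integral>x. flux a b (\<epsilon> n) t x \<partial>lborel) integrable_on {0..t1}" for n using hi by (rule has_integral_integrable)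
  have fb: "norm (\<integral>x. flux a b (\<epsilon> n) t x \<partial>lborel) \<le> ?K * (M + M + M)" if "t \<in> {0..t1}" for n t
    using flux_integral(2)[OF that e] by simp
  have X: "X integrable_on {0..t1}" by (rule dominated_convergence[OF fi integrable_const_ivl fb Xl])
  have l: "(\<lambda>n. integral {0..t1} (\<lambda>t. \<integral>x. flux a b (\<epsilon> n) t x \<partial>lborel)) \<longlonglongrightarrow> integral {0..t1} X"
    by (rule dominated_convergence[OF fi integrable_const_ivl fb Xl])
  have "(\<lambda>n. N n t1 - N n 0) \<longlonglongrightarrow> N0 t1 - N0 0" by (intro tendsto_diff Nl) (use t1 in auto)
  moreover have "integral {0..t1} (\<lambda>t. \<integral>x. flux a b (\<epsilon> n) t x \<partial>lborel) = N n t1 - N n 0" for n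
    using hi by (rule integral_unique)
  ultimately have "(\<lambda>n. integral {0..t1} (\<lambda>t. \<integral>x. flux a b (\<epsilon> n) t x \<partial>lborel)) \<longlonglongrightarrow> N0 t1 - N0 0"
    by (simp only:)
  then have "integral {0..t1} X = N0 t1 - N0 0" by (rule LIMSEQ_unique[OF l])
  then show ?thesis using integrable_integral[OF X] unfolding X_def N0_def by simp
qed

end

section \<open>Convolution with the Green function\<close>

text \<open>The set where f and g differ is open and null, hence empty. This is how the initial
  data, attained only almost everywhere, become pointwise identities.\<close>

lemma continuous_AE_eq:
  fixes f g :: "real \<Rightarrow> real"
  assumes f: "continuous_on UNIV f" and g: "continuous_on UNIV g" and ae: "AE x in lborel. f x = g x"
  shows "f x = g x"
proof (rule ccontr)
  assume "f x \<noteq> g x"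
  have o: "open {x. f x \<noteq> g x}" by (rule open_Collect_neq[OF f g])
  then have "{x. f x \<noteq> g x} \<in> null_sets lborel"
    using ae by (subst (asm) AE_iff_null) auto
  then have "negligible {x. f x \<noteq> g x}"
    by (simp add: negligible_iff_null_sets null_sets_completionI)
  then show False using open_not_negligible[OF o] \<open>f x \<noteq> g x\<close> by blast
qed

lemma continuous_nonneg_integral_zero:
  fixes f :: "real \<Rightarrow> real"
  assumes "continuous_on UNIV f" "integrable lborel f" "\<And>x. 0 \<le> f x" "(\<integral>x. f x \<partial>lborel) = 0"
  shows "f x = 0"
  by (rule continuous_AE_eq) (use assms integral_nonneg_eq_0_iff_AE[OF assms(2)] in auto)

lemma DERIV_integral_atMost:
  fixes h :: "real \<Rightarrow> real"
  assumes c: "continuous_on UNIV h" and i: "\<And>a. integrable lborel (\<lambda>y. indicator {..a} y * h y)"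
  shows "((\<lambda>x. \<integral>y. indicator {..x} y * h y \<partial>lborel) has_real_derivative h x) (at x)"
proof -
  let ?L = "\<lambda>x. \<integral>y. indicator {..x} y * h y \<partial>lborel"
  have cI: "continuous_on A h" for A using c by (rule continuous_on_subset) simp
  \<comment> \<open>Cutting at \<open>x - 1\<close> leaves a constant and an integral over a compact
    interval, to which the fundamental theorem applies near x.\<close>
  have L: "?L y = ?L (x - 1) + integral {x - 1..y} h" if "x - 1 \<le> y" for y
  proof -
    have s: "set_integrable lborel {x - 1..y} h" by (rule borel_integrable_atLeastAtMost'[OF cI])
    have "?L y = (\<integral>z. indicator {..x - 1} z * h z + indicator {x - 1..y} z * h z \<partial>lborel)"
    proof (rule integral_cong_AE)
      have [measurable]: "h \<in> borel_measurable borel" using c by (rule borel_measurable_continuous_onI)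
      show "(\<lambda>z. indicator {..y} z * h z) \<in> borel_measurable lborel"
        "(\<lambda>z. indicator {..x - 1} z * h z + indicator {x - 1..y} z * h z) \<in> borel_measurable lborel"
        by measurable
      show "AE z in lborel. indicator {..y} z * h z = indicator {..x - 1} z * h z + indicator {x - 1..y} z * h z"
        using AE_lborel_singleton[of "x - 1"] by eventually_elim (use that in \<open>auto split: split_indicator\<close>)
    qed
    also have "\<dots> = ?L (x - 1) + (\<integral>z. indicator {x - 1..y} z * h z \<partial>lborel)"
      using i s by (simp add: set_integrable_def)
    also have "(\<integral>z. indicator {x - 1..y} z * h z \<partial>lborel) = integral {x - 1..y} h"
      using set_borel_integral_eq_integral(2)[OF s] by (simp add: set_lebesgue_integral_def)
    finally show ?thesis .
  qed
  have "((\<lambda>y. integral {x - 1..y} h) has_real_derivative h x) (at x within {x - 1..x + 1})"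
    by (rule integral_has_real_derivative[OF cI]) auto
  moreover have "at x within {x - 1..x + 1} = at x" by (rule at_within_Icc_at) auto
  ultimately have d: "((\<lambda>y. integral {x - 1..y} h) has_real_derivative h x) (at x)" by (simp only:)
  have d': "((\<lambda>y. ?L (x - 1) + integral {x - 1..y} h) has_real_derivative h x) (at x)"
    by (rule DERIV_cong[OF DERIV_add[OF DERIV_const d]]) simp
  have "eventually (\<lambda>y. y \<in> {x - 1<..}) (nhds x)" by (intro eventually_nhds_in_open) auto
  then have ev: "eventually (\<lambda>y. ?L (x - 1) + integral {x - 1..y} h = ?L y) (nhds x)"
    by eventually_elim (rule L[symmetric], simp)
  show ?thesis using DERIV_cong_ev[OF refl ev refl] d' by blast
qed

lemma DERIV_integral_atLeast:
  fixes h :: "real \<Rightarrow> real"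
  assumes c: "continuous_on UNIV h" and i: "\<And>a. integrable lborel (\<lambda>y. indicator {a..} y * h y)"
  shows "((\<lambda>x. \<integral>y. indicator {x..} y * h y \<partial>lborel) has_real_derivative - h x) (at x)"
proof -
  have ind: "indicat_real {x..} (- y) = indicator {..- x} y" for x y :: real by (auto split: split_indicator)
  have i': "integrable lborel (\<lambda>y. indicator {..a} y * h (- y))" for a
    using lborel_integrable_real_affine[OF i[of "- a"], of "-1" 0] by (simp add: ind)
  have c': "continuous_on UNIV (\<lambda>y. h (- y))"
    by (intro continuous_on_compose2[OF c] continuous_intros) auto
  have "((\<lambda>x. \<integral>y. indicator {..x} y * h (- y) \<partial>lborel) has_real_derivative h (- (- x))) (at (- x))"
    by (rule DERIV_integral_atMost[OF c' i'])
  then have "((\<lambda>x. \<integral>y. indicator {..- x} y * h (- y) \<partial>lborel) has_real_derivative - h x) (at x)"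
    by (subst (asm) DERIV_mirror) simp
  moreover have "(\<integral>y. indicator {..- x} y * h (- y) \<partial>lborel) = (\<integral>y. indicator {x..} y * h y \<partial>lborel)" for x
    using lborel_integral_real_affine[of "-1" "\<lambda>y. indicator {x..} y * h y" 0] by (simp add: ind)
  ultimately show ?thesis by simp
qed

lemma nn_integral_exp_abs: "(\<integral>\<^sup>+x. ennreal (1 / 2 * exp (- \<bar>x - y\<bar>)) \<partial>lborel) = 1"
proof -
  have half0: "(\<integral>\<^sup>+x. ennreal (1 / 2 * exp (- x)) * indicator {0..} x \<partial>lborel) = ennreal (0 - - (1 / 2 * exp (- (0::real))))"
  proof (rule nn_integral_FTC_atLeast)
    have "((\<lambda>x::real. exp (- x)) \<longlongrightarrow> 0) at_top"
      by (rule filterlim_compose[OF exp_at_bot filterlim_uminus_at_bot_at_top])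
    then have "((\<lambda>x::real. - (1 / 2 * exp (- x))) \<longlongrightarrow> - (1 / 2 * 0)) at_top"
      by (intro tendsto_intros)
    then show "((\<lambda>x::real. - (1 / 2 * exp (- x))) \<longlongrightarrow> 0) at_top" by simp
  qed (auto intro!: derivative_eq_intros)
  have half: "(\<integral>\<^sup>+x. ennreal (1 / 2 * exp (- x)) * indicator {0..} x \<partial>lborel) = ennreal (1 / 2)"
    unfolding half0 by (rule arg_cong[where f = ennreal]) simp
  have "(\<integral>\<^sup>+x. ennreal (1 / 2 * exp (- \<bar>x - y\<bar>)) \<partial>lborel) = (\<integral>\<^sup>+x. ennreal (1 / 2 * exp (- \<bar>x\<bar>)) \<partial>lborel)"
    using nn_integral_translate[of "\<lambda>x. ennreal (1 / 2 * exp (- \<bar>x\<bar>))" "- y"] by simp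
  also have "\<dots> = (\<integral>\<^sup>+x. ennreal (1 / 2 * exp (- x)) * indicator {0..} x + ennreal (1 / 2 * exp (- (0 + -1 * x))) * indicator {0..} (0 + -1 * x) \<partial>lborel)"
  proof (rule nn_integral_cong_AE)
    show "AE x in lborel. ennreal (1 / 2 * exp (- \<bar>x\<bar>)) = ennreal (1 / 2 * exp (- x)) * indicator {0..} x + ennreal (1 / 2 * exp (- (0 + -1 * x))) * indicator {0..} (0 + -1 * x)"
      using AE_lborel_singleton[of "0::real"] by eventually_elim (auto split: split_indicator)
  qed
  also have "\<dots> = (\<integral>\<^sup>+x. ennreal (1 / 2 * exp (- x)) * indicator {0..} x \<partial>lborel)
      + (\<integral>\<^sup>+x. ennreal (1 / 2 * exp (- (0 + -1 * x))) * indicator {0..} (0 + -1 * x) \<partial>lborel)"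
    by (rule nn_integral_add) measurable
  also have "(\<integral>\<^sup>+x. ennreal (1 / 2 * exp (- (0 + -1 * x))) * indicator {0..} (0 + -1 * x) \<partial>lborel)
      = (\<integral>\<^sup>+x. ennreal (1 / 2 * exp (- x)) * indicator {0..} x \<partial>lborel)"
    using nn_integral_real_affine[of "\<lambda>x. ennreal (1 / 2 * exp (- x)) * indicator {0..} x" "-1" 0] by simp
  finally have *: "(\<integral>\<^sup>+x. ennreal (1 / 2 * exp (- \<bar>x - y\<bar>)) \<partial>lborel) = ennreal (1 / 2) + ennreal (1 / 2)"
    by (simp only: half)
  have "ennreal (1 / 2) + ennreal (1 / 2) = ennreal (1 / 2 + 1 / 2)"
    by (rule ennreal_plus[symmetric]) simp_all
  also have "1 / 2 + 1 / 2 = (1::real)" by simp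
  finally show ?thesis unfolding * ennreal_1 .
qed

text \<open>Stated for every kernel below \<open>1 / 2 * exp (- \<bar>z\<bar>)\<close>, hence for G
  and for its derivative alike. The sup 1/2 of the kernel gives the pointwise bound, its mass 1 the
  bound in L^1 (Young's inequality).\<close>

lemma kernel_convolution:
  fixes k F :: "real \<Rightarrow> real"
  assumes [measurable]: "k \<in> borel_measurable borel" and kb: "\<And>z. \<bar>k z\<bar> \<le> 1 / 2 * exp (- \<bar>z\<bar>)"
    and F: "integrable lborel F"
  shows "integrable lborel (\<lambda>y. k (x - y) * F y)"
    "\<bar>\<integral>y. k (x - y) * F y \<partial>lborel\<bar> \<le> (\<integral>y. \<bar>F y\<bar> \<partial>lborel) / 2"
    "integrable lborel (\<lambda>x. \<integral>y. k (x - y) * F y \<partial>lborel)"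
    "(\<integral>x. \<bar>\<integral>y. k (x - y) * F y \<partial>lborel\<bar> \<partial>lborel) \<le> (\<integral>y. \<bar>F y\<bar> \<partial>lborel)"
proof -
  have [measurable]: "F \<in> borel_measurable borel" using F by auto
  have k2: "\<bar>k z\<bar> \<le> 1 / 2" for z by (rule order_trans[OF kb]) simp
  show i: "integrable lborel (\<lambda>y. k (x - y) * F y)" for x
    by (rule integrable_bounded_mult[OF _ F k2]) measurable
  have le: "\<bar>k z * r\<bar> \<le> 1 / 2 * exp (- \<bar>z\<bar>) * \<bar>r\<bar>" for z r
    using kb[of z] unfolding abs_mult by (intro mult_right_mono) auto
  have "\<bar>\<integral>y. k (x - y) * F y \<partial>lborel\<bar> \<le> (\<integral>y. 1 / 2 * \<bar>F y\<bar> \<partial>lborel)"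
  proof (rule integral_abs_bound_integral[OF i])
    show "\<bar>k (x - y) * F y\<bar> \<le> 1 / 2 * \<bar>F y\<bar>" for y
      using k2[of "x - y"] unfolding abs_mult by (intro mult_right_mono) auto
  qed (use F in simp)
  then show "\<bar>\<integral>y. k (x - y) * F y \<partial>lborel\<bar> \<le> (\<integral>y. \<bar>F y\<bar> \<partial>lborel) / 2" by simp
  let ?C = "\<lambda>x. \<integral>y. k (x - y) * F y \<partial>lborel"
  have [measurable]: "?C \<in> borel_measurable borel" by measurable
  have "(\<integral>\<^sup>+x. ennreal \<bar>?C x\<bar> \<partial>lborel) \<le> (\<integral>\<^sup>+x. (\<integral>\<^sup>+y. ennreal (1 / 2 * exp (- \<bar>x - y\<bar>)) * ennreal \<bar>F y\<bar> \<partial>lborel) \<partial>lborel)"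
  proof (rule nn_integral_mono)
    fix x
    have "ennreal (norm (?C x)) \<le> (\<integral>\<^sup>+y. ennreal (norm (k (x - y) * F y)) \<partial>lborel)"
      by (rule integral_norm_bound_ennreal[OF i])
    also have "\<dots> \<le> (\<integral>\<^sup>+y. ennreal (1 / 2 * exp (- \<bar>x - y\<bar>)) * ennreal \<bar>F y\<bar> \<partial>lborel)"
      using le by (intro nn_integral_mono) (auto simp: ennreal_mult[symmetric] intro!: ennreal_leI)
    finally show "ennreal \<bar>?C x\<bar> \<le> (\<integral>\<^sup>+y. ennreal (1 / 2 * exp (- \<bar>x - y\<bar>)) * ennreal \<bar>F y\<bar> \<partial>lborel)" by simp
  qed
  also have "\<dots> = (\<integral>\<^sup>+y. (\<integral>\<^sup>+x. ennreal (1 / 2 * exp (- \<bar>x - y\<bar>)) * ennreal \<bar>F y\<bar> \<partial>lborel) \<partial>lborel)"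
    by (rule lborel_pair.Fubini') measurable
  also have "\<dots> = (\<integral>\<^sup>+y. ennreal \<bar>F y\<bar> \<partial>lborel)"
    using nn_integral_exp_abs by (intro nn_integral_cong) (simp add: nn_integral_multc)
  also have "\<dots> = ennreal (\<integral>y. \<bar>F y\<bar> \<partial>lborel)"
    using F by (intro nn_integral_eq_integral) auto
  finally have *: "(\<integral>\<^sup>+x. ennreal \<bar>?C x\<bar> \<partial>lborel) \<le> ennreal (\<integral>y. \<bar>F y\<bar> \<partial>lborel)" .
  show ii: "integrable lborel ?C"
    by (rule integrableI_bounded) (use * in \<open>auto simp: less_top[symmetric] top_unique\<close>)
  show "(\<integral>x. \<bar>?C x\<bar> \<partial>lborel) \<le> (\<integral>y. \<bar>F y\<bar> \<partial>lborel)"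
    using * ii by (subst (asm) nn_integral_eq_integral) auto
qed

lemma Gx_kernel_bound: "\<bar>- (1 / 2) * sgn z * exp (- \<bar>z\<bar>)\<bar> \<le> 1 / 2 * exp (- \<bar>z::real\<bar>)"
  by (simp add: abs_mult sgn_if)

lemma sgn_borel_measurable[measurable]: "(sgn :: real \<Rightarrow> real) \<in> borel_measurable borel"
proof -
  have "(sgn :: real \<Rightarrow> real) = (\<lambda>x. if x = 0 then 0 else if 0 < x then 1 else -1)" by (auto simp: sgn_if)
  then show ?thesis by simp
qed

lemma Gx_kernel_measurable: "(\<lambda>z::real. - (1 / 2) * sgn z * exp (- \<bar>z\<bar>)) \<in> borel_measurable borel"
  by measurable

lemma Gconv_bounds:
  assumes F: "integrable lborel F"
  shows "integrable lborel (\<lambda>y. 1 / 2 * exp (- \<bar>x - y\<bar>) * F y)"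
    "\<bar>Gconv F x\<bar> \<le> (\<integral>y. \<bar>F y\<bar> \<partial>lborel) / 2" "integrable lborel (Gconv F)"
    "(\<integral>x. \<bar>Gconv F x\<bar> \<partial>lborel) \<le> (\<integral>y. \<bar>F y\<bar> \<partial>lborel)"
  using kernel_convolution[where k = "\<lambda>z. 1 / 2 * exp (- \<bar>z\<bar>)", OF _ _ F] unfolding Gconv_def[abs_def] by auto

lemma Gxconv_bounds:
  assumes F: "integrable lborel F"
  shows "integrable lborel (\<lambda>y. - (1 / 2) * sgn (x - y) * exp (- \<bar>x - y\<bar>) * F y)"
    "\<bar>Gxconv F x\<bar> \<le> (\<integral>y. \<bar>F y\<bar> \<partial>lborel) / 2" "integrable lborel (Gxconv F)"
    "(\<integral>x. \<bar>Gxconv F x\<bar> \<partial>lborel) \<le> (\<integral>y. \<bar>F y\<bar> \<partial>lborel)"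
  using kernel_convolution[OF Gx_kernel_measurable Gx_kernel_bound F]
  unfolding Gxconv_def[abs_def] by auto

text \<open>On each side of x the kernel factors into a function of x and a function of y, so that x
  survives only in elementary factors and in the end points. The two convolutions differ in the sign
  of the left half.\<close>

lemma conv_half_lines:
  assumes F: "integrable lborel F"
  shows "integrable lborel (\<lambda>y. indicator {..x} y * (exp y * F y))"
    "integrable lborel (\<lambda>y. indicator {x..} y * (exp (- y) * F y))"
    "Gconv F x = 1 / 2 * exp (- x) * (\<integral>y. indicator {..x} y * (exp y * F y) \<partial>lborel)
       + 1 / 2 * exp x * (\<integral>y. indicator {x..} y * (exp (- y) * F y) \<partial>lborel)"
    "Gxconv F x = - (1 / 2) * exp (- x) * (\<integral>y. indicator {..x} y * (exp y * F y) \<partial>lborel)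
       + 1 / 2 * exp x * (\<integral>y. indicator {x..} y * (exp (- y) * F y) \<partial>lborel)"
proof -
  have [measurable]: "F \<in> borel_measurable borel" using F by auto
  have "integrable lborel (\<lambda>y. (indicator {..x} y * exp y) * F y)"
    by (rule integrable_bounded_mult[OF _ F, of _ "exp x"]) (auto split: split_indicator)
  then show l: "integrable lborel (\<lambda>y. indicator {..x} y * (exp y * F y))" by (simp add: mult.assoc)
  have "integrable lborel (\<lambda>y. (indicator {x..} y * exp (- y)) * F y)"
    by (rule integrable_bounded_mult[OF _ F, of _ "exp (- x)"]) (auto split: split_indicator)
  then show r: "integrable lborel (\<lambda>y. indicator {x..} y * (exp (- y) * F y))" by (simp add: mult.assoc)
  have e1: "exp (y - x) = exp (- x) * exp y" and e2: "exp (x - y) = exp x * exp (- y)" for y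
    using exp_add[of "- x" y] exp_add[of x "- y"] by simp_all
  have "Gconv F x = (\<integral>y. 1 / 2 * exp (- x) * (indicator {..x} y * (exp y * F y)) + 1 / 2 * exp x * (indicator {x..} y * (exp (- y) * F y)) \<partial>lborel)"
    unfolding Gconv_def
  proof (rule integral_cong_AE)
    show "AE y in lborel. 1 / 2 * exp (- \<bar>x - y\<bar>) * F y = 1 / 2 * exp (- x) * (indicator {..x} y * (exp y * F y)) + 1 / 2 * exp x * (indicator {x..} y * (exp (- y) * F y))"
      using AE_lborel_singleton[of x]
    proof eventually_elim
      case (elim y)
      then consider "y < x" | "x < y" by linarith
      then show ?case by cases (simp_all add: e1 e2)
    qed
  qed measurable
  then show "Gconv F x = 1 / 2 * exp (- x) * (\<integral>y. indicator {..x} y * (exp y * F y) \<partial>lborel)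
       + 1 / 2 * exp x * (\<integral>y. indicator {x..} y * (exp (- y) * F y) \<partial>lborel)"
    using l r by simp
  have "Gxconv F x = (\<integral>y. - (1 / 2) * exp (- x) * (indicator {..x} y * (exp y * F y)) + 1 / 2 * exp x * (indicator {x..} y * (exp (- y) * F y)) \<partial>lborel)"
    unfolding Gxconv_def
  proof (rule integral_cong_AE)
    show "AE y in lborel. - (1 / 2) * sgn (x - y) * exp (- \<bar>x - y\<bar>) * F y = - (1 / 2) * exp (- x) * (indicator {..x} y * (exp y * F y)) + 1 / 2 * exp x * (indicator {x..} y * (exp (- y) * F y))"
      using AE_lborel_singleton[of x]
    proof eventually_elim
      case (elim y)
      then consider "y < x" | "x < y" by linarith
      then show ?case by cases (simp_all add: e1 e2)
    qed
  qed measurable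
  then show "Gxconv F x = - (1 / 2) * exp (- x) * (\<integral>y. indicator {..x} y * (exp y * F y) \<partial>lborel)
       + 1 / 2 * exp x * (\<integral>y. indicator {x..} y * (exp (- y) * F y) \<partial>lborel)"
    using l r by simp
qed

text \<open>The end-point contributions of the two half-lines cancel for \<open>Gconv\<close> and
  add up to -F for \<open>Gxconv\<close>. Together the two parts say that y = G*F solves y - y'' =
  F.\<close>

lemma conv_DERIV:
  assumes F: "integrable lborel F" and c: "continuous_on UNIV F"
  shows "(Gconv F has_real_derivative Gxconv F x) (at x)"
    "(Gxconv F has_real_derivative Gconv F x - F x) (at x)"
proof -
  let ?L = "\<lambda>x. \<integral>y. indicator {..x} y * (exp y * F y) \<partial>lborel"
  let ?R = "\<lambda>x. \<integral>y. indicator {x..} y * (exp (- y) * F y) \<partial>lborel"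
  have L: "(?L has_real_derivative exp x * F x) (at x)"
    by (rule DERIV_integral_atMost) (auto intro!: continuous_intros c conv_half_lines F)
  have R: "(?R has_real_derivative - (exp (- x) * F x)) (at x)"
    by (rule DERIV_integral_atLeast) (auto intro!: continuous_intros c conv_half_lines F)
  have G: "Gconv F = (\<lambda>x. 1 / 2 * exp (- x) * ?L x + 1 / 2 * exp x * ?R x)"
    "Gxconv F = (\<lambda>x. - (1 / 2) * exp (- x) * ?L x + 1 / 2 * exp x * ?R x)"
    using conv_half_lines(3,4)[OF F] by auto
  have e: "exp (- x) * exp x = 1" using exp_add[of "- x" x] by simp
  have E: "((\<lambda>x. 1 / 2 * exp (- x)) has_real_derivative - (1 / 2 * exp (- x))) (at x)"
    "((\<lambda>x. - (1 / 2) * exp (- x)) has_real_derivative 1 / 2 * exp (- x)) (at x)"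
    "((\<lambda>x. 1 / 2 * exp x) has_real_derivative 1 / 2 * exp x) (at x)"
    by (auto intro!: derivative_eq_intros)
  have "(Gconv F has_real_derivative (- (1 / 2 * exp (- x)) * ?L x + exp x * F x * (1 / 2 * exp (- x)))
     + (1 / 2 * exp x * ?R x + - (exp (- x) * F x) * (1 / 2 * exp x))) (at x)"
    unfolding G(1) by (rule DERIV_add[OF DERIV_mult[OF E(1) L] DERIV_mult[OF E(3) R]])
  moreover have "(- (1 / 2 * exp (- x)) * ?L x + exp x * F x * (1 / 2 * exp (- x)))
     + (1 / 2 * exp x * ?R x + - (exp (- x) * F x) * (1 / 2 * exp x)) = Gxconv F x"
    unfolding conv_half_lines(4)[OF F] by (simp add: mult.commute mult.left_commute)
  ultimately show "(Gconv F has_real_derivative Gxconv F x) (at x)" by (simp only:)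
  have "(Gxconv F has_real_derivative (1 / 2 * exp (- x) * ?L x + exp x * F x * (- (1 / 2) * exp (- x)))
     + (1 / 2 * exp x * ?R x + - (exp (- x) * F x) * (1 / 2 * exp x))) (at x)"
    unfolding G(2) by (rule DERIV_add[OF DERIV_mult[OF E(2) L] DERIV_mult[OF E(3) R]])
  moreover have "(1 / 2 * exp (- x) * ?L x + exp x * F x * (- (1 / 2) * exp (- x)))
     + (1 / 2 * exp x * ?R x + - (exp (- x) * F x) * (1 / 2 * exp x)) = Gconv F x - (exp (- x) * exp x) * F x"
    unfolding conv_half_lines(3)[OF F] by (simp add: mult.commute mult.left_commute)
  ultimately show "(Gxconv F has_real_derivative Gconv F x - F x) (at x)" by (simp only: e mult_1)
qed

lemma conv_continuous:
  assumes F: "integrable lborel F" and c: "continuous_on UNIV F"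
  shows "continuous_on UNIV (Gconv F)" "continuous_on UNIV (Gxconv F)"
  by (rule DERIV_everywhere_continuous[OF conv_DERIV(1)[OF F c]] DERIV_everywhere_continuous[OF conv_DERIV(2)[OF F c]])+

text \<open>\<open>Z = G * p' - G\<^sub>x * p\<close> satisfies \<open>Z'' = Z\<close>, hence \<open>\<integral> Z\<^sup>2 + Z'\<^sup>2 = \<integral> (Z Z')' = 0\<close>.\<close>
lemma conv_derivative:
  assumes d: "\<And>x. (p has_real_derivative p' x) (at x)" and c: "continuous_on UNIV p'"
    and i: "integrable lborel p" and i': "integrable lborel p'"
  shows "Gxconv p' x = Gconv p x - p x"
proof -
  have cp: "continuous_on UNIV p" by (rule DERIV_everywhere_continuous[OF d])
  define Z where "Z x = Gconv p' x - Gxconv p x" for x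
  define Z' where "Z' x = Gxconv p' x - (Gconv p x - p x)" for x
  have dZ: "(Z has_real_derivative Z' x) (at x)" for x
    unfolding Z_def Z'_def by (intro DERIV_diff conv_DERIV i i' c cp)
  have dZ': "(Z' has_real_derivative Z x) (at x)" for x
  proof -
    have "(Z' has_real_derivative (Gconv p' x - p' x) - (Gxconv p x - p' x)) (at x)"
      unfolding Z'_def by (intro DERIV_diff conv_DERIV i i' c cp d)
    then show ?thesis by (simp add: Z_def)
  qed
  have cZ: "continuous_on UNIV Z" "continuous_on UNIV Z'"
    by (rule DERIV_everywhere_continuous[OF dZ] DERIV_everywhere_continuous[OF dZ'])+
  have mZ[measurable]: "Z \<in> borel_measurable borel" "Z' \<in> borel_measurable borel"
    using cZ by (auto intro: borel_measurable_continuous_onI)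
  have iZ: "integrable lborel Z" "integrable lborel Z'"
    unfolding Z_def Z'_def using Gconv_bounds(3) Gxconv_bounds(3) i i' by auto
  have bZ: "\<bar>Z x\<bar> \<le> (\<integral>y. \<bar>p' y\<bar> \<partial>lborel) / 2 + (\<integral>y. \<bar>p y\<bar> \<partial>lborel) / 2" for x
    unfolding Z_def using Gconv_bounds(2)[OF i', of x] Gxconv_bounds(2)[OF i, of x] by linarith
  have bp: "\<bar>p x\<bar> \<le> (\<integral>y. \<bar>p' y\<bar> \<partial>lborel) / 2" for x
    by (rule abs_le_half_integral_derivative[OF d c i i'])
  have bZ': "\<bar>Z' x\<bar> \<le> (\<integral>y. \<bar>p' y\<bar> \<partial>lborel) / 2 + (\<integral>y. \<bar>p y\<bar> \<partial>lborel) / 2 + (\<integral>y. \<bar>p' y\<bar> \<partial>lborel) / 2" for x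
    unfolding Z'_def using Gxconv_bounds(2)[OF i', of x] Gconv_bounds(2)[OF i, of x] bp[of x] by linarith
  have i1: "integrable lborel (\<lambda>x. Z x * Z' x)" by (rule integrable_bounded_mult[OF _ iZ(2) bZ]) measurable
  have i2: "integrable lborel (\<lambda>x. Z' x * Z' x + Z x * Z x)"
    by (intro Bochner_Integration.integrable_add integrable_bounded_mult[OF _ iZ(2) bZ'] integrable_bounded_mult[OF _ iZ(1) bZ]) measurable
  have "(\<integral>x. Z' x * Z' x + Z x * Z x \<partial>lborel) = 0"
    by (rule integral_derivative_zero[OF _ _ i1 i2])
      (auto intro!: derivative_eq_intros dZ dZ' continuous_intros cZ)
  then have "Z' x * Z' x + Z x * Z x = 0"
    by (intro continuous_nonneg_integral_zero[OF _ i2]) (auto intro!: continuous_intros cZ)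
  then have "Z' x = 0" by (simp add: add_nonneg_eq_0_iff)
  then show ?thesis by (simp add: Z'_def)
qed

text \<open>Interpolation: the squared L^2 norm is at most sup norm times L^1 norm.\<close>

lemma integral_square_le:
  fixes f :: "real \<Rightarrow> real"
  assumes i: "integrable lborel f" and b: "\<And>x. \<bar>f x\<bar> \<le> B" and n: "(\<integral>x. \<bar>f x\<bar> \<partial>lborel) \<le> N"
  shows "integrable lborel (\<lambda>x. (f x)\<^sup>2)" "(\<integral>x. (f x)\<^sup>2 \<partial>lborel) \<le> B * N"
proof -
  show ii: "integrable lborel (\<lambda>x. (f x)\<^sup>2)"
    unfolding power2_eq_square by (rule integrable_bounded_mult[OF _ i b]) (use i in auto)
  have B: "0 \<le> B" using b[of 0] by linarith
  have "(\<integral>x. (f x)\<^sup>2 \<partial>lborel) \<le> (\<integral>x. B * \<bar>f x\<bar> \<partial>lborel)"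
  proof (rule integral_mono[OF ii])
    show "(f x)\<^sup>2 \<le> B * \<bar>f x\<bar>" for x
    proof -
      have "\<bar>f x\<bar> * \<bar>f x\<bar> \<le> B * \<bar>f x\<bar>" by (rule mult_right_mono[OF b]) simp
      then show ?thesis by (simp add: power2_eq_square)
    qed
  qed (use i in simp)
  also have "\<dots> \<le> B * N" using n B by (simp add: mult_left_mono)
  finally show "(\<integral>x. (f x)\<^sup>2 \<partial>lborel) \<le> B * N" .
qed

text \<open>Origin of the constant: the function has sup norm at most N and L^1 norm at most 2N, its
  derivative at most 2N and 3N. Sup times L^1 norm gives 2N^2 and 6N^2, and 6N^2 + 2N dominates all
  the bounds at once.\<close>

lemma regular_conv:
  assumes a: "integrable lborel a" "continuous_on UNIV a" "(\<integral>x. \<bar>a x\<bar> \<partial>lborel) \<le> N"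
    and b: "integrable lborel b" "continuous_on UNIV b" "(\<integral>x. \<bar>b x\<bar> \<partial>lborel) \<le> N" "\<And>x. \<bar>b x\<bar> \<le> N"
  shows "regular (6 * N\<^sup>2 + 2 * N) (\<lambda>x. Gconv a x + Gxconv b x) (\<lambda>x. Gxconv a x + Gconv b x - b x)"
proof -
  let ?A = "\<lambda>x. Gconv a x + Gxconv b x" and ?A' = "\<lambda>x. Gxconv a x + Gconv b x - b x"
  have N: "0 \<le> N" using b(4)[of 0] by linarith
  note ga = Gconv_bounds[OF a(1)] Gxconv_bounds[OF a(1)] and gb = Gconv_bounds[OF b(1)] Gxconv_bounds[OF b(1)]
  have bA: "\<bar>?A x\<bar> \<le> N" for x using ga(2)[of x] gb(6)[of x] a(3) b(3) by linarith
  have bA': "\<bar>?A' x\<bar> \<le> 2 * N" for x using ga(6)[of x] gb(2)[of x] b(4)[of x] a(3) b(3) by linarith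
  have iA: "integrable lborel ?A" "integrable lborel ?A'" using ga gb b by auto
  have "(\<integral>x. \<bar>?A x\<bar> \<partial>lborel) \<le> (\<integral>x. \<bar>Gconv a x\<bar> + \<bar>Gxconv b x\<bar> \<partial>lborel)"
    by (intro integral_mono) (use ga gb in auto)
  also have "\<dots> \<le> 2 * N" using ga gb a b by simp
  finally have nA: "(\<integral>x. \<bar>?A x\<bar> \<partial>lborel) \<le> 2 * N" .
  have "(\<integral>x. \<bar>?A' x\<bar> \<partial>lborel) \<le> (\<integral>x. \<bar>Gxconv a x\<bar> + \<bar>Gconv b x\<bar> + \<bar>b x\<bar> \<partial>lborel)"
    by (intro integral_mono) (use ga gb b in auto)
  also have "\<dots> \<le> 3 * N" using ga gb a b by simp
  finally have nA': "(\<integral>x. \<bar>?A' x\<bar> \<partial>lborel) \<le> 3 * N" .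
  note sA = integral_square_le[OF iA(1) bA nA] and sA' = integral_square_le[OF iA(2) bA' nA']
  have NN: "0 \<le> N\<^sup>2" "N * (2 * N) = 2 * N\<^sup>2" "2 * N * (3 * N) = 6 * N\<^sup>2" by (simp_all add: power2_eq_square)
  show ?thesis unfolding regular_def
  proof (intro conjI allI)
    show "(?A has_real_derivative ?A' x) (at x)" for x
    proof -
      have "(?A has_real_derivative Gxconv a x + (Gconv b x - b x)) (at x)"
        by (intro DERIV_add conv_DERIV a b)
      then show ?thesis by (simp add: algebra_simps)
    qed
    show "continuous_on UNIV ?A'" by (intro continuous_intros conv_continuous a b)
    show "\<bar>?A x\<bar> \<le> 6 * N\<^sup>2 + 2 * N" for x using bA[of x] N NN by linarith
    show "\<bar>?A' x\<bar> \<le> 6 * N\<^sup>2 + 2 * N" for x using bA'[of x] NN by linarith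
    show "integrable lborel (\<lambda>x. (?A x)\<^sup>2)" "integrable lborel (\<lambda>x. (?A' x)\<^sup>2)" using sA sA' by auto
    show "(\<integral>x. (?A x)\<^sup>2 \<partial>lborel) \<le> 6 * N\<^sup>2 + 2 * N" using sA(2) N NN by linarith
    show "(\<integral>x. (?A' x)\<^sup>2 \<partial>lborel) \<le> 6 * N\<^sup>2 + 2 * N" using sA'(2) N NN by linarith
  qed
qed

section \<open>Riccati inequality\<close>

text \<open>The time is the infimum of the closed set where Y has reached m; it feeds the continuity
  argument for the Riccati inequality.\<close>

lemma first_passage:
  fixes Y :: "real \<Rightarrow> real"
  assumes c: "continuous_on {0..t1} Y" and t: "t \<in> {0..t1}" "m \<le> Y t" and 0: "Y 0 < m"
  obtains r where "r \<in> {0..t1}" "Y r = m" "\<And>s. 0 \<le> s \<Longrightarrow> s < r \<Longrightarrow> Y s < m"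
proof -
  define C where "C = {s \<in> {0..t1}. m \<le> Y s}"
  have "C = {0..t1} \<inter> Y -` {m..}" by (auto simp: C_def)
  then have "closed C" using continuous_closed_preimage[OF c, of "{m..}"] by simp
  have ne: "C \<noteq> {}" and bb: "bdd_below C" using t by (auto simp: C_def intro: bdd_belowI[of _ 0])
  define r where "r = Inf C"
  have rC: "r \<in> C" unfolding r_def by (rule closed_contains_Inf[OF ne bb \<open>closed C\<close>])
  have lt: "Y s < m" if "0 \<le> s" "s < r" for s
  proof (rule ccontr)
    assume "\<not> Y s < m"
    then have "s \<in> C" using that rC by (auto simp: C_def)
    then have "r \<le> s" unfolding r_def using bb by (rule cInf_lower)
    then show False using that by simp
  qed
  have "Y r \<le> m"
  proof (rule ccontr)
    assume "\<not> Y r \<le> m"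
    then have "\<exists>s\<ge>0. s \<le> r \<and> Y s = m"
      using 0 rC by (intro IVT') (auto simp: C_def intro: continuous_on_subset[OF c])
    then obtain s where "0 \<le> s" "s \<le> r" "Y s = m" by blast
    then show False using lt[of s] \<open>\<not> Y r \<le> m\<close> by (cases "s = r") auto
  qed
  then have "Y r = m" using rC by (auto simp: C_def)
  then show thesis using that rC lt by (auto simp: C_def)
qed

text \<open>Q is known only as an integral of X, which may be discontinuous in t. Replacing X by its
  continuous upper bound \<open>q\<close> gives a differentiable Y with Q \<le> Y. While Y is
  negative this means \<open>(Y t)\<^sup>2 \<le> (Q t)\<^sup>2\<close>, so Y itself satisfies the
  Riccati inequality and can be integrated in closed form.\<close>

lemma riccati_blowup_time:
  fixes Q X :: "real \<Rightarrow> real"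
  assumes t1: "0 \<le> t1" and E: "0 < E"
    and i: "\<And>t. t \<in> {0..t1} \<Longrightarrow> (X has_integral (Q t - Q 0)) {0..t}"
    and X: "\<And>t. t \<in> {0..t1} \<Longrightarrow> X t \<le> - (Q t)\<^sup>2 / (6 * E) + 27 * E\<^sup>2"
    and Q0: "Q 0 < - 9 * E * sqrt (2 * E)"
  shows "t1 \<le> sqrt (2 * E) / (3 * E) * ln ((Q 0 - 9 * E * sqrt (2 * E)) / (Q 0 + 9 * E * sqrt (2 * E)))"
proof -
  \<comment> \<open>\<open>- a\<close> is the negative zero of the right-hand side:
    \<open>a\<^sup>2\<close> is the product of \<open>6 * E\<close> and
    \<open>27 * E\<^sup>2\<close>.\<close>
  define a where "a = 9 * E * sqrt (2 * E)"
  have sE: "0 < sqrt (2 * E)" "sqrt (2 * E) * sqrt (2 * E) = 2 * E" using E by auto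
  have a0: "0 < a" using E sE unfolding a_def by simp
  have a2: "a\<^sup>2 = 162 * E ^ 3"
  proof -
    have "a\<^sup>2 = 81 * E\<^sup>2 * (sqrt (2 * E) * sqrt (2 * E))" unfolding a_def by (simp add: power2_eq_square)
    then show ?thesis unfolding sE by (simp add: power2_eq_square power3_eq_cube)
  qed
  define q where "q t = - (Q t)\<^sup>2 / (6 * E) + 27 * E\<^sup>2" for t
  have q: "q t = - ((Q t)\<^sup>2 - a\<^sup>2) / (6 * E)" for t
    unfolding q_def a2 using E by (simp add: field_simps power2_eq_square power3_eq_cube)
  have Xi: "X integrable_on {0..t1}" using i[of t1] t1 by auto
  have "continuous_on {0..t1} (\<lambda>t. Q 0 + integral {0..t} X)"
    by (intro continuous_intros indefinite_integral_continuous_1 Xi)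
  moreover have "continuous_on {0..t1} (\<lambda>t. Q 0 + integral {0..t} X) = continuous_on {0..t1} Q"
    by (rule continuous_on_cong) (use integral_unique[OF i] in auto)
  ultimately have Qc: "continuous_on {0..t1} Q" by simp
  have qc: "continuous_on {0..t1} q" unfolding q_def by (intro continuous_intros Qc) (use E in auto)
  define Y where "Y t = Q 0 + integral {0..t} q" for t
  have Y0: "Y 0 = Q 0" by (simp add: Y_def)
  have qi: "q integrable_on {0..t}" if "t \<in> {0..t1}" for t
    by (rule integrable_continuous_real[OF continuous_on_subset[OF qc]]) (use that in auto)
  have Yc: "continuous_on {0..t1} Y" unfolding Y_def
    by (intro continuous_intros indefinite_integral_continuous_1 qi) (use t1 in auto)
  have Yd: "(Y has_real_derivative q t) (at t)" if "0 < t" "t < t1" for t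
  proof -
    have "((\<lambda>t. integral {0..t} q) has_real_derivative q t) (at t within {0..t1})"
      by (rule integral_has_real_derivative[OF qc]) (use that in auto)
    moreover have "at t within {0..t1} = at t" by (rule at_within_Icc_at) (use that in auto)
    ultimately have d: "((\<lambda>t. integral {0..t} q) has_real_derivative q t) (at t)" by (simp only:)
    show ?thesis unfolding Y_def by (rule DERIV_cong[OF DERIV_add[OF DERIV_const d]]) simp
  qed
  have QY: "Q t \<le> Y t" if t: "t \<in> {0..t1}" for t
  proof -
    have "Q t - Q 0 \<le> integral {0..t} q"
      using X t by (intro has_integral_le[OF i[OF t] integrable_integral[OF qi[OF t]]]) (auto simp: q_def)
    then show ?thesis by (simp add: Y_def)
  qed
  \<comment> \<open>The midpoint of \<open>Q 0\<close> and \<open>- a\<close>: staying below it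
    keeps Y strictly below the threshold.\<close>
  define m where "m = (Q 0 - a) / 2"
  have m: "Q 0 < m" "m < - a" using Q0 unfolding m_def a_def by auto
  have q_le: "q t \<le> - ((Y t)\<^sup>2 - a\<^sup>2) / (6 * E)" "a\<^sup>2 < (Y t)\<^sup>2" if "t \<in> {0..t1}" "Y t < m" for t
  proof -
    have "(- Y t)\<^sup>2 \<le> (- Q t)\<^sup>2" using QY[OF that(1)] that(2) m(2) a0 by (intro power_mono) auto
    then show "q t \<le> - ((Y t)\<^sup>2 - a\<^sup>2) / (6 * E)" unfolding q using E by (intro divide_right_mono) auto
    have "a\<^sup>2 < (- Y t)\<^sup>2" using that(2) m(2) a0 by (intro power_strict_mono) auto
    then show "a\<^sup>2 < (Y t)\<^sup>2" by simp
  qed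
  \<comment> \<open>Continuity argument: until the first time at which Y equals m its derivative is
    nonpositive, so Y cannot have risen from \<open>Q 0\<close> to m.\<close>
  have Ym: "Y t < m" if t: "t \<in> {0..t1}" for t
  proof (rule ccontr)
    assume "\<not> Y t < m"
    then obtain r where r: "r \<in> {0..t1}" "Y r = m" "\<And>s. 0 \<le> s \<Longrightarrow> s < r \<Longrightarrow> Y s < m"
      using first_passage[OF Yc t, of m] m(1) Y0 by auto
    have "Y r \<le> Y 0"
    proof (rule DERIV_nonpos_imp_decreasing_open[of 0 r Y])
      fix s assume s: "0 < s" "s < r"
      then have "q s \<le> - ((Y s)\<^sup>2 - a\<^sup>2) / (6 * E)" "a\<^sup>2 < (Y s)\<^sup>2" using q_le[of s] r(1) r(3)[of s] by auto
      moreover have "- ((Y s)\<^sup>2 - a\<^sup>2) / (6 * E) \<le> 0" using calculation(2) E by (simp add: divide_nonpos_pos)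
      ultimately have "q s \<le> 0" by linarith
      then show "\<exists>y. DERIV Y s :> y \<and> y \<le> 0" using Yd[of s] s r(1) by auto
    qed (use r(1) in \<open>auto intro: continuous_on_subset[OF Yc]\<close>)
    then show False using r(2) m(1) Y0 by simp
  qed
  \<comment> \<open>The primitive that linearises Y' = -(Y^2 - a^2) / (6E): along Y it falls at
    least at the rate k = 2a / (6E), and it stays nonnegative.\<close>
  define L where "L t = ln (a - Y t) - ln (- a - Y t)" for t
  define k where "k = a / (3 * E)"
  have pos: "0 < a - Y t" "0 < - a - Y t" if "t \<in> {0..t1}" for t using Ym[OF that] m a0 by auto
  have "L t1 + k * t1 \<le> L 0 + k * 0"
  proof (rule DERIV_nonpos_imp_decreasing_open[OF t1, of "\<lambda>t. L t + k * t"])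
    fix s assume s: "0 < s" "s < t1"
    then have sI: "s \<in> {0..t1}" by simp
    have 1: "((\<lambda>t. L t + k * t) has_real_derivative (- q s / (a - Y s) - (- q s) / (- a - Y s) + k)) (at s)"
      unfolding L_def using pos[OF sI] by (auto intro!: derivative_eq_intros Yd s)
    have "- q s / (a - Y s) - (- q s) / (- a - Y s) = q s * (2 * a / ((Y s)\<^sup>2 - a\<^sup>2))"
      using pos[OF sI] q_le(2)[OF sI Ym[OF sI]] by (simp add: field_simps power2_eq_square)
    also have "\<dots> \<le> - ((Y s)\<^sup>2 - a\<^sup>2) / (6 * E) * (2 * a / ((Y s)\<^sup>2 - a\<^sup>2))"
      using q_le[OF sI Ym[OF sI]] a0 by (intro mult_right_mono) auto
    also have "\<dots> = - k" using q_le(2)[OF sI Ym[OF sI]] E unfolding k_def by (simp add: field_simps)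
    finally show "\<exists>y. ((\<lambda>t. L t + k * t) has_real_derivative y) (at s) \<and> y \<le> 0" using 1 by force
  next
    show "continuous_on {0..t1} (\<lambda>t. L t + k * t)" unfolding L_def
      by (intro continuous_intros Yc) (use pos in force)+
  qed
  moreover have "0 \<le> L t1" unfolding L_def using pos[of t1] t1 a0 by (simp add: ln_mono)
  ultimately have kt: "k * t1 \<le> L 0" by simp
  have p0: "0 < a - Q 0" "0 < - a - Q 0" using pos[of 0] t1 Y0 by auto
  have L0: "L 0 = ln ((Q 0 - a) / (Q 0 + a))"
  proof -
    \<comment> \<open>Both terms of the quotient in the statement are negative; the logarithm of a
      quotient splits for the positive ones.\<close>
    have "(Q 0 - a) / (Q 0 + a) = (a - Q 0) / (- a - Q 0)"
      using minus_divide_divide[of "a - Q 0" "- a - Q 0"] by simp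
    then show ?thesis unfolding L_def Y0 using p0 by (simp add: ln_div)
  qed
  have k: "k = 3 * sqrt (2 * E)" unfolding k_def a_def using E by simp
  \<comment> \<open>The factor in the statement is 2/k, so the argument yields half the stated time;
    giving away the factor 2 uses \<open>0 \<le> t1\<close>.\<close>
  have "sqrt (2 * E) / (3 * E) * k = 2" unfolding k using E sE by (simp add: field_simps)
  then have "2 * t1 = sqrt (2 * E) / (3 * E) * (k * t1)" by (simp add: mult.assoc[symmetric])
  also have "\<dots> \<le> sqrt (2 * E) / (3 * E) * L 0" using kt E by (intro mult_left_mono) auto
  finally have "t1 \<le> sqrt (2 * E) / (3 * E) * L 0" using t1 by simp
  then show ?thesis unfolding L0 a_def .
qed

section \<open>Energy and cubic functional\<close>

text \<open>All functions are arguments so that permuting them covers the three equations: the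
  sources of the second and third are that of the first with the unknowns exchanged
  (\<open>gnl_fnl\<close>, \<open>hnl_fnl\<close>).\<close>

definition nonlocal_part :: "(real \<Rightarrow> real) \<Rightarrow> (real \<Rightarrow> real) \<Rightarrow> (real \<Rightarrow> real) \<Rightarrow> (real \<Rightarrow> real) \<Rightarrow> (real \<Rightarrow> real) \<Rightarrow> (real \<Rightarrow> real) \<Rightarrow> real \<Rightarrow> real" where
  "nonlocal_part p q r px qx rx x = Gconv (\<lambda>y. p y * qx y + p y * rx y) x
     + Gxconv (\<lambda>y. fnl (p y) (q y) (r y) (px y) (qx y) (rx y)) x"

text \<open>Since the derivative of \<open>Gxconv f\<close> is \<open>Gconv f - f\<close>, no
  derivative of the source occurs.\<close>

definition nonlocal_part_deriv :: "(real \<Rightarrow> real) \<Rightarrow> (real \<Rightarrow> real) \<Rightarrow> (real \<Rightarrow> real) \<Rightarrow> (real \<Rightarrow> real) \<Rightarrow> (real \<Rightarrow> real) \<Rightarrow> (real \<Rightarrow> real) \<Rightarrow> real \<Rightarrow> real" where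
  "nonlocal_part_deriv p q r px qx rx x = Gxconv (\<lambda>y. p y * qx y + p y * rx y) x
     + Gconv (\<lambda>y. fnl (p y) (q y) (r y) (px y) (qx y) (rx y)) x - fnl (p x) (q x) (r x) (px x) (qx x) (rx x)"

lemma gnl_fnl: "gnl u v w ux vx wx = fnl v u w vx ux wx" by (simp add: gnl_def fnl_def mult.commute)
lemma hnl_fnl: "hnl u v w ux vx wx = fnl w u v wx ux vx" by (simp add: hnl_def fnl_def mult.commute)

lemma regular_mono:
  assumes "regular M f f'" "M \<le> N" shows "regular N f f'"
  using assms unfolding regular_def by (auto intro: order_trans)

lemma square_abs_bound: "\<bar>a::real\<bar> \<le> M \<Longrightarrow> a\<^sup>2 \<le> M\<^sup>2"
  using power_mono[of "\<bar>a\<bar>" M 2] by simp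

lemma integral_square_sum3_le:
  fixes a b c :: "'a \<Rightarrow> real"
  assumes m: "a \<in> borel_measurable M" "b \<in> borel_measurable M" "c \<in> borel_measurable M"
    and i: "integrable M (\<lambda>x. (a x)\<^sup>2)" "integrable M (\<lambda>x. (b x)\<^sup>2)" "integrable M (\<lambda>x. (c x)\<^sup>2)"
  shows "integrable M (\<lambda>x. (a x + b x + c x)\<^sup>2)"
    "(\<integral>x. (a x + b x + c x)\<^sup>2 \<partial>M) \<le> 3 * (\<integral>x. (a x)\<^sup>2 \<partial>M) + 3 * (\<integral>x. (b x)\<^sup>2 \<partial>M) + 3 * (\<integral>x. (c x)\<^sup>2 \<partial>M)"
proof -
  have "(\<lambda>x. a x + b x) \<in> borel_measurable M" using m by measurable
  then show ii: "integrable M (\<lambda>x. (a x + b x + c x)\<^sup>2)"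
    by (rule integrable_square_add[OF _ m(3) integrable_square_add[OF m(1,2) i(1,2)] i(3)])
  have sq: "(a + b + c)\<^sup>2 \<le> 3 * a\<^sup>2 + 3 * b\<^sup>2 + 3 * c\<^sup>2" for a b c :: real
  proof -
    have "0 \<le> (a - b)\<^sup>2 + (b - c)\<^sup>2 + (a - c)\<^sup>2" by simp
    then show ?thesis by (simp add: power2_eq_square algebra_simps)
  qed
  have "(\<integral>x. (a x + b x + c x)\<^sup>2 \<partial>M) \<le> (\<integral>x. 3 * (a x)\<^sup>2 + 3 * (b x)\<^sup>2 + 3 * (c x)\<^sup>2 \<partial>M)"
    by (rule integral_mono[OF ii _ sq]) (use i in simp)
  then show "(\<integral>x. (a x + b x + c x)\<^sup>2 \<partial>M) \<le> 3 * (\<integral>x. (a x)\<^sup>2 \<partial>M) + 3 * (\<integral>x. (b x)\<^sup>2 \<partial>M) + 3 * (\<integral>x. (c x)\<^sup>2 \<partial>M)"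
    using i by simp
qed

text \<open>The 9 is dictated by the squared L^2 norms: the square of a sum of three costs a factor
  3 on each of three terms.\<close>

lemma regular_sum3:
  assumes p: "regular M p px" and q: "regular M q qx" and r: "regular M r rx"
  shows "regular (9 * M) (\<lambda>x. p x + q x + r x) (\<lambda>x. px x + qx x + rx x)"
proof -
  note P = regularD[OF p] and Q = regularD[OF q] and R = regularD[OF r]
  have pm: "p \<in> borel_measurable lborel" "q \<in> borel_measurable lborel" "r \<in> borel_measurable lborel"
    "px \<in> borel_measurable lborel" "qx \<in> borel_measurable lborel" "rx \<in> borel_measurable lborel"
    using P(10,11) Q(10,11) R(10,11) by auto
  note i = integral_square_sum3_le[OF pm(1-3) P(5) Q(5) R(5)] integral_square_sum3_le[OF pm(4-6) P(6) Q(6) R(6)]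
  have n: "(\<integral>x. (p x + q x + r x)\<^sup>2 \<partial>lborel) \<le> 9 * M" using i(2) P(7) Q(7) R(7) by linarith
  have nx: "(\<integral>x. (px x + qx x + rx x)\<^sup>2 \<partial>lborel) \<le> 9 * M" using i(4) P(8) Q(8) R(8) by linarith
  show ?thesis unfolding regular_def
  proof (intro conjI allI)
    show "((\<lambda>x. p x + q x + r x) has_real_derivative px x + qx x + rx x) (at x)" for x
      by (intro DERIV_add P(1) Q(1) R(1))
    show "continuous_on UNIV (\<lambda>x. px x + qx x + rx x)" by (intro continuous_intros P(2) Q(2) R(2))
    show "\<bar>p x + q x + r x\<bar> \<le> 9 * M" "\<bar>px x + qx x + rx x\<bar> \<le> 9 * M" for x
      using P(3,4)[of x] Q(3,4)[of x] R(3,4)[of x] P(12) by linarith+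
  qed (fact i(1) i(3) n nx)+
qed

text \<open>Six squares with the factor 3: each has integral at most M and is pointwise at most
  \<open>M\<^sup>2\<close>; the sum of the two bounds serves for both purposes.\<close>

lemma quadratic_bounds:
  assumes p: "regular M p px" and q: "regular M q qx" and r: "regular M r rx"
    and c: "continuous_on UNIV g"
    and b: "\<And>x. \<bar>g x\<bar> \<le> 3 * ((p x)\<^sup>2 + (q x)\<^sup>2 + (r x)\<^sup>2 + (px x)\<^sup>2 + (qx x)\<^sup>2 + (rx x)\<^sup>2)"
  shows "integrable lborel g" "(\<integral>x. \<bar>g x\<bar> \<partial>lborel) \<le> 18 * M + 18 * M\<^sup>2" "\<bar>g x\<bar> \<le> 18 * M + 18 * M\<^sup>2"
proof -
  note P = regularD[OF p] and Q = regularD[OF q] and R = regularD[OF r]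
  let ?B = "\<lambda>x. 3 * ((p x)\<^sup>2 + (q x)\<^sup>2 + (r x)\<^sup>2 + (px x)\<^sup>2 + (qx x)\<^sup>2 + (rx x)\<^sup>2)"
  have Bi: "integrable lborel ?B" using P(5,6) Q(5,6) R(5,6) by auto
  show i: "integrable lborel g"
    by (rule Bochner_Integration.integrable_bound[OF Bi])
      (use order_trans[OF b abs_ge_self] borel_measurable_continuous_onI[OF c] in auto)
  have "(\<integral>x. \<bar>g x\<bar> \<partial>lborel) \<le> (\<integral>x. ?B x \<partial>lborel)" by (intro integral_mono Bi b) (use i in auto)
  also have "\<dots> \<le> 18 * M" using P(5-8) Q(5-8) R(5-8) by simp
  finally show "(\<integral>x. \<bar>g x\<bar> \<partial>lborel) \<le> 18 * M + 18 * M\<^sup>2" using zero_le_power2[of M] by linarith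
  have "?B x \<le> 18 * M\<^sup>2"
    using square_abs_bound[OF P(3)[of x]] square_abs_bound[OF P(4)[of x]] square_abs_bound[OF Q(3)[of x]]
      square_abs_bound[OF Q(4)[of x]] square_abs_bound[OF R(3)[of x]] square_abs_bound[OF R(4)[of x]] by simp
  then show "\<bar>g x\<bar> \<le> 18 * M + 18 * M\<^sup>2" using b[of x] P(12) by linarith
qed

lemma quadratic_form_bounds:
  fixes u v w ux vx wx :: real
  shows "\<bar>u * vx + u * wx\<bar> \<le> 3 * (u\<^sup>2 + v\<^sup>2 + w\<^sup>2 + ux\<^sup>2 + vx\<^sup>2 + wx\<^sup>2)"
    "\<bar>fnl u v w ux vx wx\<bar> \<le> 3 * (u\<^sup>2 + v\<^sup>2 + w\<^sup>2 + ux\<^sup>2 + vx\<^sup>2 + wx\<^sup>2)"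
proof -
  note n = zero_le_power2[of u] zero_le_power2[of v] zero_le_power2[of w] zero_le_power2[of ux] zero_le_power2[of vx] zero_le_power2[of wx]
  show "\<bar>u * vx + u * wx\<bar> \<le> 3 * (u\<^sup>2 + v\<^sup>2 + w\<^sup>2 + ux\<^sup>2 + vx\<^sup>2 + wx\<^sup>2)"
    using abs_mult_le_sum_squares[of u vx] abs_mult_le_sum_squares[of u wx] n
      abs_triangle_ineq[of "u * vx" "u * wx"] by argo
  show "\<bar>fnl u v w ux vx wx\<bar> \<le> 3 * (u\<^sup>2 + v\<^sup>2 + w\<^sup>2 + ux\<^sup>2 + vx\<^sup>2 + wx\<^sup>2)"
    using abs_le_D1[OF abs_mult_le_sum_squares[of ux vx]] abs_le_D1[OF abs_mult_le_sum_squares[of ux wx]]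
      abs_le_D2[OF abs_mult_le_sum_squares[of ux vx]] abs_le_D2[OF abs_mult_le_sum_squares[of ux wx]] n
    unfolding fnl_def by (intro abs_leI) argo+
qed

lemma source_terms:
  assumes p: "regular M p px" and q: "regular M q qx" and r: "regular M r rx"
  defines "a \<equiv> \<lambda>y. p y * qx y + p y * rx y" and "f \<equiv> \<lambda>y. fnl (p y) (q y) (r y) (px y) (qx y) (rx y)"
  shows "integrable lborel a" "continuous_on UNIV a" "(\<integral>x. \<bar>a x\<bar> \<partial>lborel) \<le> 18 * M + 18 * M\<^sup>2"
    "integrable lborel f" "continuous_on UNIV f" "(\<integral>x. \<bar>f x\<bar> \<partial>lborel) \<le> 18 * M + 18 * M\<^sup>2" "\<bar>f x\<bar> \<le> 18 * M + 18 * M\<^sup>2"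
proof -
  note P = regularD[OF p] and Q = regularD[OF q] and R = regularD[OF r]
  show ca: "continuous_on UNIV a" unfolding a_def by (intro continuous_intros P(9) Q(2) R(2))
  show cf: "continuous_on UNIV f" unfolding f_def fnl_def by (intro continuous_intros P(2,9) Q(2,9) R(2,9)) auto
  note A = quadratic_bounds[OF p q r ca] and F = quadratic_bounds[OF p q r cf]
  show "integrable lborel a" "(\<integral>x. \<bar>a x\<bar> \<partial>lborel) \<le> 18 * M + 18 * M\<^sup>2"
    by (rule A, simp only: a_def quadratic_form_bounds)+
  show "integrable lborel f" "(\<integral>x. \<bar>f x\<bar> \<partial>lborel) \<le> 18 * M + 18 * M\<^sup>2" "\<bar>f x\<bar> \<le> 18 * M + 18 * M\<^sup>2"
    by (rule F, simp only: f_def quadratic_form_bounds)+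
qed

text \<open>The constant of \<open>regular_conv\<close> for the bound N = 18M + 18M^2 of
  \<open>source_terms\<close>.\<close>

definition nonlocal_bound :: "real \<Rightarrow> real" where
  "nonlocal_bound M = 6 * (18 * M + 18 * M\<^sup>2)\<^sup>2 + 2 * (18 * M + 18 * M\<^sup>2)"

lemma regular_nonlocal_part:
  assumes p: "regular M p px" and q: "regular M q qx" and r: "regular M r rx"
  shows "regular (nonlocal_bound M) (nonlocal_part p q r px qx rx) (nonlocal_part_deriv p q r px qx rx)"
  using regular_conv[OF source_terms[OF p q r]] unfolding nonlocal_part_def[abs_def] nonlocal_part_deriv_def[abs_def] nonlocal_bound_def .

text \<open>\<open>H\<close> collects the exact derivatives in the energy balance of one component; the remainders \<open>K\<close>
  of the three components cancel only in the sum.\<close>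
lemma energy_density:
  assumes p: "regular M p px" and q: "regular M q qx" and r: "regular M r rx" and S: "regular N S Sx"
  defines "a \<equiv> \<lambda>y. p y * qx y + p y * rx y" and "f \<equiv> \<lambda>y. fnl (p y) (q y) (r y) (px y) (qx y) (rx y)"
    and "A \<equiv> nonlocal_part p q r px qx rx" and "Ax \<equiv> nonlocal_part_deriv p q r px qx rx"
  defines "J \<equiv> \<lambda>x. - 2 * (p x * (S x * px x + A x)) + (Sx x * (px x)\<^sup>2 - 2 * px x * (Sx x * px x + Ax x))"
    and "H \<equiv> \<lambda>x. (p x) ^ 3 - 2 * p x * Gxconv a x - 2 * p x * Gconv f x - S x * (p x)\<^sup>2"
    and "K \<equiv> \<lambda>x. - 2 * p x * a x + 2 * px x * f x + Sx x * (p x)\<^sup>2 - Sx x * (px x)\<^sup>2 - 3 * (p x)\<^sup>2 * px x"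
  shows "integrable lborel (\<lambda>x. p x * (S x * px x + A x))"
    "integrable lborel (\<lambda>x. Sx x * (px x)\<^sup>2 - 2 * px x * (Sx x * px x + Ax x))"
    "integrable lborel H" "(H has_real_derivative J x - K x) (at x)" "continuous_on UNIV J"
proof -
  note P = regularD[OF p] and Q = regularD[OF q] and R = regularD[OF r] and S' = regularD[OF S]
  note A' = regularD[OF regular_nonlocal_part[OF p q r], folded A_def Ax_def]
  note s = source_terms[OF p q r, folded a_def f_def]
  note [measurable] = P(10,11) Q(10,11) R(10,11) S'(10,11) A'(10,11)
  \<comment> \<open>\<open>regular_rhs\<close> asks for one common constant, hence the
    maxima.\<close>
  have i1: "integrable lborel (\<lambda>x. (S x * px x + A x)\<^sup>2)"
    using regular_rhs[OF regular_mono[OF S, of "max N (max M (nonlocal_bound M))"] regular_mono[OF p, of "max N (max M (nonlocal_bound M))"]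
      regular_mono[OF regular_nonlocal_part[OF p q r, folded A_def Ax_def], of "max N (max M (nonlocal_bound M))"]] by simp
  show "integrable lborel (\<lambda>x. p x * (S x * px x + A x))"
    by (rule integrable_mult_of_square[OF _ _ P(5) i1]) measurable
  have i2: "integrable lborel (\<lambda>x. (Sx x * px x + Ax x)\<^sup>2)"
    by (rule integrable_square_add[OF _ _ integrable_square_bounded_mult[OF _ _ P(6) S'(4)] A'(6)]) measurable
  have "integrable lborel (\<lambda>x. px x * (Sx x * px x + Ax x))"
    by (rule integrable_mult_of_square[OF _ _ P(6) i2]) measurable
  then have "integrable lborel (\<lambda>x. 2 * (px x * (Sx x * px x + Ax x)))" by (rule integrable_mult_right)
  then show "integrable lborel (\<lambda>x. Sx x * (px x)\<^sup>2 - 2 * px x * (Sx x * px x + Ax x))"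
    unfolding mult.assoc[symmetric]
    by (intro Bochner_Integration.integrable_diff integrable_bounded_mult[OF _ P(6) S'(4)]) (simp_all add: mult.assoc)
  have p3: "integrable lborel (\<lambda>x. p x * (p x)\<^sup>2)" by (rule integrable_bounded_mult[OF _ P(5) P(3)]) measurable
  have pG: "integrable lborel (\<lambda>x. p x * Gxconv a x)" "integrable lborel (\<lambda>x. p x * Gconv f x)"
    by (rule integrable_bounded_mult[OF _ Gxconv_bounds(3)[OF s(1)] P(3)] integrable_bounded_mult[OF _ Gconv_bounds(3)[OF s(4)] P(3)]; measurable)+
  have "integrable lborel (\<lambda>x. S x * (p x)\<^sup>2)" by (rule integrable_bounded_mult[OF _ P(5) S'(3)]) measurable
  then have "integrable lborel (\<lambda>x. p x * (p x)\<^sup>2 - 2 * (p x * Gxconv a x) - 2 * (p x * Gconv f x) - S x * (p x)\<^sup>2)"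
    using p3 pG by auto
  moreover have "(\<lambda>x. p x * (p x)\<^sup>2 - 2 * (p x * Gxconv a x) - 2 * (p x * Gconv f x) - S x * (p x)\<^sup>2) = H"
    unfolding H_def by (simp add: fun_eq_iff power2_eq_square power3_eq_cube)
  ultimately show "integrable lborel H" by simp
  have d: "(H has_real_derivative 3 * (p x)\<^sup>2 * px x - (2 * px x * Gxconv a x + 2 * p x * (Gconv a x - a x))
     - (2 * px x * Gconv f x + 2 * p x * Gxconv f x) - (Sx x * (p x)\<^sup>2 + S x * (2 * p x * px x))) (at x)"
    unfolding H_def
    by (auto intro!: derivative_eq_intros P(1) S'(1) conv_DERIV s simp: algebra_simps power2_eq_square)
  have "J x - K x = 3 * (p x)\<^sup>2 * px x - (2 * px x * Gxconv a x + 2 * p x * (Gconv a x - a x))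
     - (2 * px x * Gconv f x + 2 * p x * Gxconv f x) - (Sx x * (p x)\<^sup>2 + S x * (2 * p x * px x))"
    unfolding J_def K_def A_def Ax_def nonlocal_part_def nonlocal_part_deriv_def a_def[symmetric] f_def[symmetric]
    by (simp add: f_def algebra_simps power2_eq_square)
  then show "(H has_real_derivative J x - K x) (at x)" using d by (simp only:)
  show "continuous_on UNIV J" unfolding J_def
    by (intro continuous_intros P(2,9) S'(2,9) A'(2,9))
qed

text \<open>Up to the remainders \<open>K\<close> of \<open>energy_density\<close> the integrand is
  an exact derivative, and the three remainders cancel pointwise. The part of the products
  \<open>2 * px * f\<close> that is cubic in derivatives sums to \<open>S\<^sub>x\<close> times the
  sum of the squared derivatives, which the terms \<open>- Sx * px\<^sup>2\<close> remove; the part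
  with undifferentiated squares is removed by the remaining terms.\<close>

lemma energy_flux_zero:
  assumes u: "regular M u ux" and v: "regular M v vx" and w: "regular M w wx"
  defines "S \<equiv> \<lambda>x. u x + v x + w x" and "Sx \<equiv> \<lambda>x. ux x + vx x + wx x"
  defines "I \<equiv> \<lambda>p q r px qx rx. - 2 * (\<integral>x. p x * (S x * px x + nonlocal_part p q r px qx rx x) \<partial>lborel)
     + (\<integral>x. Sx x * (px x)\<^sup>2 - 2 * px x * (Sx x * px x + nonlocal_part_deriv p q r px qx rx x) \<partial>lborel)"
  shows "I u v w ux vx wx + I v u w vx ux wx + I w u v wx ux vx = 0"
proof -
  have S: "regular (9 * M) S Sx" unfolding S_def Sx_def by (rule regular_sum3[OF u v w])
  note U = energy_density[OF u v w S] and V = energy_density[OF v u w S] and W = energy_density[OF w u v S]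
  let ?J = "\<lambda>p q r px qx rx x. - 2 * (p x * (S x * px x + nonlocal_part p q r px qx rx x)) + (Sx x * (px x)\<^sup>2 - 2 * px x * (Sx x * px x + nonlocal_part_deriv p q r px qx rx x))"
  have JI: "integrable lborel (?J p q r px qx rx)" "I p q r px qx rx = (\<integral>x. ?J p q r px qx rx x \<partial>lborel)"
    if "regular M p px" "regular M q qx" "regular M r rx" for p q r px qx rx
    using energy_density(1,2)[OF that S] unfolding I_def by simp_all
  let ?H = "\<lambda>p q r px qx rx x. (p x) ^ 3 - 2 * p x * Gxconv (\<lambda>y. p y * qx y + p y * rx y) x
     - 2 * p x * Gconv (\<lambda>y. fnl (p y) (q y) (r y) (px y) (qx y) (rx y)) x - S x * (p x)\<^sup>2"
  let ?J3 = "\<lambda>x. ?J u v w ux vx wx x + ?J v u w vx ux wx x + ?J w u v wx ux vx x"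
  have "I u v w ux vx wx + I v u w vx ux wx + I w u v wx ux vx = (\<integral>x. ?J3 x \<partial>lborel)"
    using JI[OF u v w] JI[OF v u w] JI[OF w u v] by simp
  also have "\<dots> = 0"
  proof (rule integral_derivative_zero[where h = "\<lambda>x. ?H u v w ux vx wx x + ?H v u w vx ux wx x + ?H w u v wx ux vx x"])
    show "((\<lambda>x. ?H u v w ux vx wx x + ?H v u w vx ux wx x + ?H w u v wx ux vx x) has_real_derivative ?J3 x) (at x)" for x
    proof (rule DERIV_cong[OF DERIV_add[OF DERIV_add[OF U(4) V(4)] W(4)]])
      let ?a = "u x" and ?b = "v x" and ?c = "w x" and ?d = "ux x" and ?e = "vx x" and ?f = "wx x"
      let ?K = "\<lambda>p q r px qx rx. - 2 * p * (p * qx + p * rx) + 2 * px * fnl p q r px qx rx + (?d + ?e + ?f) * p\<^sup>2 - (?d + ?e + ?f) * px\<^sup>2 - 3 * p\<^sup>2 * px"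
      have "?K ?a ?b ?c ?d ?e ?f + ?K ?b ?a ?c ?e ?d ?f + ?K ?c ?a ?b ?f ?d ?e = 0"
        unfolding fnl_def by (simp add: field_simps power2_eq_square)
      then show "?J u v w ux vx wx x - (- 2 * u x * (u x * vx x + u x * wx x) + 2 * ux x * fnl (u x) (v x) (w x) (ux x) (vx x) (wx x) + Sx x * (u x)\<^sup>2 - Sx x * (ux x)\<^sup>2 - 3 * (u x)\<^sup>2 * ux x) +
        (?J v u w vx ux wx x - (- 2 * v x * (v x * ux x + v x * wx x) + 2 * vx x * fnl (v x) (u x) (w x) (vx x) (ux x) (wx x) + Sx x * (v x)\<^sup>2 - Sx x * (vx x)\<^sup>2 - 3 * (v x)\<^sup>2 * vx x)) +
        (?J w u v wx ux vx x - (- 2 * w x * (w x * ux x + w x * vx x) + 2 * wx x * fnl (w x) (u x) (v x) (wx x) (ux x) (vx x) + Sx x * (w x)\<^sup>2 - Sx x * (wx x)\<^sup>2 - 3 * (w x)\<^sup>2 * wx x)) = ?J3 x"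
        unfolding Sx_def by linarith
    qed
    show "continuous_on UNIV ?J3" by (intro continuous_on_add U(5) V(5) W(5))
    show "integrable lborel (\<lambda>x. ?H u v w ux vx wx x + ?H v u w vx ux wx x + ?H w u v wx ux vx x)"
      by (intro Bochner_Integration.integrable_add U(3) V(3) W(3))
    show "integrable lborel ?J3" by (intro Bochner_Integration.integrable_add JI u v w)
  qed
  finally show ?thesis .
qed

section \<open>Upper bound for the rate of the cubic functional\<close>

lemma Gconv_add:
  assumes "integrable lborel f" "integrable lborel g"
  shows "Gconv (\<lambda>y. f y + g y) x = Gconv f x + Gconv g x"
  using Gconv_bounds(1)[OF assms(1), of x] Gconv_bounds(1)[OF assms(2), of x]
  unfolding Gconv_def distrib_left by (rule Bochner_Integration.integral_add)

lemma Gxconv_add: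
  assumes "integrable lborel f" "integrable lborel g"
  shows "Gxconv (\<lambda>y. f y + g y) x = Gxconv f x + Gxconv g x"
  using Gxconv_bounds(1)[OF assms(1), of x] Gxconv_bounds(1)[OF assms(2), of x]
  unfolding Gxconv_def distrib_left by (rule Bochner_Integration.integral_add)

text \<open>The kernel lies between 0 and 1/2, so only the negative part of F counts, and with at
  most half its mass.\<close>

lemma Gconv_lower_bound:
  assumes F: "integrable lborel F" and g: "integrable lborel g" and g0: "\<And>x. 0 \<le> g x" and le: "\<And>x. - g x \<le> F x"
  shows "- ((\<integral>x. g x \<partial>lborel) / 2) \<le> Gconv F x"
proof -
  have "(\<integral>y. - (1 / 2 * g y) \<partial>lborel) \<le> Gconv F x"
    unfolding Gconv_def
  proof (rule integral_mono[OF _ Gconv_bounds(1)[OF F]])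
    show "- (1 / 2 * g y) \<le> 1 / 2 * exp (- \<bar>x - y\<bar>) * F y" for y
    proof -
      have "1 / 2 * exp (- \<bar>x - y\<bar>) * g y \<le> 1 / 2 * g y" using g0 by (intro mult_right_mono) auto
      moreover have "1 / 2 * exp (- \<bar>x - y\<bar>) * (- g y) \<le> 1 / 2 * exp (- \<bar>x - y\<bar>) * F y"
        using le by (intro mult_left_mono) auto
      ultimately show ?thesis by linarith
    qed
  qed (use g in simp)
  then show ?thesis by simp
qed

text \<open>\<open>abs_le_half_integral_derivative\<close> for the square of p, whose derivative 2 p
  p_x is at most p^2 + p_x^2 in modulus. The 1/2 enters the constant 9/4 of the pointwise inequality
  for \<open>S\<^sub>x\<close>.\<close>

lemma sup_square_le:
  assumes p: "regular M p px"
  shows "(p x)\<^sup>2 \<le> ((\<integral>x. (p x)\<^sup>2 \<partial>lborel) + (\<integral>x. (px x)\<^sup>2 \<partial>lborel)) / 2"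
proof -
  note P = regularD[OF p]
  note [measurable] = P(10,11)
  have ppx: "integrable lborel (\<lambda>x. p x * px x)" by (rule integrable_mult_of_square[OF _ _ P(5,6)]) measurable
  have ii: "integrable lborel (\<lambda>x. 2 * (p x * px x))" using ppx by (rule integrable_mult_right)
  have "\<bar>(p x)\<^sup>2\<bar> \<le> (\<integral>x. \<bar>2 * (p x * px x)\<bar> \<partial>lborel) / 2"
    by (rule abs_le_half_integral_derivative[OF _ _ P(5) ii])
      (auto intro!: derivative_eq_intros P(1) continuous_intros P(2,9))
  moreover have "(\<integral>x. \<bar>2 * (p x * px x)\<bar> \<partial>lborel) \<le> (\<integral>x. (p x)\<^sup>2 + (px x)\<^sup>2 \<partial>lborel)"
  proof (rule integral_mono)
    show "\<bar>2 * (p x * px x)\<bar> \<le> (p x)\<^sup>2 + (px x)\<^sup>2" for x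
    proof -
      have "0 \<le> (\<bar>p x\<bar> - \<bar>px x\<bar>)\<^sup>2" by simp
      then show ?thesis by (simp add: power2_diff abs_mult)
    qed
  qed (use ii P(5,6) in auto)
  moreover have "(\<integral>x. (p x)\<^sup>2 + (px x)\<^sup>2 \<partial>lborel) = (\<integral>x. (p x)\<^sup>2 \<partial>lborel) + (\<integral>x. (px x)\<^sup>2 \<partial>lborel)"
    using P(5,6) by (rule Bochner_Integration.integral_add)
  ultimately show ?thesis by simp
qed

text \<open>Summed over the components, the sources \<open>u v\<^sub>x + u w\<^sub>x\<close> and
  their permutations form the derivative of u v + u w + v w, and \<open>conv_derivative\<close>
  turns \<open>Gxconv\<close> of it into \<open>Gconv\<close> minus the identity. So every
  \<open>Gxconv\<close> disappears and one quadratic expression F remains.\<close>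

lemma nonlocal_part_deriv_sum:
  assumes u: "regular M u ux" and v: "regular M v vx" and w: "regular M w wx"
  defines "F \<equiv> \<lambda>x. 3 / 2 * ((u x)\<^sup>2 + (v x)\<^sup>2 + (w x)\<^sup>2) + 1 / 2 * (u x + v x + w x)\<^sup>2
      - 3 / 2 * ((ux x)\<^sup>2 + (vx x)\<^sup>2 + (wx x)\<^sup>2) + (ux x + vx x + wx x)\<^sup>2"
  shows "nonlocal_part_deriv u v w ux vx wx x + nonlocal_part_deriv v u w vx ux wx x + nonlocal_part_deriv w u v wx ux vx x = Gconv F x - F x"
    "integrable lborel F"
proof -
  note s = source_terms[OF u v w] and s2 = source_terms[OF v u w] and s3 = source_terms[OF w u v]
  note U = regularD[OF u] and V = regularD[OF v] and W = regularD[OF w]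
  note [measurable] = U(10,11) V(10,11) W(10,11)
  let ?p = "\<lambda>x. u x * v x + u x * w x + v x * w x"
  let ?p' = "\<lambda>y. (u y * vx y + u y * wx y) + (v y * ux y + v y * wx y) + (w y * ux y + w y * vx y)"
  let ?f = "\<lambda>y. fnl (u y) (v y) (w y) (ux y) (vx y) (wx y) + fnl (v y) (u y) (w y) (vx y) (ux y) (wx y) + fnl (w y) (u y) (v y) (wx y) (ux y) (vx y)"
  have pi: "integrable lborel ?p"
    by (intro Bochner_Integration.integrable_add integrable_mult_of_square U(5) V(5) W(5)) measurable
  have p'i: "integrable lborel ?p'" by (rule Bochner_Integration.integrable_add[OF Bochner_Integration.integrable_add[OF s(1) s2(1)] s3(1)])
  have fi: "integrable lborel ?f" by (rule Bochner_Integration.integrable_add[OF Bochner_Integration.integrable_add[OF s(4) s2(4)] s3(4)])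
  have "Gxconv ?p' x = Gconv ?p x - ?p x"
  proof (rule conv_derivative[OF _ _ pi p'i])
    show "(?p has_real_derivative ?p' x) (at x)" for x
      by (auto intro!: derivative_eq_intros U(1) V(1) W(1) simp: algebra_simps)
    show "continuous_on UNIV ?p'" by (intro continuous_intros U(2,9) V(2,9) W(2,9))
  qed
  moreover have "Gxconv ?p' x = Gxconv (\<lambda>y. u y * vx y + u y * wx y) x + Gxconv (\<lambda>y. v y * ux y + v y * wx y) x + Gxconv (\<lambda>y. w y * ux y + w y * vx y) x"
    using Gxconv_add[OF Bochner_Integration.integrable_add[OF s(1) s2(1)] s3(1), of x]
    unfolding Gxconv_add[OF s(1) s2(1), of x] .
  moreover have "Gconv ?f x = Gconv (\<lambda>y. fnl (u y) (v y) (w y) (ux y) (vx y) (wx y)) x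
     + Gconv (\<lambda>y. fnl (v y) (u y) (w y) (vx y) (ux y) (wx y)) x + Gconv (\<lambda>y. fnl (w y) (u y) (v y) (wx y) (ux y) (vx y)) x"
    using Gconv_add[OF Bochner_Integration.integrable_add[OF s(4) s2(4)] s3(4), of x]
    unfolding Gconv_add[OF s(4) s2(4), of x] .
  moreover have "Gconv (\<lambda>y. ?p y + ?f y) x = Gconv ?p x + Gconv ?f x" by (rule Gconv_add[OF pi fi])
  moreover have F: "(\<lambda>y. ?p y + ?f y) = F"
    unfolding F_def fnl_def by (rule ext) (simp add: field_simps power2_eq_square)
  moreover have "?p x + ?f x = F x" by (rule fun_cong[OF F])
  ultimately show "nonlocal_part_deriv u v w ux vx wx x + nonlocal_part_deriv v u w vx ux wx x + nonlocal_part_deriv w u v wx ux vx x = Gconv F x - F x"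
    unfolding nonlocal_part_deriv_def by simp
  show "integrable lborel F" unfolding F[symmetric] using pi fi by (rule Bochner_Integration.integrable_add)
qed

text \<open>The shape \<open>0 * ... + 1 * ...\<close> is that of \<open>power_has_integral\<close>
  at \<open>a = 0\<close>, \<open>b = 1\<close>. After the pointwise bound on \<open>- P\<close> is
  multiplied by \<open>3 * (Sx x)\<^sup>2\<close>, the fourth power has coefficient 1 - 3 + 3/2 =
  -1/2, and Cauchy-Schwarz between \<open>S\<^sub>x\<close> and its square converts this into the
  negative square of Q.\<close>

lemma cubic_flux_le:
  assumes u: "regular M u ux" and v: "regular M v vx" and w: "regular M w wx"
  defines "S \<equiv> \<lambda>x. u x + v x + w x" and "Sx \<equiv> \<lambda>x. ux x + vx x + wx x"
  defines "E \<equiv> (\<integral>x. (u x)\<^sup>2 \<partial>lborel) + (\<integral>x. (ux x)\<^sup>2 \<partial>lborel) + ((\<integral>x. (v x)\<^sup>2 \<partial>lborel) + (\<integral>x. (vx x)\<^sup>2 \<partial>lborel))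
     + ((\<integral>x. (w x)\<^sup>2 \<partial>lborel) + (\<integral>x. (wx x)\<^sup>2 \<partial>lborel))"
  assumes E: "E \<le> E0" and E0: "0 < E0"
  shows "(\<integral>x. Sx x * (0 * (Sx x)\<^sup>2 + 1 * (Sx x) ^ 3) - (2 * 0 * Sx x + 3 * 1 * (Sx x)\<^sup>2) *
        (Sx x * Sx x + (nonlocal_part_deriv u v w ux vx wx x + nonlocal_part_deriv v u w vx ux wx x + nonlocal_part_deriv w u v wx ux vx x)) \<partial>lborel)
     \<le> - (\<integral>x. 0 * (Sx x)\<^sup>2 + 1 * (Sx x) ^ 3 \<partial>lborel)\<^sup>2 / (6 * E0) + 27 * E0\<^sup>2"
proof -
  note U = regularD[OF u] and V = regularD[OF v] and W = regularD[OF w]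
  have S: "regular (9 * M) S Sx" unfolding S_def Sx_def by (rule regular_sum3[OF u v w])
  note S' = regularD[OF S]
  note [measurable] = U(10,11) V(10,11) W(10,11) S'(10,11)
  define F where "F x = 3 / 2 * ((u x)\<^sup>2 + (v x)\<^sup>2 + (w x)\<^sup>2) + 1 / 2 * (S x)\<^sup>2
      - 3 / 2 * ((ux x)\<^sup>2 + (vx x)\<^sup>2 + (wx x)\<^sup>2) + (Sx x)\<^sup>2" for x
  define P where "P x = nonlocal_part_deriv u v w ux vx wx x + nonlocal_part_deriv v u w vx ux wx x + nonlocal_part_deriv w u v wx ux vx x" for x
  define g where "g x = 3 / 2 * ((ux x)\<^sup>2 + (vx x)\<^sup>2 + (wx x)\<^sup>2)" for x
  have PF: "P x = Gconv F x - F x" and Fi: "integrable lborel F" for x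
    using nonlocal_part_deriv_sum[OF u v w] unfolding P_def F_def[abs_def] S_def Sx_def by auto
  have gi: "integrable lborel g" unfolding g_def using U(6) V(6) W(6) by simp
  have gint: "(\<integral>x. g x \<partial>lborel) \<le> 3 / 2 * E"
    unfolding g_def E_def using U(5,6) V(5,6) W(5,6) by simp
  have lowb: "- ((\<integral>x. g x \<partial>lborel) / 2) \<le> Gconv F x" for x
    by (rule Gconv_lower_bound[OF Fi gi]) (auto simp: g_def F_def)
  have GF: "- (3 / 4 * E) \<le> Gconv F x" for x using lowb[of x] gint by argo
  have sq3: "(a + b + c)\<^sup>2 \<le> 3 * (a\<^sup>2 + b\<^sup>2 + c\<^sup>2)" for a b c :: real
  proof -
    have "0 \<le> (a - b)\<^sup>2 + (b - c)\<^sup>2 + (a - c)\<^sup>2" by simp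
    then show ?thesis by (simp add: power2_eq_square algebra_simps)
  qed
  \<comment> \<open>9/4 is three times 3/4: one share from \<open>GF\<close>, one from the squares
    of u, v, w (sum at most E / 2), one from \<open>(S x)\<^sup>2\<close> (at most 3 E / 2). The
    gradient part of F is at most half of \<open>(Sx x)\<^sup>2\<close>, because the squared
    derivatives sum to at least a third of it.\<close>
  have Pb: "- P x \<le> 1 / 2 * (Sx x)\<^sup>2 + 9 / 4 * E" for x
  proof -
    have "(u x)\<^sup>2 + (v x)\<^sup>2 + (w x)\<^sup>2 \<le> E / 2"
      using add_mono[OF add_mono[OF sup_square_le[OF u, of x] sup_square_le[OF v, of x]] sup_square_le[OF w, of x]]
      unfolding E_def add_divide_distrib .
    moreover have "(S x)\<^sup>2 \<le> 3 * ((u x)\<^sup>2 + (v x)\<^sup>2 + (w x)\<^sup>2)" unfolding S_def by (rule sq3)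
    moreover have "(Sx x)\<^sup>2 \<le> 3 * ((ux x)\<^sup>2 + (vx x)\<^sup>2 + (wx x)\<^sup>2)" unfolding Sx_def by (rule sq3)
    moreover have "F x = 3 / 2 * ((u x)\<^sup>2 + (v x)\<^sup>2 + (w x)\<^sup>2) + 1 / 2 * (S x)\<^sup>2
      - 3 / 2 * ((ux x)\<^sup>2 + (vx x)\<^sup>2 + (wx x)\<^sup>2) + (Sx x)\<^sup>2" by (rule F_def)
    ultimately show ?thesis unfolding PF using GF[of x] by argo
  qed
  have i2: "integrable lborel (\<lambda>x. (Sx x)\<^sup>2)" by (rule S'(6))
  have i4: "integrable lborel (\<lambda>x. ((Sx x)\<^sup>2)\<^sup>2)"
    using integrable_square_bounded_mult[OF _ _ S'(6) S'(4)] by (simp add: power2_eq_square)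
  have i3: "integrable lborel (\<lambda>x. Sx x * (Sx x)\<^sup>2)"
    by (rule integrable_bounded_mult[OF _ i2 S'(4)]) measurable
  have n2: "(\<integral>x. (Sx x)\<^sup>2 \<partial>lborel) \<le> 3 * E"
  proof -
    have "(\<integral>x. (Sx x)\<^sup>2 \<partial>lborel) \<le> (\<integral>x. 3 * ((ux x)\<^sup>2 + (vx x)\<^sup>2 + (wx x)\<^sup>2) \<partial>lborel)"
      using U(6) V(6) W(6) unfolding Sx_def by (intro integral_mono sq3 S'(6)[unfolded Sx_def]) auto
    also have "\<dots> \<le> 3 * E" unfolding E_def using U(6) V(6) W(6) by simp
    finally show ?thesis .
  qed
  have E_nn: "0 \<le> E" unfolding E_def by simp
  let ?J = "\<lambda>x. Sx x * (0 * (Sx x)\<^sup>2 + 1 * (Sx x) ^ 3) - (2 * 0 * Sx x + 3 * 1 * (Sx x)\<^sup>2) * (Sx x * Sx x + P x)"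
  have Ji: "integrable lborel ?J"
  proof -
    have Pi: "integrable lborel (\<lambda>x. P x)" unfolding PF using Gconv_bounds(3)[OF Fi] Fi by (rule Bochner_Integration.integrable_diff)
    have bs: "\<bar>(Sx x)\<^sup>2\<bar> \<le> (9 * M)\<^sup>2" for x using square_abs_bound[OF S'(4)[of x]] by simp
    have "integrable lborel (\<lambda>x. (Sx x)\<^sup>2 * P x)"
      by (rule integrable_bounded_mult[OF _ Pi bs]) measurable
    then have "integrable lborel (\<lambda>x. - 2 * ((Sx x)\<^sup>2)\<^sup>2 - 3 * ((Sx x)\<^sup>2 * P x))" using i4 by simp
    then show ?thesis by (rule back_subst[of "integrable lborel"]) (simp add: fun_eq_iff power2_eq_square power3_eq_cube algebra_simps)
  qed
  have "(\<integral>x. ?J x \<partial>lborel) \<le> (\<integral>x. - (1 / 2) * ((Sx x)\<^sup>2)\<^sup>2 + 27 / 4 * E * (Sx x)\<^sup>2 \<partial>lborel)"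
  proof (rule integral_mono[OF Ji])
    show "?J x \<le> - (1 / 2) * ((Sx x)\<^sup>2)\<^sup>2 + 27 / 4 * E * (Sx x)\<^sup>2" for x
    proof -
      have "3 * (Sx x)\<^sup>2 * (- P x) \<le> 3 * (Sx x)\<^sup>2 * (1 / 2 * (Sx x)\<^sup>2 + 9 / 4 * E)"
        by (intro mult_left_mono Pb) auto
      then show ?thesis by (simp add: power2_eq_square power3_eq_cube algebra_simps)
    qed
  qed (use i2 i4 in simp)
  also have "\<dots> = - (1 / 2) * (\<integral>x. ((Sx x)\<^sup>2)\<^sup>2 \<partial>lborel) + 27 / 4 * E * (\<integral>x. (Sx x)\<^sup>2 \<partial>lborel)"
    using i2 i4 by simp
  finally have J: "(\<integral>x. ?J x \<partial>lborel) \<le> - (1 / 2) * (\<integral>x. ((Sx x)\<^sup>2)\<^sup>2 \<partial>lborel) + 27 / 4 * E * (\<integral>x. (Sx x)\<^sup>2 \<partial>lborel)" .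
  let ?Q = "\<integral>x. Sx x * (Sx x)\<^sup>2 \<partial>lborel"
  have "?Q\<^sup>2 \<le> (\<integral>x. (Sx x)\<^sup>2 \<partial>lborel) * (\<integral>x. ((Sx x)\<^sup>2)\<^sup>2 \<partial>lborel)"
    by (rule Cauchy_Schwarz_integral[OF _ _ i2 i4]) measurable
  also have "\<dots> \<le> 3 * E0 * (\<integral>x. ((Sx x)\<^sup>2)\<^sup>2 \<partial>lborel)"
    using n2 E by (intro mult_right_mono) auto
  finally have Q: "?Q\<^sup>2 / (6 * E0) \<le> 1 / 2 * (\<integral>x. ((Sx x)\<^sup>2)\<^sup>2 \<partial>lborel)"
    using E0 by (simp add: field_simps)
  have "27 / 4 * E * (\<integral>x. (Sx x)\<^sup>2 \<partial>lborel) \<le> 27 / 4 * E * (3 * E)"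
    using n2 E_nn by (intro mult_left_mono) auto
  also have "\<dots> \<le> 27 / 4 * E0 * (3 * E0)" using E E_nn E0 by (intro mult_mono) auto
  \<comment> \<open>The product is 81/4 times \<open>E0\<^sup>2\<close>; rounding up to 27 produces
    exactly the threshold \<open>9 * E0 * sqrt (2 * E0)\<close>.\<close>
  also have "\<dots> \<le> 27 * E0\<^sup>2" by (simp add: power2_eq_square)
  finally have "27 / 4 * E * (\<integral>x. (Sx x)\<^sup>2 \<partial>lborel) \<le> 27 * E0\<^sup>2" .
  then have "(\<integral>x. ?J x \<partial>lborel) \<le> - ?Q\<^sup>2 / (6 * E0) + 27 * E0\<^sup>2" using J Q by simp
  moreover have "(\<lambda>x. 0 * (Sx x)\<^sup>2 + 1 * (Sx x) ^ 3) = (\<lambda>x. Sx x * (Sx x)\<^sup>2)"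
    by (simp add: fun_eq_iff power2_eq_square power3_eq_cube)
  ultimately show ?thesis unfolding P_def by (simp only:)
qed

text \<open>The setting is a closed time interval inside the lifespan, where a bound M uniform in t
  exists. The equations hold in mean square, all written through \<open>fnl\<close>.\<close>

locale ch_flow =
  fixes t1 M :: real and u ux v vx w wx :: "real \<Rightarrow> real \<Rightarrow> real"
  assumes t1: "0 \<le> t1"
    and u: "\<And>t. t \<in> {0..t1} \<Longrightarrow> regular M (u t) (ux t)"
    and v: "\<And>t. t \<in> {0..t1} \<Longrightarrow> regular M (v t) (vx t)"
    and w: "\<And>t. t \<in> {0..t1} \<Longrightarrow> regular M (w t) (wx t)"
    and du: "\<And>t. t \<in> {0..t1} \<Longrightarrow> ((\<lambda>s. \<integral>x. ((u s x - u t x) / (s - t) + ((u t x + v t x + w t x) * ux t x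
        + nonlocal_part (u t) (v t) (w t) (ux t) (vx t) (wx t) x))\<^sup>2 \<partial>lborel) \<longlongrightarrow> 0) (at t within {0..t1})"
    and dv: "\<And>t. t \<in> {0..t1} \<Longrightarrow> ((\<lambda>s. \<integral>x. ((v s x - v t x) / (s - t) + ((u t x + v t x + w t x) * vx t x
        + nonlocal_part (v t) (u t) (w t) (vx t) (ux t) (wx t) x))\<^sup>2 \<partial>lborel) \<longlongrightarrow> 0) (at t within {0..t1})"
    and dw: "\<And>t. t \<in> {0..t1} \<Longrightarrow> ((\<lambda>s. \<integral>x. ((w s x - w t x) / (s - t) + ((u t x + v t x + w t x) * wx t x
        + nonlocal_part (w t) (u t) (v t) (wx t) (ux t) (vx t) x))\<^sup>2 \<partial>lborel) \<longlongrightarrow> 0) (at t within {0..t1})"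
begin

abbreviation "S \<equiv> \<lambda>t x. u t x + v t x + w t x"
abbreviation "Sx \<equiv> \<lambda>t x. ux t x + vx t x + wx t x"
abbreviation "Au \<equiv> \<lambda>t. nonlocal_part (u t) (v t) (w t) (ux t) (vx t) (wx t)"
abbreviation "Av \<equiv> \<lambda>t. nonlocal_part (v t) (u t) (w t) (vx t) (ux t) (wx t)"
abbreviation "Aw \<equiv> \<lambda>t. nonlocal_part (w t) (u t) (v t) (wx t) (ux t) (vx t)"
abbreviation "Aux \<equiv> \<lambda>t. nonlocal_part_deriv (u t) (v t) (w t) (ux t) (vx t) (wx t)"
abbreviation "Avx \<equiv> \<lambda>t. nonlocal_part_deriv (v t) (u t) (w t) (vx t) (ux t) (wx t)"
abbreviation "Awx \<equiv> \<lambda>t. nonlocal_part_deriv (w t) (u t) (v t) (wx t) (ux t) (vx t)"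

text \<open>Large enough for the components, for S (\<open>9 * M\<close>) and for the sum of the
  three nonlocal terms (\<open>9 * nonlocal_bound M\<close>).\<close>

definition "M' = 9 * M + 9 * nonlocal_bound M"

lemma M': "M \<le> M'" "9 * M \<le> M'" "nonlocal_bound M \<le> M'" "9 * nonlocal_bound M \<le> M'"
proof -
  have M: "0 \<le> M" using regularD(12)[OF u[of 0]] t1 by simp
  have "0 \<le> nonlocal_bound M" unfolding nonlocal_bound_def using M by simp
  then show "M \<le> M'" "9 * M \<le> M'" "nonlocal_bound M \<le> M'" "9 * nonlocal_bound M \<le> M'" using M unfolding M'_def by auto
qed

text \<open>All components are carried by the same velocity u + v + w, which is why one transport
  locale covers them.\<close>

sublocale U: transport t1 M' u ux S Sx Au Aux
  by unfold_locales (use t1 du in \<open>auto intro: regular_mono[OF u M'(1)] regular_mono[OF regular_sum3[OF u v w] M'(2)] regular_mono[OF regular_nonlocal_part[OF u v w] M'(3)]\<close>)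

sublocale V: transport t1 M' v vx S Sx Av Avx
  by unfold_locales (use t1 dv in \<open>auto intro: regular_mono[OF v M'(1)] regular_mono[OF regular_sum3[OF u v w] M'(2)] regular_mono[OF regular_nonlocal_part[OF v u w] M'(3)]\<close>)

sublocale W: transport t1 M' w wx S Sx Aw Awx
  by unfold_locales (use t1 dw in \<open>auto intro: regular_mono[OF w M'(1)] regular_mono[OF regular_sum3[OF u v w] M'(2)] regular_mono[OF regular_nonlocal_part[OF w u v] M'(3)]\<close>)

definition energy :: "real \<Rightarrow> real" where
  "energy t = (\<integral>x. (u t x)\<^sup>2 \<partial>lborel) + (\<integral>x. (ux t x)\<^sup>2 \<partial>lborel) + ((\<integral>x. (v t x)\<^sup>2 \<partial>lborel) + (\<integral>x. (vx t x)\<^sup>2 \<partial>lborel))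
     + ((\<integral>x. (w t x)\<^sup>2 \<partial>lborel) + (\<integral>x. (wx t x)\<^sup>2 \<partial>lborel))"

text \<open>Per component, the law for the square plus the law for the squared derivative
  (\<open>a = 1\<close>, \<open>b = 0\<close>); \<open>energy_flux_zero\<close> makes the total rate
  vanish. It is stated at the end point, like those laws; intermediate times come from restricting
  the flow.\<close>

lemma energy_end: "energy t1 = energy 0"
proof -
  note i = has_integral_add[OF has_integral_add[OF
        has_integral_add[OF U.square_has_integral U.power_has_integral[where a = 1 and b = 0]]
        has_integral_add[OF V.square_has_integral V.power_has_integral[where a = 1 and b = 0]]]
        has_integral_add[OF W.square_has_integral W.power_has_integral[where a = 1 and b = 0]]]
  have "((\<lambda>t. 0 :: real) has_integral energy t1 - energy 0) {0..t1}"
  \<comment> \<open>\<open>back_subst\<close> defers matching the sum of the six increments with the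
    increment of the energy.\<close>
  proof (rule has_integral_eq[OF _ i[THEN back_subst[of "\<lambda>y. (_ has_integral y) {0..t1}"]]])
    fix t assume t: "t \<in> {0..t1}"
    show "- 2 * (\<integral>x. u t x * (S t x * ux t x + Au t x) \<partial>lborel)
      + (\<integral>x. Sx t x * (1 * (ux t x)\<^sup>2 + 0 * ux t x ^ 3) - (2 * 1 * ux t x + 3 * 0 * (ux t x)\<^sup>2) * (Sx t x * ux t x + Aux t x) \<partial>lborel)
      + (- 2 * (\<integral>x. v t x * (S t x * vx t x + Av t x) \<partial>lborel)
      + (\<integral>x. Sx t x * (1 * (vx t x)\<^sup>2 + 0 * vx t x ^ 3) - (2 * 1 * vx t x + 3 * 0 * (vx t x)\<^sup>2) * (Sx t x * vx t x + Avx t x) \<partial>lborel))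
      + (- 2 * (\<integral>x. w t x * (S t x * wx t x + Aw t x) \<partial>lborel)
      + (\<integral>x. Sx t x * (1 * (wx t x)\<^sup>2 + 0 * wx t x ^ 3) - (2 * 1 * wx t x + 3 * 0 * (wx t x)\<^sup>2) * (Sx t x * wx t x + Awx t x) \<partial>lborel)) = 0"
      using energy_flux_zero[OF u[OF t] v[OF t] w[OF t]] by simp
  qed (simp add: energy_def)
  moreover have "((\<lambda>t. 0 :: real) has_integral 0) {0..t1}" by simp
  ultimately have "energy t1 - energy 0 = 0" by (rule has_integral_unique)
  then show ?thesis by simp
qed

text \<open>Adding the three equations shows that S is transported by itself. With c = S the law
  \<open>T.power_has_integral\<close> at \<open>a = 0\<close>, \<open>b = 1\<close> is the balance
  of the cubic functional.\<close>

sublocale T: transport t1 M' S Sx S Sx "\<lambda>t x. Au t x + Av t x + Aw t x" "\<lambda>t x. Aux t x + Avx t x + Awx t x"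
proof
  fix t assume t: "t \<in> {0..t1}"
  show "regular M' (\<lambda>x. Au t x + Av t x + Aw t x) (\<lambda>x. Aux t x + Avx t x + Awx t x)"
    by (rule regular_mono[OF regular_sum3[OF regular_nonlocal_part[OF u[OF t] v[OF t] w[OF t]] regular_nonlocal_part[OF v[OF t] u[OF t] w[OF t]]
      regular_nonlocal_part[OF w[OF t] u[OF t] v[OF t]]] M'(4)])
  let ?k = "\<lambda>c cx A s x. (c s x - c t x) / (s - t) + (S t x * cx t x + A t x)"
  have k: "?k c cx A s \<in> borel_measurable borel \<and> integrable lborel (\<lambda>x. (?k c cx A s x)\<^sup>2)"
    if tr: "transport t1 M' c cx S Sx A Ax" and s: "s \<in> {0..t1}" for c cx A Ax s
  proof -
    note rc = transport.c[OF tr] and rS = transport.S[OF tr t] and rA = transport.A[OF tr t]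
    note [measurable] = regularD(10,11)[OF rc[OF s]] regularD(10,11)[OF rc[OF t]] regularD(10,11)[OF rS] regularD(10,11)[OF rA]
    have "integrable lborel (\<lambda>x. (c s x + - c t x)\<^sup>2)"
      by (rule integrable_square_add) (use regularD(5)[OF rc[OF s]] regularD(5)[OF rc[OF t]] in auto)
    then have "integrable lborel (\<lambda>x. ((c s x - c t x) / (s - t))\<^sup>2)" by (simp add: power_divide)
    then have "integrable lborel (\<lambda>x. (?k c cx A s x)\<^sup>2)"
      by (rule integrable_square_add[rotated 2, OF _ regular_rhs[OF rS rc[OF t] rA]]) measurable
    then show ?thesis by simp
  qed
  note ku = k[OF U.transport_axioms] and kv = k[OF V.transport_axioms] and kw = k[OF W.transport_axioms]
  show "((\<lambda>s. \<integral>x. ((S s x - S t x) / (s - t) + (S t x * Sx t x + (Au t x + Av t x + Aw t x)))\<^sup>2 \<partial>lborel) \<longlongrightarrow> 0) (at t within {0..t1})"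
  \<comment> \<open>The error for the sum is the sum of the three errors, so its square is at most
    three times the sum of their squares.\<close>
  proof (rule Lim_null_comparison)
    show "((\<lambda>s. 3 * (\<integral>x. (?k u ux Au s x)\<^sup>2 \<partial>lborel) + 3 * (\<integral>x. (?k v vx Av s x)\<^sup>2 \<partial>lborel) + 3 * (\<integral>x. (?k w wx Aw s x)\<^sup>2 \<partial>lborel)) \<longlongrightarrow> 0) (at t within {0..t1})"
    proof -
      have "((\<lambda>s. 3 * (\<integral>x. (?k u ux Au s x)\<^sup>2 \<partial>lborel) + 3 * (\<integral>x. (?k v vx Av s x)\<^sup>2 \<partial>lborel) + 3 * (\<integral>x. (?k w wx Aw s x)\<^sup>2 \<partial>lborel)) \<longlongrightarrow> 3 * 0 + 3 * 0 + 3 * 0) (at t within {0..t1})"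
        by (intro tendsto_add tendsto_mult_left du[OF t] dv[OF t] dw[OF t])
      then show ?thesis by (simp only: mult_zero_right add_0_left)
    qed
    have "norm (\<integral>x. ((S s x - S t x) / (s - t) + (S t x * Sx t x + (Au t x + Av t x + Aw t x)))\<^sup>2 \<partial>lborel)
       \<le> 3 * (\<integral>x. (?k u ux Au s x)\<^sup>2 \<partial>lborel) + 3 * (\<integral>x. (?k v vx Av s x)\<^sup>2 \<partial>lborel) + 3 * (\<integral>x. (?k w wx Aw s x)\<^sup>2 \<partial>lborel)"
      if s: "s \<in> {0..t1}" for s
    proof -
      have eq: "(S s x - S t x) / (s - t) + (S t x * Sx t x + (Au t x + Av t x + Aw t x)) = ?k u ux Au s x + ?k v vx Av s x + ?k w wx Aw s x" for x
        by (simp add: add_divide_distrib diff_divide_distrib algebra_simps)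
      have "(\<integral>x. (?k u ux Au s x + ?k v vx Av s x + ?k w wx Aw s x)\<^sup>2 \<partial>lborel)
        \<le> 3 * (\<integral>x. (?k u ux Au s x)\<^sup>2 \<partial>lborel) + 3 * (\<integral>x. (?k v vx Av s x)\<^sup>2 \<partial>lborel) + 3 * (\<integral>x. (?k w wx Aw s x)\<^sup>2 \<partial>lborel)"
        by (rule integral_square_sum3_le) (use ku[OF s] kv[OF s] kw[OF s] in \<open>simp_all only: measurable_lborel1 measurable_lborel2\<close>)
      moreover have "0 \<le> (\<integral>x. (?k u ux Au s x + ?k v vx Av s x + ?k w wx Aw s x)\<^sup>2 \<partial>lborel)"
        by (rule Bochner_Integration.integral_nonneg) (rule zero_le_power2)
      ultimately show ?thesis unfolding eq real_norm_def by linarith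
    qed
    then show "\<forall>\<^sub>F s in at t within {0..t1}. norm (\<integral>x. ((S s x - S t x) / (s - t) + (S t x * Sx t x + (Au t x + Av t x + Aw t x)))\<^sup>2 \<partial>lborel)
       \<le> 3 * (\<integral>x. (?k u ux Au s x)\<^sup>2 \<partial>lborel) + 3 * (\<integral>x. (?k v vx Av s x)\<^sup>2 \<partial>lborel) + 3 * (\<integral>x. (?k w wx Aw s x)\<^sup>2 \<partial>lborel)"
      unfolding eventually_at_filter by (intro always_eventually allI impI)
  qed
qed (use t1 U.S in auto)

end

lemma ch_flow_restrict:
  assumes "ch_flow t1 M u ux v vx w wx" "t \<in> {0..t1}"
  shows "ch_flow t M u ux v vx w wx"
proof -
  interpret ch_flow t1 M u ux v vx w wx by fact
  have sub: "{0..t} \<subseteq> {0..t1}" using assms(2) by auto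
  show ?thesis
    by unfold_locales (use assms(2) sub in \<open>auto intro: u v w tendsto_within_subset[OF du sub] tendsto_within_subset[OF dv sub] tendsto_within_subset[OF dw sub]\<close>)
qed

lemma ch_flow_time_bound:
  assumes "ch_flow t1 M u ux v vx w wx" and E0: "0 < E0" and e: "ch_flow.energy u ux v vx w wx 0 \<le> E0"
    and Q0: "Q0 = (\<integral>x. (ux 0 x + vx 0 x + wx 0 x) ^ 3 \<partial>lborel)" "Q0 < - 9 * E0 * sqrt (2 * E0)"
  shows "t1 \<le> sqrt (2 * E0) / (3 * E0) * ln ((Q0 - 9 * E0 * sqrt (2 * E0)) / (Q0 + 9 * E0 * sqrt (2 * E0)))"
proof -
  interpret ch_flow t1 M u ux v vx w wx by fact
  define Q where "Q t = (\<integral>x. 0 * (Sx t x)\<^sup>2 + 1 * (Sx t x) ^ 3 \<partial>lborel)" for t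
  define X where "X t = (\<integral>x. Sx t x * (0 * (Sx t x)\<^sup>2 + 1 * (Sx t x) ^ 3) - (2 * 0 * Sx t x + 3 * 1 * (Sx t x)\<^sup>2) *
        (Sx t x * Sx t x + (Aux t x + Avx t x + Awx t x)) \<partial>lborel)" for t
  have "Q 0 = Q0" unfolding Q_def Q0 by simp
  have "t1 \<le> sqrt (2 * E0) / (3 * E0) * ln ((Q 0 - 9 * E0 * sqrt (2 * E0)) / (Q 0 + 9 * E0 * sqrt (2 * E0)))"
  proof (rule riccati_blowup_time[OF t1 E0])
    fix t assume t: "t \<in> {0..t1}"
    \<comment> \<open>Restriction to \<open>[0, t]\<close> turns the two end-point laws into
      statements at time t.\<close>
    interpret R: ch_flow t M u ux v vx w wx by (rule ch_flow_restrict[OF assms(1) t])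
    show "(X has_integral Q t - Q 0) {0..t}"
      unfolding X_def Q_def by (rule R.T.power_has_integral)
    have "energy t \<le> E0" using R.energy_end e by simp
    then show "X t \<le> - (Q t)\<^sup>2 / (6 * E0) + 27 * E0\<^sup>2"
      unfolding X_def Q_def energy_def by (intro cubic_flux_le[OF u[OF t] v[OF t] w[OF t] _ E0])
  qed (use Q0 \<open>Q 0 = Q0\<close> in simp)
  then show ?thesis unfolding \<open>Q 0 = Q0\<close> .
qed

section \<open>Test functions and the Fourier transform\<close>

definition smooth :: "(real \<Rightarrow> real) \<Rightarrow> bool" where
  "smooth f \<longleftrightarrow> (\<forall>k x. ((deriv ^^ k) f) differentiable (at x))"

text \<open>Coinduction: a class of functions closed under differentiation consists of smooth
  functions. This spares formulas for iterated derivatives.\<close>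

lemma smooth_coinduct:
  assumes "P f" and d: "\<And>g. P g \<Longrightarrow> \<exists>g'. P g' \<and> (\<forall>x. (g has_real_derivative g' x) (at x))"
  shows "smooth f"
proof -
  have step: "P (deriv g) \<and> (\<forall>x. g differentiable (at x))" if g: "P g" for g
  proof -
    obtain g' where g': "P g'" "\<And>x. (g has_real_derivative g' x) (at x)" using d[OF g] by blast
    then have "deriv g = g'" by (intro ext DERIV_imp_deriv)
    then show ?thesis using g' by (auto simp: real_differentiable_def)
  qed
  have "P ((deriv ^^ k) f)" for k by (induction k) (use assms(1) step in auto)
  then show ?thesis using step unfolding smooth_def by blast
qed

lemma smoothD:
  assumes "smooth f"
  shows "(f has_real_derivative deriv f x) (at x)" "smooth (deriv f)"
proof -
  have "((deriv ^^ 0) f) differentiable (at x)" using assms unfolding smooth_def by blast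
  then have "f differentiable (at x)" by simp
  then show "(f has_real_derivative deriv f x) (at x)" by (simp add: DERIV_deriv_iff_real_differentiable)
  have "(deriv ^^ k) (deriv f) = (deriv ^^ Suc k) f" for k by (simp add: funpow_swap1)
  then show "smooth (deriv f)" using assms unfolding smooth_def by (simp only:) simp
qed

text \<open>The invariant for \<open>smooth_mult\<close>: by the Leibniz rule products alone are not
  closed under differentiation, but their sums are.\<close>

inductive sum_of_products :: "(real \<Rightarrow> real) \<Rightarrow> bool" where
  prod: "smooth a \<Longrightarrow> smooth b \<Longrightarrow> sum_of_products (\<lambda>x. a x * b x)"
| add: "sum_of_products f \<Longrightarrow> sum_of_products g \<Longrightarrow> sum_of_products (\<lambda>x. f x + g x)"

lemma smooth_mult:
  assumes "smooth a" "smooth b" shows "smooth (\<lambda>x. a x * b x)"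
proof (rule smooth_coinduct[where P = sum_of_products])
  show "sum_of_products (\<lambda>x. a x * b x)" using assms by (rule sum_of_products.prod)
  show "\<exists>g'. sum_of_products g' \<and> (\<forall>x. (g has_real_derivative g' x) (at x))" if "sum_of_products g" for g
    using that
  proof induction
    case (prod a b)
    have "sum_of_products (\<lambda>x. deriv a x * b x + deriv b x * a x)"
      by (intro sum_of_products.intros smoothD prod)
    moreover have "((\<lambda>x. a x * b x) has_real_derivative deriv a x * b x + deriv b x * a x) (at x)" for x
      by (intro DERIV_mult smoothD prod)
    ultimately show ?case by blast
  next
    case (add f g)
    then obtain f' g' where "sum_of_products f'" "sum_of_products g'"
      "\<And>x. (f has_real_derivative f' x) (at x)" "\<And>x. (g has_real_derivative g' x) (at x)" by blast
    then show ?case by (intro exI[of _ "\<lambda>x. f' x + g' x"] conjI allI sum_of_products.add DERIV_add)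
  qed
qed

lemma smooth_affine:
  assumes "smooth f" shows "smooth (\<lambda>x. k * f (c + e * x))"
\<comment> \<open>The factor k must vary in the invariant, since each derivative contributes another
  \<open>e\<close>.\<close>
proof (rule smooth_coinduct[where P = "\<lambda>g. \<exists>k b. smooth b \<and> g = (\<lambda>x. k * b (c + e * x))"])
  fix g :: "real \<Rightarrow> real" assume "\<exists>k b. smooth b \<and> g = (\<lambda>x. k * b (c + e * x))"
  then obtain k b where b: "smooth b" and g: "g = (\<lambda>x. k * b (c + e * x))" by blast
  have "(g has_real_derivative (k * e) * deriv b (c + e * x)) (at x)" for x
  proof -
    have "((\<lambda>x. c + e * x) has_real_derivative e) (at x)" by (auto intro!: derivative_eq_intros)
    then have "((\<lambda>x. b (c + e * x)) has_real_derivative deriv b (c + e * x) * e) (at x)"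
      by (rule DERIV_chain2[OF smoothD(1)[OF b]])
    then have "((\<lambda>x. k * b (c + e * x)) has_real_derivative k * (deriv b (c + e * x) * e)) (at x)" by (rule DERIV_cmult)
    then show ?thesis unfolding g by (simp add: mult_ac)
  qed
  then show "\<exists>g'. (\<exists>k b. smooth b \<and> g' = (\<lambda>x. k * b (c + e * x))) \<and> (\<forall>x. (g has_real_derivative g' x) (at x))"
    by (intro exI[of _ "\<lambda>x. (k * e) * deriv b (c + e * x)"] conjI allI exI[of _ "k * e"] exI[of _ "deriv b"] refl smoothD(2)[OF b])
qed (intro exI[of _ k] exI[of _ f] conjI assms refl)

lemma smooth_trig: "smooth (\<lambda>x. p * cos (y * x) + q * sin (y * x))"
proof (rule smooth_coinduct[where P = "\<lambda>g. \<exists>p q. g = (\<lambda>x. p * cos (y * x) + q * sin (y * x))"])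
  fix g :: "real \<Rightarrow> real" assume "\<exists>p q. g = (\<lambda>x. p * cos (y * x) + q * sin (y * x))"
  then obtain p q where g: "g = (\<lambda>x. p * cos (y * x) + q * sin (y * x))" by blast
  have "(g has_real_derivative (q * y) * cos (y * x) + (- p * y) * sin (y * x)) (at x)" for x
    unfolding g by (auto intro!: derivative_eq_intros)
  then show "\<exists>g'. (\<exists>p q. g' = (\<lambda>x. p * cos (y * x) + q * sin (y * x))) \<and> (\<forall>x. (g has_real_derivative g' x) (at x))"
    by (intro exI[of _ "\<lambda>x. (q * y) * cos (y * x) + (- p * y) * sin (y * x)"] conjI allI exI[of _ "q * y"] exI[of _ "- p * y"] refl)
qed (intro exI[of _ p] exI[of _ q] refl)

lemma poly_exp_tendsto_0: "((\<lambda>s::real. poly p s * exp (- s)) \<longlongrightarrow> 0) at_top"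
proof -
  have "((\<lambda>s::real. \<Sum>i\<le>degree p. coeff p i * (s ^ i / exp s)) \<longlongrightarrow> (\<Sum>i\<le>degree p. coeff p i * 0)) at_top"
    by (intro tendsto_intros tendsto_power_div_exp_0)
  moreover have "poly p s * exp (- s) = (\<Sum>i\<le>degree p. coeff p i * (s ^ i / exp s))" for s
    unfolding poly_altdef sum_distrib_right by (simp add: exp_minus divide_inverse mult.assoc)
  ultimately show ?thesis by simp
qed

text \<open>The classical flat function exp(-1/x) with a polynomial in s = 1/x in front. The family
  is closed under differentiation, p passing to s^2 (p - p').\<close>

definition flat_exp :: "real poly \<Rightarrow> real \<Rightarrow> real" where
  "flat_exp p x = (if 0 < x then poly p (1 / x) * exp (- (1 / x)) else 0)"

lemma flat_exp_DERIV: "(flat_exp p has_real_derivative flat_exp ([:0, 0, 1:] * (p - pderiv p)) x) (at x)"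
proof -
  consider "0 < x" | "x < 0" | "x = 0" by linarith
  then show ?thesis
  proof cases
    case 1
    have i: "((\<lambda>x. 1 / x) has_real_derivative - (1 / x)\<^sup>2) (at x)"
      using 1 by (auto intro!: derivative_eq_intros simp: power2_eq_square)
    have "((\<lambda>x. poly p (1 / x) * exp (- (1 / x))) has_real_derivative
       (poly (pderiv p) (1 / x) * (- (1 / x)\<^sup>2)) * exp (- (1 / x)) + (exp (- (1 / x)) * (- (- (1 / x)\<^sup>2))) * poly p (1 / x)) (at x)"
      by (rule DERIV_mult[OF DERIV_chain2[OF poly_DERIV i] DERIV_fun_exp[OF DERIV_minus[OF i]]])
    moreover have "(poly (pderiv p) s * (- s\<^sup>2)) * exp (- s) + (exp (- s) * (- (- s\<^sup>2))) * poly p s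
       = poly ([:0, 0, 1:] * (p - pderiv p)) s * exp (- s)" for s :: real
      by (simp add: algebra_simps power2_eq_square)
    ultimately have d: "((\<lambda>x. poly p (1 / x) * exp (- (1 / x))) has_real_derivative flat_exp ([:0, 0, 1:] * (p - pderiv p)) x) (at x)"
      using 1 by (simp only: flat_exp_def if_True)
    have "eventually (\<lambda>y. y \<in> {0<..}) (nhds x)" using 1 by (intro eventually_nhds_in_open) auto
    then have ev: "eventually (\<lambda>y. poly p (1 / y) * exp (- (1 / y)) = flat_exp p y) (nhds x)"
      by eventually_elim (simp add: flat_exp_def)
    show ?thesis using d DERIV_cong_ev[OF refl ev refl] by simp
  next
    case 2
    have "eventually (\<lambda>y. y \<in> {..<0}) (nhds x)" using 2 by (intro eventually_nhds_in_open) auto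
    then have ev: "eventually (\<lambda>y. 0 = flat_exp p y) (nhds x)" by eventually_elim (simp add: flat_exp_def)
    have "(flat_exp p has_real_derivative 0) (at x)" using DERIV_cong_ev[OF refl ev refl, of 0] by simp
    then show ?thesis using 2 by (simp add: flat_exp_def)
  next
    case 3
    have "((\<lambda>h. flat_exp p h / h) \<longlongrightarrow> 0) (at (0::real))"
    proof (rule filterlim_split_at)
      have "eventually (\<lambda>h. h < 0) (at_left (0::real))" by (simp add: eventually_at_filter)
      then have "eventually (\<lambda>h. flat_exp p h / h = 0) (at_left (0::real))"
        by eventually_elim (simp add: flat_exp_def)
      then show "((\<lambda>h. flat_exp p h / h) \<longlongrightarrow> 0) (at_left 0)" by (rule tendsto_eventually)
      \<comment> \<open>Division by h is multiplication by s = 1/h and is absorbed into the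
        polynomial.\<close>
      have "((\<lambda>h. poly ([:0, 1:] * p) (inverse h) * exp (- inverse h)) \<longlongrightarrow> 0) (at_right (0::real))"
        by (rule filterlim_compose[OF poly_exp_tendsto_0 filterlim_inverse_at_top_right])
      moreover have "eventually (\<lambda>h. 0 < h) (at_right (0::real))" by (simp add: eventually_at_filter)
      then have "eventually (\<lambda>h. poly ([:0, 1:] * p) (inverse h) * exp (- inverse h) = flat_exp p h / h) (at_right (0::real))"
        by eventually_elim (simp add: flat_exp_def divide_inverse mult_ac)
      ultimately show "((\<lambda>h. flat_exp p h / h) \<longlongrightarrow> 0) (at_right 0)"
        by (rule Lim_transform_eventually)
    qed
    then show ?thesis using 3 by (simp add: flat_exp_def DERIV_def)
  qed
qed

lemma smooth_flat_exp: "smooth (flat_exp p)"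
proof (rule smooth_coinduct[where P = "\<lambda>g. \<exists>p. g = flat_exp p"])
  fix g :: "real \<Rightarrow> real" assume "\<exists>p. g = flat_exp p"
  then obtain p where g: "g = flat_exp p" by blast
  show "\<exists>g'. (\<exists>p. g' = flat_exp p) \<and> (\<forall>x. (g has_real_derivative g' x) (at x))"
    unfolding g by (rule exI[of _ "flat_exp ([:0, 0, 1:] * (p - pderiv p))"]) (intro conjI allI exI flat_exp_DERIV, rule refl)
qed blast

text \<open>\<open>exp 2\<close> compensates the value exp(-1)^2 at the origin. With value 1 there,
  \<open>bump (\<xi> / N)\<close> is a cutoff that tends to 1 pointwise.\<close>

definition bump :: "real \<Rightarrow> real" where
  "bump x = exp 2 * (flat_exp 1 (1 + x) * flat_exp 1 (1 - x))"

lemma bump_simps: "bump 0 = 1" "\<bar>x\<bar> \<ge> 1 \<Longrightarrow> bump x = 0" "0 \<le> bump x"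
  by (auto simp: bump_def flat_exp_def mult_exp_exp)

lemma smooth_bump: "smooth bump"
proof -
  have "smooth (\<lambda>x. exp 2 * flat_exp 1 (1 + x) * flat_exp 1 (1 - x))"
    using smooth_mult[OF smooth_affine[OF smooth_flat_exp, of "exp 2" 1 1 1] smooth_affine[OF smooth_flat_exp, of 1 1 1 "-1"]] by simp
  then show ?thesis unfolding bump_def[abs_def] by (simp add: mult.assoc)
qed

lemma test_fun_smooth: "test_fun f \<longleftrightarrow> smooth f \<and> bounded {x. f x \<noteq> 0}"
  by (simp add: test_fun_def smooth_def)

text \<open>Contains the real and the imaginary part of the truncated wave
  \<open>bump (\<xi> / n) * cis (y * \<xi>)\<close>; test functions are real valued, so this wave is
  tested in two pieces.\<close>

lemma test_fun_modulated_bump: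
  assumes "0 < n"
  shows "test_fun (\<lambda>x. bump (x / n) * (p * cos (y * x) + q * sin (y * x)))"
  unfolding test_fun_smooth
proof
  have "smooth (\<lambda>x. 1 * bump (0 + (1 / n) * x))" by (rule smooth_affine[OF smooth_bump])
  then have "smooth (\<lambda>x. bump (x / n))" by simp
  then show "smooth (\<lambda>x. bump (x / n) * (p * cos (y * x) + q * sin (y * x)))"
    by (rule smooth_mult[OF _ smooth_trig])
  have "{x. bump (x / n) * (p * cos (y * x) + q * sin (y * x)) \<noteq> 0} \<subseteq> {-n..n}"
  proof
    fix x assume "x \<in> {x. bump (x / n) * (p * cos (y * x) + q * sin (y * x)) \<noteq> 0}"
    then have "\<bar>x / n\<bar> < 1" using bump_simps(2)[of "x / n"] by fastforce
    then have "\<bar>x\<bar> < n" using assms by (simp add: abs_divide)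
    then show "x \<in> {-n..n}" by auto
  qed
  then show "bounded {x. bump (x / n) * (p * cos (y * x) + q * sin (y * x)) \<noteq> 0}"
    by (rule bounded_subset[OF bounded_closed_interval])
qed

section \<open>Fourier integrals of test functions and Gaussians; Bessel's inequality\<close>

lemma cis_measurable[measurable]: "cis \<in> borel_measurable borel"
  by (rule borel_measurable_continuous_onI) (intro continuous_intros)

lemma cnj_measurable[measurable]: "cnj \<in> borel_measurable borel"
  by (rule borel_measurable_continuous_onI) (intro continuous_intros)

lemma test_funE:
  assumes "test_fun f"
  obtains R where "0 < R" "\<And>x. R \<le> \<bar>x\<bar> \<Longrightarrow> f x = 0" "\<And>x. R \<le> \<bar>x\<bar> \<Longrightarrow> deriv f x = 0"
proof -
  obtain R where R: "\<forall>x\<in>{x. f x \<noteq> 0}. norm x \<le> R" using assms unfolding test_fun_def bounded_iff by blast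
  then have z: "f x = 0" if "\<bar>x\<bar> > R" for x using that by fastforce
  have "deriv f x = 0" if "\<bar>x\<bar> > R" for x
  proof -
    have "open {x. \<bar>x\<bar> > R}" by (intro open_Collect_less continuous_intros)
    then have "eventually (\<lambda>y. y \<in> {x. \<bar>x\<bar> > R}) (nhds x)" using that by (intro eventually_nhds_in_open) auto
    then have "eventually (\<lambda>y. f y = 0) (nhds x)" by eventually_elim (use z in auto)
    then have "(f has_real_derivative 0) (at x)" using DERIV_cong_ev[OF refl _ refl, of f "\<lambda>_. 0" x 0] by simp
    then show ?thesis by (rule DERIV_imp_deriv)
  qed
  \<comment> \<open>The enlarged radius is positive and turns the strict inequality into a weak
    one.\<close>
  then show thesis using z by (intro that[of "\<bar>R\<bar> + 1"]) auto
qed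

lemma test_fun_deriv: assumes "test_fun f" shows "test_fun (deriv f)"
proof -
  obtain R where R: "0 < R" "\<And>x. R \<le> \<bar>x\<bar> \<Longrightarrow> deriv f x = 0" using test_funE[OF assms] by metis
  have "{x. deriv f x \<noteq> 0} \<subseteq> {-R..R}"
  proof
    fix x assume "x \<in> {x. deriv f x \<noteq> 0}"
    then have "\<not> R \<le> \<bar>x\<bar>" using R(2) by auto
    then show "x \<in> {-R..R}" by auto
  qed
  then have "bounded {x. deriv f x \<noteq> 0}" by (rule bounded_subset[OF bounded_closed_interval])
  then show ?thesis using assms smoothD(2) unfolding test_fun_smooth by blast
qed

lemma test_fun_props:
  assumes "test_fun f"
  shows "continuous_on UNIV f" "f \<in> borel_measurable borel" "integrable lborel f" "integrable lborel (\<lambda>x. (f x)\<^sup>2)"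
proof -
  show c: "continuous_on UNIV f"
    by (rule DERIV_everywhere_continuous) (use assms smoothD(1) in \<open>auto simp: test_fun_smooth\<close>)
  then show "f \<in> borel_measurable borel" by (rule borel_measurable_continuous_onI)
  obtain R where R: "0 < R" "\<And>x. R \<le> \<bar>x\<bar> \<Longrightarrow> f x = 0" using test_funE[OF assms] by metis
  have *: "integrable lborel g" if "continuous_on UNIV g" "\<And>x. R \<le> \<bar>x\<bar> \<Longrightarrow> g x = 0" for g :: "real \<Rightarrow> real"
  proof -
    have "set_integrable lborel {-R..R} g"
      by (rule borel_integrable_atLeastAtMost'[OF continuous_on_subset[OF that(1)]]) auto
    moreover have "indicator {-R..R} x *\<^sub>R g x = g x" for x
    proof (cases "x \<in> {-R..R}")
      case False
      then have "R \<le> \<bar>x\<bar>" by auto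
      then show ?thesis by (simp add: that(2))
    qed simp
    ultimately show ?thesis by (simp only: set_integrable_def)
  qed
  show "integrable lborel f" by (rule *[OF c R(2)])
  show "integrable lborel (\<lambda>x. (f x)\<^sup>2)" by (rule *) (use R(2) in \<open>auto intro!: continuous_intros c\<close>)
qed

lemma integrable_complex_cis:
  assumes "integrable lborel f" and [measurable]: "g \<in> borel_measurable borel"
  shows "integrable lborel (\<lambda>x. complex_of_real (f x) * cis (g x))"
  by (rule Bochner_Integration.integrable_bound[OF assms(1)]) (use assms(1) in \<open>auto simp: norm_mult\<close>)

lemma fourier_measurable:
  assumes [measurable]: "f \<in> borel_measurable borel"
  shows "fourier f \<in> borel_measurable borel"
  unfolding fourier_def[abs_def] by measurable

lemma fourier_norm_le:
  assumes "integrable lborel f"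
  shows "cmod (fourier f x) \<le> (\<integral>x. \<bar>f x\<bar> \<partial>lborel)"
proof -
  have "cmod (fourier f x) \<le> (\<integral>\<xi>. cmod (complex_of_real (f \<xi>) * cis (- (\<xi> * x))) \<partial>lborel)"
    unfolding fourier_def by (rule integral_norm_bound)
  then show ?thesis by (simp add: norm_mult)
qed

text \<open>Integration by parts on an interval whose end points lie outside the support, so that
  the boundary terms are 0.\<close>

lemma fourier_deriv:
  assumes f: "test_fun f"
  shows "fourier (deriv f) x = \<i> * x * fourier f x"
proof -
  obtain R where R: "0 < R" "\<And>x. R \<le> \<bar>x\<bar> \<Longrightarrow> f x = 0" "\<And>x. R \<le> \<bar>x\<bar> \<Longrightarrow> deriv f x = 0" using test_funE[OF f] by metis
  note F = test_fun_props[OF f] and D = test_fun_props[OF test_fun_deriv[OF f]]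
  let ?H = "\<lambda>\<xi>. complex_of_real (f \<xi>) * cis (- (\<xi> * x))"
  let ?H' = "\<lambda>\<xi>. complex_of_real (deriv f \<xi>) * cis (- (\<xi> * x)) - \<i> * x * (complex_of_real (f \<xi>) * cis (- (\<xi> * x)))"
  have d: "(?H has_vector_derivative ?H' \<xi>) (at \<xi>)" for \<xi>
  proof -
    have 1: "((\<lambda>\<xi>. complex_of_real (f \<xi>)) has_vector_derivative complex_of_real (deriv f \<xi>)) (at \<xi>)"
      using smoothD(1)[of f \<xi>] f unfolding test_fun_smooth by (auto intro: has_vector_derivative_of_real simp: has_real_derivative_iff_has_vector_derivative)
    have 2: "((\<lambda>\<xi>. cis (- (\<xi> * x))) has_vector_derivative (- x) *\<^sub>R (\<i> * cis (- (\<xi> * x)))) (at \<xi>)"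
      unfolding has_vector_derivative_def by (auto intro!: derivative_eq_intros simp: fun_eq_iff scaleR_conv_of_real)
    show ?thesis using has_vector_derivative_mult[OF 1 2] by (simp add: scaleR_conv_of_real algebra_simps)
  qed
  have c: "continuous_on UNIV ?H'" by (intro continuous_intros F D)
  have "(\<integral>\<xi>. indicator {-R..R} \<xi> *\<^sub>R ?H' \<xi> \<partial>lborel) = ?H R - ?H (-R)"
    by (rule integral_FTC_atLeastAtMost)
      (use R(1) in \<open>auto intro: has_vector_derivative_at_within[OF d] continuous_on_subset[OF c]\<close>)
  also have "\<dots> = 0" using R by simp
  also have "(\<integral>\<xi>. indicator {-R..R} \<xi> *\<^sub>R ?H' \<xi> \<partial>lborel) = (\<integral>\<xi>. ?H' \<xi> \<partial>lborel)"
  proof (rule Bochner_Integration.integral_cong[OF refl])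
    show "indicator {-R..R} \<xi> *\<^sub>R ?H' \<xi> = ?H' \<xi>" for \<xi>
    proof (cases "\<xi> \<in> {-R..R}")
      case False
      then have "R \<le> \<bar>\<xi>\<bar>" by auto
      then show ?thesis by (simp add: R(2,3))
    qed simp
  qed
  also have "(\<integral>\<xi>. ?H' \<xi> \<partial>lborel) = fourier (deriv f) x - \<i> * x * fourier f x"
    unfolding fourier_def using integrable_complex_cis[OF F(3)] integrable_complex_cis[OF D(3)] by simp
  finally show ?thesis by simp
qed

text \<open>Two derivatives produce the factor \<open>x\<^sup>2\<close>; quadratic decay is what
  makes \<open>fourier f\<close> integrable.\<close>

lemma fourier_decay:
  assumes f: "test_fun f"
  obtains C where "0 \<le> C" "\<And>x. cmod (fourier f x) \<le> C / (1 + x\<^sup>2)"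
proof -
  note f2 = test_fun_deriv[OF test_fun_deriv[OF f]]
  let ?C = "(\<integral>x. \<bar>f x\<bar> \<partial>lborel) + (\<integral>x. \<bar>deriv (deriv f) x\<bar> \<partial>lborel)"
  have "cmod (fourier f x) * (1 + x\<^sup>2) \<le> ?C" for x
  proof -
    have "fourier (deriv (deriv f)) x = - (complex_of_real (x\<^sup>2) * fourier f x)"
      unfolding fourier_deriv[OF test_fun_deriv[OF f]] fourier_deriv[OF f] by (simp add: power2_eq_square algebra_simps)
    then have "cmod (fourier f x) * x\<^sup>2 = cmod (fourier (deriv (deriv f)) x)" by (simp add: norm_mult norm_power)
    then show ?thesis
      using fourier_norm_le[OF test_fun_props(3)[OF f], of x] fourier_norm_le[OF test_fun_props(3)[OF f2], of x]
      by (simp add: distrib_left)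
  qed
  moreover have "0 < 1 + x\<^sup>2" for x :: real by (simp add: add_pos_nonneg)
  ultimately have "cmod (fourier f x) \<le> ?C / (1 + x\<^sup>2)" for x by (simp add: pos_le_divide_eq)
  moreover have "0 \<le> ?C" by simp
  ultimately show thesis using that by blast
qed

text \<open>Read off from the characteristic function of the standard normal law, then
  rescaled.\<close>

lemma gaussian_fourier:
  assumes n: "0 < n"
  shows "integrable lborel (\<lambda>x. exp (- (x / n)\<^sup>2 / 2))"
    "(\<integral>x. complex_of_real (exp (- (x / n)\<^sup>2 / 2)) * cis (x * z) \<partial>lborel) = complex_of_real (sqrt (2 * pi) * n * exp (- (n * z)\<^sup>2 / 2))"
proof -
  have i0: "integrable lborel (\<lambda>x::real. exp (- x\<^sup>2 / 2))"
  proof -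
    have "integrable lborel (\<lambda>x. sqrt (2 * pi) * std_normal_density x)" by simp
    then show ?thesis unfolding std_normal_density_def by simp
  qed
  show "integrable lborel (\<lambda>x. exp (- (x / n)\<^sup>2 / 2))"
    using lborel_integrable_real_affine[OF i0, of "1 / n" 0] n by (simp add: power_divide)
  have "complex_of_real (exp (- (n * z)\<^sup>2 / 2)) = (\<integral>x. std_normal_density x *\<^sub>R iexp (n * z * x) \<partial>lborel)"
    using char_std_normal_distribution[THEN fun_cong, of "n * z"] unfolding char_def
    by (subst (asm) integral_density) auto
  also have "\<dots> = (\<integral>x. complex_of_real (1 / sqrt (2 * pi)) * (complex_of_real (exp (- x\<^sup>2 / 2)) * cis (n * z * x)) \<partial>lborel)"
    unfolding std_normal_density_def by (rule Bochner_Integration.integral_cong) (auto simp: cis_conv_exp scaleR_conv_of_real)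
  also have "\<dots> = complex_of_real (1 / sqrt (2 * pi)) * (\<integral>x. complex_of_real (exp (- x\<^sup>2 / 2)) * cis (n * z * x) \<partial>lborel)"
    by (rule integral_mult_right_zero)
  finally have e: "(\<integral>x. complex_of_real (exp (- x\<^sup>2 / 2)) * cis (n * z * x) \<partial>lborel) = complex_of_real (sqrt (2 * pi) * exp (- (n * z)\<^sup>2 / 2))"
    by (simp add: field_simps)
  have "(\<integral>x. complex_of_real (exp (- (x / n)\<^sup>2 / 2)) * cis (x * z) \<partial>lborel)
     = n *\<^sub>R (\<integral>x. complex_of_real (exp (- x\<^sup>2 / 2)) * cis (n * z * x) \<partial>lborel)"
    using lborel_integral_real_affine[of n "\<lambda>x. complex_of_real (exp (- (x / n)\<^sup>2 / 2)) * cis (x * z)" 0] n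
    by (simp add: mult_ac)
  then show "(\<integral>x. complex_of_real (exp (- (x / n)\<^sup>2 / 2)) * cis (x * z) \<partial>lborel) = complex_of_real (sqrt (2 * pi) * n * exp (- (n * z)\<^sup>2 / 2))"
    unfolding e by (simp add: scaleR_conv_of_real mult_ac)
qed

text \<open>Origin of the Sobolev thresholds: taken at the exponent of the space it makes the
  transform F integrable above 1/2; taken at that exponent minus 1 it makes \<xi> F integrable above
  3/2.\<close>

lemma integrable_powr_weight:
  assumes r: "r > 1 / 2"
  shows "integrable lborel (\<lambda>x::real. (1 + x\<^sup>2) powr (- r))"
proof -
  let ?h = "\<lambda>x::real. indicator {1..} x * x powr (- (2 * r))"
  have "(\<integral>\<^sup>+x. ennreal (x powr (- (2 * r))) * indicator {1..} x \<partial>lborel)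
     = ennreal (0 - (1 powr (1 - 2 * r) / (1 - 2 * r)))"
  proof (rule nn_integral_FTC_atLeast[where F = "\<lambda>x. x powr (1 - 2 * r) / (1 - 2 * r)"])
    fix x :: real assume "1 \<le> x"
    then show "((\<lambda>x. x powr (1 - 2 * r) / (1 - 2 * r)) has_real_derivative x powr (- (2 * r))) (at x)"
      using r by (auto intro!: derivative_eq_intros)
  next
    have "((\<lambda>x::real. x powr (1 - 2 * r)) \<longlongrightarrow> 0) at_top"
      by (rule tendsto_neg_powr) (use r in \<open>auto intro: filterlim_ident\<close>)
    then have "((\<lambda>x::real. x powr (1 - 2 * r) / (1 - 2 * r)) \<longlongrightarrow> 0 / (1 - 2 * r)) at_top"
      by (intro tendsto_divide tendsto_const) (use r in auto)
    then show "((\<lambda>x::real. x powr (1 - 2 * r) / (1 - 2 * r)) \<longlongrightarrow> 0) at_top" by simp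
  qed auto
  also have "(\<integral>\<^sup>+x. ennreal (x powr (- (2 * r))) * indicator {1..} x \<partial>lborel) = (\<integral>\<^sup>+x. ennreal (?h x) \<partial>lborel)"
    by (intro nn_integral_cong) (auto split: split_indicator)
  finally have h: "integrable lborel ?h"
    by (intro integrableI_nonneg) (auto split: split_indicator)
  have h': "integrable lborel (\<lambda>x. ?h (0 + -1 * x))" by (rule lborel_integrable_real_affine[OF h]) simp
  have i1: "integrable lborel (indicator {-1..1} :: real \<Rightarrow> real)" by (simp add: integrable_indicator_iff)
  show ?thesis
  proof (rule Bochner_Integration.integrable_bound)
    show "integrable lborel (\<lambda>x. indicator {-1..1} x + (?h x + ?h (0 + -1 * x)))"
      by (rule Bochner_Integration.integrable_add[OF i1 Bochner_Integration.integrable_add[OF h h']])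
    show "AE x in lborel. norm ((1 + x\<^sup>2) powr (- r)) \<le> norm (indicator {-1..1} x + (?h x + ?h (0 + -1 * x)))"
    proof (rule AE_I2)
      fix x :: real
      have pos: "0 \<le> ?h x" "0 \<le> ?h (0 + -1 * x)" "0 \<le> indicat_real {-1..1} x" by auto
      have "(1 + x\<^sup>2) powr (- r) \<le> indicator {-1..1} x + (?h x + ?h (0 + -1 * x))"
      proof (cases "\<bar>x\<bar> \<le> 1")
        case True
        have "(1 + x\<^sup>2) powr (- r) \<le> 1 powr (- r)" using r by (intro powr_mono2') auto
        moreover have "indicat_real {-1..1} x = 1" using True by (simp add: abs_le_iff)
        ultimately show ?thesis using pos powr_one_eq_one[of "- r"] by linarith
      next
        case False
        have "(1 + x\<^sup>2) powr (- r) \<le> (x\<^sup>2) powr (- r)" using r False by (intro powr_mono2') auto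
        also have "\<dots> = \<bar>x\<bar> powr (- (2 * r))"
        proof -
          have e: "x\<^sup>2 = \<bar>x\<bar> powr 2" using False by (simp add: powr_numeral)
          show ?thesis unfolding e powr_powr by simp
        qed
        also have "\<dots> \<le> ?h x + ?h (0 + -1 * x)"
          using False by (cases "0 \<le> x") (auto split: split_indicator)
        finally show ?thesis using pos by linarith
      qed
      then show "norm ((1 + x\<^sup>2) powr (- r)) \<le> norm (indicator {-1..1} x + (?h x + ?h (0 + -1 * x)))"
        unfolding real_norm_def by (smt (verit) powr_ge_zero)
    qed
  qed measurable
qed

lemma integrable_inverse_quadratic: "integrable lborel (\<lambda>x::real. 1 / (1 + x\<^sup>2))"
proof -
  have "(1 + x\<^sup>2) powr (- 1) = 1 / (1 + x\<^sup>2)" for x :: real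
    using add_pos_nonneg[of 1 "x\<^sup>2"] by (simp add: powr_minus_divide)
  then show ?thesis using integrable_powr_weight[of 1] by simp
qed

text \<open>A factor of modulus 1 does not affect absolute convergence, so Fubini applies as for the
  product \<open>a x * b y\<close>.\<close>

lemma swap_integral:
  fixes a b :: "real \<Rightarrow> complex" and c :: "real \<Rightarrow> real \<Rightarrow> complex"
  assumes a: "integrable lborel a" and b: "integrable lborel b"
    and c[measurable]: "case_prod c \<in> borel_measurable (borel \<Otimes>\<^sub>M borel)" and c1: "\<And>x y. cmod (c x y) = 1"
  shows "(\<integral>y. (\<integral>x. a x * b y * c x y \<partial>lborel) \<partial>lborel) = (\<integral>x. (\<integral>y. a x * b y * c x y \<partial>lborel) \<partial>lborel)"
proof (rule lborel_pair.Fubini_integral)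
  have [measurable]: "a \<in> borel_measurable borel" "b \<in> borel_measurable borel" using a b by auto
  have m: "case_prod (\<lambda>x y. a x * b y * c x y) \<in> borel_measurable (borel \<Otimes>\<^sub>M borel)" by measurable
  show "integrable (lborel \<Otimes>\<^sub>M lborel) (case_prod (\<lambda>x y. a x * b y * c x y))"
  proof (rule lborel_pair.Fubini_integrable)
    show "case_prod (\<lambda>x y. a x * b y * c x y) \<in> borel_measurable (lborel \<Otimes>\<^sub>M lborel)" using m by simp
    show "integrable lborel (\<lambda>x. \<integral>y. norm (case_prod (\<lambda>x y. a x * b y * c x y) (x, y)) \<partial>lborel)"
      using a by (simp add: norm_mult c1)
    show "AE x in lborel. integrable lborel (\<lambda>y. case_prod (\<lambda>x y. a x * b y * c x y) (x, y))"
    proof (rule AE_I2)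
      fix x
      have [measurable]: "(\<lambda>y. c x y) \<in> borel_measurable borel" using measurable_Pair2[OF c, of x] by simp
      show "integrable lborel (\<lambda>y. case_prod (\<lambda>x y. a x * b y * c x y) (x, y))"
      proof (rule Bochner_Integration.integrable_bound)
        show "integrable lborel (\<lambda>y. a x * b y)" using b by simp
        show "AE y in lborel. norm (case_prod (\<lambda>x y. a x * b y * c x y) (x, y)) \<le> norm (a x * b y)"
          by (simp add: norm_mult c1)
      qed (simp, measurable)
    qed
  qed
qed

lemma fourier_integrable:
  assumes "test_fun f" shows "integrable lborel (fourier f)" "integrable lborel (\<lambda>x. (cmod (fourier f x))\<^sup>2)"
proof -
  have [measurable]: "fourier f \<in> borel_measurable borel" by (rule fourier_measurable[OF test_fun_props(2)[OF assms]])
  obtain C where C: "0 \<le> C" "\<And>x. cmod (fourier f x) \<le> C / (1 + x\<^sup>2)" using fourier_decay[OF assms] by metis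
  have Ci: "integrable lborel (\<lambda>x. C * (1 / (1 + x\<^sup>2)))" by (rule integrable_mult_right[OF integrable_inverse_quadratic])
  have pos: "0 < 1 + x\<^sup>2" "1 \<le> 1 + x\<^sup>2" for x :: real by (auto simp: add_pos_nonneg)
  have Cx: "C / (1 + x\<^sup>2) \<le> C" for x using mult_left_mono[OF pos(2)[of x] C(1)] by (intro mult_imp_div_pos_le pos) simp
  show i: "integrable lborel (fourier f)"
  proof (rule Bochner_Integration.integrable_bound[OF Ci])
    show "AE x in lborel. norm (fourier f x) \<le> norm (C * (1 / (1 + x\<^sup>2)))"
      by (rule AE_I2) (rule order_trans[OF C(2)], simp add: C(1))
  qed measurable
  show "integrable lborel (\<lambda>x. (cmod (fourier f x))\<^sup>2)"
    unfolding power2_eq_square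
    by (rule integrable_bounded_mult[OF _ integrable_norm[OF i], of _ C]) (use order_trans[OF C(2) Cx] in simp_all)
qed

lemma test_fun_bounded:
  assumes f: "test_fun f"
  obtains B where "\<And>x. \<bar>f x\<bar> \<le> B"
proof -
  obtain R where R: "0 < R" "\<And>x. R \<le> \<bar>x\<bar> \<Longrightarrow> f x = 0" using test_funE[OF f] by metis
  have "compact (f ` {-R..R})" by (intro compact_continuous_image continuous_on_subset[OF test_fun_props(1)[OF f]]) auto
  then obtain B where B: "\<forall>y\<in>f ` {-R..R}. norm y \<le> B" using compact_imp_bounded bounded_iff by metis
  have "\<bar>f x\<bar> \<le> \<bar>B\<bar>" for x
  proof (cases "x \<in> {-R..R}")
    case True
    then have "\<bar>f x\<bar> \<le> B" using B by simp
    then show ?thesis by simp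
  next
    case False
    then have "R \<le> \<bar>x\<bar>" by auto
    then show ?thesis using R(2) by simp
  qed
  then show thesis using that by blast
qed

text \<open>Fourier inversion at the origin. Damping by Gaussians of growing width permits Fubini
  and turns the integral into a mean of f over Gaussians of shrinking width; both expressions
  converge by domination.\<close>

lemma integral_fourier:
  assumes f: "test_fun f"
  shows "(\<integral>x. fourier f x \<partial>lborel) = 2 * pi * f 0"
proof (rule LIMSEQ_unique)
  note F = test_fun_props[OF f]
  note [measurable] = F(2) fourier_measurable[OF F(2)]
  note Ki = fourier_integrable(1)[OF f]
  define N where "N n = real (Suc n)" for n
  have N: "0 < N n" for n by (simp add: N_def)
  have Ninv: "(\<lambda>n. x / N n) \<longlonglongrightarrow> 0" for x
    using tendsto_mult_left[OF LIMSEQ_Suc[OF lim_1_over_n], of x] by (simp add: N_def)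
  define g where "g n x = exp (- (x / N n)\<^sup>2 / 2)" for n x
  have gi: "integrable lborel (g n)" for n unfolding g_def by (rule gaussian_fourier(1)[OF N])
  have g1: "\<bar>g n x\<bar> \<le> 1" for n x by (simp add: g_def)
  have [measurable]: "g n \<in> borel_measurable borel" for n unfolding g_def by measurable
  show "(\<lambda>n. \<integral>x. fourier f x * complex_of_real (g n x) \<partial>lborel) \<longlonglongrightarrow> (\<integral>x. fourier f x \<partial>lborel)"
  proof (rule integral_dominated_convergence[where w = "\<lambda>x. cmod (fourier f x)"])
    show "AE x in lborel. (\<lambda>n. fourier f x * complex_of_real (g n x)) \<longlonglongrightarrow> fourier f x"
    proof (rule AE_I2)
      fix x
      have "(\<lambda>n. fourier f x * complex_of_real (exp (- (x / N n)\<^sup>2 / 2))) \<longlonglongrightarrow> fourier f x * complex_of_real (exp (- 0\<^sup>2 / 2))"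
        by (intro tendsto_intros Ninv) auto
      then show "(\<lambda>n. fourier f x * complex_of_real (g n x)) \<longlonglongrightarrow> fourier f x" by (simp add: g_def)
    qed
    show "AE x in lborel. norm (fourier f x * complex_of_real (g n x)) \<le> cmod (fourier f x)" for n
      using g1[of n] by (auto simp: norm_mult intro!: mult_left_le)
  qed (use Ki in auto)
  have ex: "integrable lborel (\<lambda>x::real. exp (- (x / 1)\<^sup>2 / 2))" "(\<integral>x. exp (- (x / 1)\<^sup>2 / 2) \<partial>lborel) = sqrt (2 * pi)"
  proof -
    show i: "integrable lborel (\<lambda>x::real. exp (- (x / 1)\<^sup>2 / 2))" by (rule gaussian_fourier(1)) simp
    have "complex_of_real (\<integral>x. exp (- (x / 1)\<^sup>2 / 2) \<partial>lborel) = complex_of_real (sqrt (2 * pi))"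
      using gaussian_fourier(2)[of 1 0] i by (simp del: of_real_mult)
    then show "(\<integral>x. exp (- (x / 1)\<^sup>2 / 2) \<partial>lborel) = sqrt (2 * pi)" by (simp only: of_real_eq_iff)
  qed
  have eq: "(\<integral>x. fourier f x * complex_of_real (g n x) \<partial>lborel) = complex_of_real (sqrt (2 * pi) * (\<integral>\<eta>. f (\<eta> / N n) * exp (- (\<eta> / 1)\<^sup>2 / 2) \<partial>lborel))" for n
  proof -
    have "(\<integral>x. fourier f x * complex_of_real (g n x) \<partial>lborel) = (\<integral>x. (\<integral>\<xi>. complex_of_real (f \<xi>) * complex_of_real (g n x) * cis (x * - \<xi>) \<partial>lborel) \<partial>lborel)"
    proof (rule Bochner_Integration.integral_cong[OF refl])
      fix x
      have "fourier f x * complex_of_real (g n x) = (\<integral>\<xi>. complex_of_real (f \<xi>) * cis (- (\<xi> * x)) * complex_of_real (g n x) \<partial>lborel)"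
        unfolding fourier_def by simp
      also have "\<dots> = (\<integral>\<xi>. complex_of_real (f \<xi>) * complex_of_real (g n x) * cis (x * - \<xi>) \<partial>lborel)"
        by (rule Bochner_Integration.integral_cong) (auto simp: mult_ac)
      finally show "fourier f x * complex_of_real (g n x) = (\<integral>\<xi>. complex_of_real (f \<xi>) * complex_of_real (g n x) * cis (x * - \<xi>) \<partial>lborel)" .
    qed
    also have "\<dots> = (\<integral>\<xi>. (\<integral>x. complex_of_real (f \<xi>) * complex_of_real (g n x) * cis (x * - \<xi>) \<partial>lborel) \<partial>lborel)"
      by (rule swap_integral) (use F(3) gi in auto)
    also have "\<dots> = (\<integral>\<xi>. complex_of_real (f \<xi>) * complex_of_real (sqrt (2 * pi) * N n * exp (- (N n * - \<xi>)\<^sup>2 / 2)) \<partial>lborel)"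
      unfolding mult.assoc g_def integral_mult_right_zero gaussian_fourier(2)[OF N] by simp
    also have "\<dots> = complex_of_real (\<integral>\<xi>. f \<xi> * (sqrt (2 * pi) * N n * exp (- (N n * - \<xi>)\<^sup>2 / 2)) \<partial>lborel)"
      unfolding of_real_mult[symmetric] by (rule integral_complex_of_real)
    \<comment> \<open>Rescaling by \<open>N n\<close> fixes the Gaussian and moves the dependence on
      n into the argument of f.\<close>
    also have "(\<integral>\<xi>. f \<xi> * (sqrt (2 * pi) * N n * exp (- (N n * - \<xi>)\<^sup>2 / 2)) \<partial>lborel)
       = \<bar>1 / N n\<bar> *\<^sub>R (\<integral>\<eta>. f (0 + 1 / N n * \<eta>) * (sqrt (2 * pi) * N n * exp (- (N n * - (0 + 1 / N n * \<eta>))\<^sup>2 / 2)) \<partial>lborel)"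
      by (rule lborel_integral_real_affine) (use N[of n] in simp)
    also have "\<dots> = (\<integral>\<eta>. 1 / N n * (f (0 + 1 / N n * \<eta>) * (sqrt (2 * pi) * N n * exp (- (N n * - (0 + 1 / N n * \<eta>))\<^sup>2 / 2))) \<partial>lborel)"
      unfolding integral_mult_right_zero real_scaleR_def by (simp only: abs_of_pos[OF divide_pos_pos[OF zero_less_one N]])
    also have "\<dots> = (\<integral>\<eta>. sqrt (2 * pi) * (f (\<eta> / N n) * exp (- (\<eta> / 1)\<^sup>2 / 2)) \<partial>lborel)"
      by (rule Bochner_Integration.integral_cong) (use N[of n] in auto)
    also have "\<dots> = sqrt (2 * pi) * (\<integral>\<eta>. f (\<eta> / N n) * exp (- (\<eta> / 1)\<^sup>2 / 2) \<partial>lborel)"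
      by (rule integral_mult_right_zero)
    finally show ?thesis .
  qed
  obtain B where B: "\<And>x. \<bar>f x\<bar> \<le> B" using test_fun_bounded[OF f] by metis
  have "(\<lambda>n. \<integral>\<eta>. f (\<eta> / N n) * exp (- (\<eta> / 1)\<^sup>2 / 2) \<partial>lborel) \<longlonglongrightarrow> (\<integral>\<eta>. f 0 * exp (- (\<eta> / 1)\<^sup>2 / 2) \<partial>lborel)"
  proof (rule integral_dominated_convergence[where w = "\<lambda>\<eta>. B * exp (- (\<eta> / 1)\<^sup>2 / 2)"])
    show "AE \<eta> in lborel. (\<lambda>n. f (\<eta> / N n) * exp (- (\<eta> / 1)\<^sup>2 / 2)) \<longlonglongrightarrow> f 0 * exp (- (\<eta> / 1)\<^sup>2 / 2)"
      using continuous_on_tendsto_compose[OF F(1) Ninv] by (auto intro!: tendsto_intros)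
    show "AE \<eta> in lborel. norm (f (\<eta> / N n) * exp (- (\<eta> / 1)\<^sup>2 / 2)) \<le> B * exp (- (\<eta> / 1)\<^sup>2 / 2)" for n
      using B by (auto simp: abs_mult intro!: mult_right_mono)
  qed (use ex in auto)
  then have "(\<lambda>n. \<integral>\<eta>. f (\<eta> / N n) * exp (- (\<eta> / 1)\<^sup>2 / 2) \<partial>lborel) \<longlonglongrightarrow> f 0 * sqrt (2 * pi)"
    unfolding integral_mult_right_zero ex(2) .
  then have "(\<lambda>n. complex_of_real (sqrt (2 * pi) * (\<integral>\<eta>. f (\<eta> / N n) * exp (- (\<eta> / 1)\<^sup>2 / 2) \<partial>lborel))) \<longlonglongrightarrow> complex_of_real (sqrt (2 * pi) * (f 0 * sqrt (2 * pi)))"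
    by (intro tendsto_of_real tendsto_mult_left)
  moreover have "sqrt (2 * pi) * (f 0 * sqrt (2 * pi)) = 2 * pi * f 0" by simp
  ultimately show "(\<lambda>n. \<integral>x. fourier f x * complex_of_real (g n x) \<partial>lborel) \<longlonglongrightarrow> complex_of_real (2 * pi * f 0)"
    unfolding eq by (simp only:)
qed

text \<open>A Gaussian damping factor makes Fubini applicable; \<open>|H \<xi> H \<eta>| \<le> (|H \<xi>|\<^sup>2 + |H \<eta>|\<^sup>2) / 2\<close> then
  replaces the Plancherel identity.\<close>
lemma bessel_inequality:
  fixes H :: "real \<Rightarrow> complex"
  assumes H1: "integrable lborel H" and H2: "integrable lborel (\<lambda>\<xi>. (cmod (H \<xi>))\<^sup>2)"
  defines "h \<equiv> \<lambda>y. \<integral>\<xi>. H \<xi> * cis (y * \<xi>) \<partial>lborel"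
  shows "integrable lborel (\<lambda>y. (cmod (h y))\<^sup>2)"
    "(\<integral>y. (cmod (h y))\<^sup>2 \<partial>lborel) \<le> 2 * pi * (\<integral>\<xi>. (cmod (H \<xi>))\<^sup>2 \<partial>lborel)"
proof -
  let ?I = "\<integral>\<xi>. (cmod (H \<xi>))\<^sup>2 \<partial>lborel"
  have [measurable]: "H \<in> borel_measurable borel" using H1 by auto
  have hm[measurable]: "h \<in> borel_measurable borel" unfolding h_def by measurable
  have hb: "cmod (h y) \<le> (\<integral>\<xi>. cmod (H \<xi>) \<partial>lborel)" for y
  proof -
    have "cmod (h y) \<le> (\<integral>\<xi>. cmod (H \<xi> * cis (y * \<xi>)) \<partial>lborel)" unfolding h_def by (rule integral_norm_bound)
    then show ?thesis by (simp add: norm_mult)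
  qed
  define N where "N n = real (Suc n)" for n
  have N: "0 < N n" for n by (simp add: N_def)
  have Ninv: "(\<lambda>n. x / N n) \<longlonglongrightarrow> 0" for x
    using tendsto_mult_left[OF LIMSEQ_Suc[OF lim_1_over_n], of x] by (simp add: N_def)
  define g where "g n x = exp (- (x / N n)\<^sup>2 / 2)" for n x
  have gi: "integrable lborel (g n)" for n unfolding g_def by (rule gaussian_fourier(1)[OF N])
  have g01: "0 \<le> g n x" "g n x \<le> 1" for n x by (simp_all add: g_def)
  have [measurable]: "g n \<in> borel_measurable borel" for n unfolding g_def by measurable
  \<comment> \<open>The Fourier transform of \<open>g n\<close>. Its mass is 2 pi for every n, and
    this is the constant of the inequality.\<close>
  define G where "G n z = sqrt (2 * pi) * N n * exp (- (N n * z)\<^sup>2 / 2)" for n z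
  have G0: "0 \<le> G n z" for n z unfolding G_def using N[of n] by simp
  have [measurable]: "G n \<in> borel_measurable borel" for n unfolding G_def by measurable
  have Gint: "(\<integral>\<^sup>+z. ennreal (G n (x - z)) \<partial>lborel) = ennreal (2 * pi)" "(\<integral>\<^sup>+z. ennreal (G n (z - x)) \<partial>lborel) = ennreal (2 * pi)" for n x
  proof -
    have e: "(N n * z)\<^sup>2 = (z / (1 / N n))\<^sup>2" for z using N[of n] by (simp add: field_simps)
    have i: "integrable lborel (G n)" unfolding G_def e using N[of n] by (intro integrable_mult_right gaussian_fourier(1)) simp
    have "complex_of_real (\<integral>z. exp (- (z / (1 / N n))\<^sup>2 / 2) \<partial>lborel) = complex_of_real (sqrt (2 * pi) * (1 / N n))"
      using gaussian_fourier(2)[of "1 / N n" 0] N[of n] integral_complex_of_real[of lborel "\<lambda>z. exp (- (z / (1 / N n))\<^sup>2 / 2)"]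
      by (simp del: of_real_mult of_real_divide)
    then have "(\<integral>z. exp (- (z / (1 / N n))\<^sup>2 / 2) \<partial>lborel) = sqrt (2 * pi) * (1 / N n)" by (simp only: of_real_eq_iff)
    then have "(\<integral>z. G n z \<partial>lborel) = sqrt (2 * pi) * N n * (sqrt (2 * pi) * (1 / N n))"
      unfolding G_def e integral_mult_right_zero by (simp only:)
    also have "\<dots> = 2 * pi" using N[of n] by simp
    finally have "(\<integral>\<^sup>+z. ennreal (G n z) \<partial>lborel) = ennreal (2 * pi)"
      using nn_integral_eq_integral[OF i] G0[of n] by simp
    then show "(\<integral>\<^sup>+z. ennreal (G n (z - x)) \<partial>lborel) = ennreal (2 * pi)"
      using nn_integral_translate[of "\<lambda>z. ennreal (G n z)" "- x"] by simp
    moreover have "G n (x - z) = G n (z - x)" for z by (simp add: G_def power_mult_distrib power2_commute[of x z])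
    ultimately show "(\<integral>\<^sup>+z. ennreal (G n (x - z)) \<partial>lborel) = ennreal (2 * pi)" by simp
  qed
  have hc: "cnj (h y) = (\<integral>\<eta>. cnj (H \<eta>) * cis (y * - \<eta>) \<partial>lborel)" for y
  proof -
    have "cnj (h y) = (\<integral>\<eta>. cnj (H \<eta> * cis (y * \<eta>)) \<partial>lborel)" unfolding h_def by (rule Bochner_Integration.integral_cnj[symmetric])
    then show ?thesis by (simp add: cis_cnj)
  qed
  have main: "integrable lborel (\<lambda>y. g n y * (cmod (h y))\<^sup>2)" "(\<integral>y. g n y * (cmod (h y))\<^sup>2 \<partial>lborel) \<le> 2 * pi * ?I" for n
  proof -
    let ?B = "\<integral>\<xi>. cmod (H \<xi>) \<partial>lborel"
    have "\<bar>(cmod (h y))\<^sup>2\<bar> \<le> ?B\<^sup>2" for y using hb[of y] by simp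
    from integrable_bounded_mult[OF _ gi[of n] this] show gh: "integrable lborel (\<lambda>y. g n y * (cmod (h y))\<^sup>2)"
      by (simp add: mult.commute)
    have bi: "integrable lborel (\<lambda>y. complex_of_real (g n y) * cnj (h y))"
    proof (rule Bochner_Integration.integrable_bound)
      show "integrable lborel (\<lambda>y. ?B * g n y)" using gi by simp
      show "AE y in lborel. norm (complex_of_real (g n y) * cnj (h y)) \<le> norm (?B * g n y)"
      proof (rule AE_I2)
        fix y
        have "norm (complex_of_real (g n y) * cnj (h y)) = g n y * cmod (h y)" using g01(1)[of n y] by (simp add: norm_mult)
        also have "\<dots> \<le> g n y * ?B" by (rule mult_left_mono[OF hb g01(1)])
        also have "\<dots> \<le> norm (?B * g n y)" unfolding real_norm_def mult.commute[of ?B] by (rule abs_ge_self)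
        finally show "norm (complex_of_real (g n y) * cnj (h y)) \<le> norm (?B * g n y)" .
      qed
    qed measurable
    \<comment> \<open>After a second use of Fubini this is the convolution of
      \<open>cnj (H \<eta>)\<close> with \<open>G n\<close>.\<close>
    define k where "k \<xi> = (\<integral>y. complex_of_real (g n y) * cnj (h y) * cis (y * \<xi>) \<partial>lborel)" for \<xi>
    have [measurable]: "k \<in> borel_measurable borel" unfolding k_def by measurable
    have "complex_of_real (\<integral>y. g n y * (cmod (h y))\<^sup>2 \<partial>lborel) = (\<integral>y. complex_of_real (g n y * (cmod (h y))\<^sup>2) \<partial>lborel)"
      by (rule integral_complex_of_real[symmetric])
    also have "\<dots> = (\<integral>y. (\<integral>\<xi>. H \<xi> * (complex_of_real (g n y) * cnj (h y)) * cis (y * \<xi>) \<partial>lborel) \<partial>lborel)"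
    proof (rule Bochner_Integration.integral_cong[OF refl])
      fix y
      have "complex_of_real (g n y * (cmod (h y))\<^sup>2) = (complex_of_real (g n y) * cnj (h y)) * h y"
        by (simp add: complex_norm_square mult_ac del: of_real_power)
      also have "\<dots> = (\<integral>\<xi>. (complex_of_real (g n y) * cnj (h y)) * (H \<xi> * cis (y * \<xi>)) \<partial>lborel)"
        unfolding h_def by (rule integral_mult_right_zero[symmetric])
      finally show "complex_of_real (g n y * (cmod (h y))\<^sup>2) = (\<integral>\<xi>. H \<xi> * (complex_of_real (g n y) * cnj (h y)) * cis (y * \<xi>) \<partial>lborel)"
        by (simp only: mult_ac)
    qed
    also have "\<dots> = (\<integral>\<xi>. (\<integral>y. H \<xi> * (complex_of_real (g n y) * cnj (h y)) * cis (y * \<xi>) \<partial>lborel) \<partial>lborel)"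
      by (rule swap_integral[OF H1 bi]) auto
    also have "\<dots> = (\<integral>\<xi>. H \<xi> * k \<xi> \<partial>lborel)"
      unfolding k_def mult.assoc integral_mult_right_zero ..
    finally have eq: "complex_of_real (\<integral>y. g n y * (cmod (h y))\<^sup>2 \<partial>lborel) = (\<integral>\<xi>. H \<xi> * k \<xi> \<partial>lborel)" .
    have k: "k \<xi> = (\<integral>\<eta>. cnj (H \<eta>) * complex_of_real (G n (\<xi> - \<eta>)) \<partial>lborel)" for \<xi>
    proof -
      have "k \<xi> = (\<integral>y. (\<integral>\<eta>. cnj (H \<eta>) * (complex_of_real (g n y) * cis (y * \<xi>)) * cis (y * - \<eta>) \<partial>lborel) \<partial>lborel)"
        unfolding k_def
      proof (rule Bochner_Integration.integral_cong[OF refl])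
        fix y
        have "complex_of_real (g n y) * cnj (h y) * cis (y * \<xi>) = (complex_of_real (g n y) * cis (y * \<xi>)) * cnj (h y)" by (simp add: mult_ac)
        also have "\<dots> = (\<integral>\<eta>. (complex_of_real (g n y) * cis (y * \<xi>)) * (cnj (H \<eta>) * cis (y * - \<eta>)) \<partial>lborel)"
          unfolding hc by (rule integral_mult_right_zero[symmetric])
        finally show "complex_of_real (g n y) * cnj (h y) * cis (y * \<xi>) = (\<integral>\<eta>. cnj (H \<eta>) * (complex_of_real (g n y) * cis (y * \<xi>)) * cis (y * - \<eta>) \<partial>lborel)"
          by (simp only: mult_ac)
      qed
      also have "\<dots> = (\<integral>\<eta>. (\<integral>y. cnj (H \<eta>) * (complex_of_real (g n y) * cis (y * \<xi>)) * cis (y * - \<eta>) \<partial>lborel) \<partial>lborel)"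
        by (rule swap_integral) (use H1 in \<open>auto intro!: integrable_complex_cis gi\<close>)
      also have "\<dots> = (\<integral>\<eta>. cnj (H \<eta>) * complex_of_real (G n (\<xi> - \<eta>)) \<partial>lborel)"
      proof (rule Bochner_Integration.integral_cong[OF refl])
        fix \<eta>
        have "(\<integral>y. cnj (H \<eta>) * (complex_of_real (g n y) * cis (y * \<xi>)) * cis (y * - \<eta>) \<partial>lborel)
          = (\<integral>y. cnj (H \<eta>) * (complex_of_real (g n y) * cis (y * (\<xi> - \<eta>))) \<partial>lborel)"
        proof (rule Bochner_Integration.integral_cong[OF refl])
          fix y
          have "cis (y * \<xi>) * cis (y * - \<eta>) = cis (y * (\<xi> - \<eta>))" by (simp add: cis_mult right_diff_distrib)
          then show "cnj (H \<eta>) * (complex_of_real (g n y) * cis (y * \<xi>)) * cis (y * - \<eta>) = cnj (H \<eta>) * (complex_of_real (g n y) * cis (y * (\<xi> - \<eta>)))"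
            by (simp only: mult.assoc)
        qed
        also have "\<dots> = cnj (H \<eta>) * complex_of_real (G n (\<xi> - \<eta>))"
          unfolding integral_mult_right_zero g_def G_def gaussian_fourier(2)[OF N] ..
        finally show "(\<integral>y. cnj (H \<eta>) * (complex_of_real (g n y) * cis (y * \<xi>)) * cis (y * - \<eta>) \<partial>lborel) = cnj (H \<eta>) * complex_of_real (G n (\<xi> - \<eta>))" .
      qed
      finally show ?thesis .
    qed
    have Gb: "\<bar>G n z\<bar> \<le> sqrt (2 * pi) * N n" for z
      unfolding abs_of_nonneg[OF G0] unfolding G_def using N[of n] by (intro mult_left_le) auto
    have kn: "ennreal (cmod (k \<xi>)) \<le> (\<integral>\<^sup>+\<eta>. ennreal (cmod (H \<eta>) * G n (\<xi> - \<eta>)) \<partial>lborel)" for \<xi>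
    proof -
      have i: "integrable lborel (\<lambda>\<eta>. cnj (H \<eta>) * complex_of_real (G n (\<xi> - \<eta>)))"
      proof (rule Bochner_Integration.integrable_bound)
        show "integrable lborel (\<lambda>\<eta>. (sqrt (2 * pi) * N n) * cmod (H \<eta>))" using H1 by simp
        show "AE \<eta> in lborel. norm (cnj (H \<eta>) * complex_of_real (G n (\<xi> - \<eta>))) \<le> norm ((sqrt (2 * pi) * N n) * cmod (H \<eta>))"
        proof (rule AE_I2)
          fix \<eta>
          have "norm (cnj (H \<eta>) * complex_of_real (G n (\<xi> - \<eta>))) = \<bar>G n (\<xi> - \<eta>)\<bar> * cmod (H \<eta>)"
            by (simp add: norm_mult)
          also have "\<dots> \<le> (sqrt (2 * pi) * N n) * cmod (H \<eta>)" by (intro mult_right_mono Gb) simp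
          also have "\<dots> \<le> norm ((sqrt (2 * pi) * N n) * cmod (H \<eta>))" unfolding real_norm_def by (rule abs_ge_self)
          finally show "norm (cnj (H \<eta>) * complex_of_real (G n (\<xi> - \<eta>))) \<le> norm ((sqrt (2 * pi) * N n) * cmod (H \<eta>))" .
        qed
      qed measurable
      have "ennreal (cmod (k \<xi>)) \<le> (\<integral>\<^sup>+\<eta>. ennreal (cmod (cnj (H \<eta>) * complex_of_real (G n (\<xi> - \<eta>)))) \<partial>lborel)"
        unfolding k by (rule integral_norm_bound_ennreal[OF i])
      then show ?thesis using G0 by (simp add: norm_mult)
    qed
    have "ennreal (\<integral>y. g n y * (cmod (h y))\<^sup>2 \<partial>lborel) = ennreal (cmod (\<integral>\<xi>. H \<xi> * k \<xi> \<partial>lborel))"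
      unfolding eq[symmetric] norm_of_real using g01[of n] by (simp add: integral_nonneg_AE)
    also have "\<dots> \<le> (\<integral>\<^sup>+\<xi>. ennreal (cmod (H \<xi> * k \<xi>)) \<partial>lborel)"
    \<comment> \<open>The integral of a non-integrable function is 0 by convention, which makes the
      bound trivial in that case.\<close>
    proof (cases "integrable lborel (\<lambda>\<xi>. H \<xi> * k \<xi>)")
      case False
      then show ?thesis by (simp add: not_integrable_integral_eq)
    qed (rule integral_norm_bound_ennreal)
    also have "\<dots> \<le> (\<integral>\<^sup>+\<xi>. (\<integral>\<^sup>+\<eta>. ennreal ((cmod (H \<xi>))\<^sup>2 / 2) * ennreal (G n (\<xi> - \<eta>)) + ennreal ((cmod (H \<eta>))\<^sup>2 / 2) * ennreal (G n (\<xi> - \<eta>)) \<partial>lborel) \<partial>lborel)"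
    proof (rule nn_integral_mono)
      fix \<xi>
      have "ennreal (cmod (H \<xi> * k \<xi>)) = ennreal (cmod (H \<xi>)) * ennreal (cmod (k \<xi>))" by (simp add: norm_mult ennreal_mult)
      also have "\<dots> \<le> ennreal (cmod (H \<xi>)) * (\<integral>\<^sup>+\<eta>. ennreal (cmod (H \<eta>) * G n (\<xi> - \<eta>)) \<partial>lborel)"
        by (rule mult_left_mono[OF kn]) simp
      also have "\<dots> = (\<integral>\<^sup>+\<eta>. ennreal (cmod (H \<xi>)) * ennreal (cmod (H \<eta>) * G n (\<xi> - \<eta>)) \<partial>lborel)"
        by (rule nn_integral_cmult[symmetric]) measurable
      also have "\<dots> \<le> (\<integral>\<^sup>+\<eta>. ennreal ((cmod (H \<xi>))\<^sup>2 / 2) * ennreal (G n (\<xi> - \<eta>)) + ennreal ((cmod (H \<eta>))\<^sup>2 / 2) * ennreal (G n (\<xi> - \<eta>)) \<partial>lborel)"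
      proof (rule nn_integral_mono)
        fix \<eta>
        have "0 \<le> (cmod (H \<xi>) - cmod (H \<eta>))\<^sup>2" by simp
        then have "cmod (H \<xi>) * cmod (H \<eta>) \<le> (cmod (H \<xi>))\<^sup>2 / 2 + (cmod (H \<eta>))\<^sup>2 / 2" by (simp add: power2_diff)
        then have "cmod (H \<xi>) * cmod (H \<eta>) * G n (\<xi> - \<eta>) \<le> ((cmod (H \<xi>))\<^sup>2 / 2 + (cmod (H \<eta>))\<^sup>2 / 2) * G n (\<xi> - \<eta>)"
          by (rule mult_right_mono) (rule G0)
        then have "cmod (H \<xi>) * (cmod (H \<eta>) * G n (\<xi> - \<eta>)) \<le> (cmod (H \<xi>))\<^sup>2 / 2 * G n (\<xi> - \<eta>) + (cmod (H \<eta>))\<^sup>2 / 2 * G n (\<xi> - \<eta>)"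
          by (simp only: mult.assoc distrib_right)
        then show "ennreal (cmod (H \<xi>)) * ennreal (cmod (H \<eta>) * G n (\<xi> - \<eta>)) \<le> ennreal ((cmod (H \<xi>))\<^sup>2 / 2) * ennreal (G n (\<xi> - \<eta>)) + ennreal ((cmod (H \<eta>))\<^sup>2 / 2) * ennreal (G n (\<xi> - \<eta>))"
          using G0 by (simp add: ennreal_mult[symmetric] ennreal_plus[symmetric] ennreal_leI del: ennreal_plus)
      qed
      finally show "ennreal (cmod (H \<xi> * k \<xi>)) \<le> (\<integral>\<^sup>+\<eta>. ennreal ((cmod (H \<xi>))\<^sup>2 / 2) * ennreal (G n (\<xi> - \<eta>)) + ennreal ((cmod (H \<eta>))\<^sup>2 / 2) * ennreal (G n (\<xi> - \<eta>)) \<partial>lborel)" .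
    qed
    also have "\<dots> = (\<integral>\<^sup>+\<xi>. (\<integral>\<^sup>+\<eta>. ennreal ((cmod (H \<xi>))\<^sup>2 / 2) * ennreal (G n (\<xi> - \<eta>)) \<partial>lborel) \<partial>lborel)
       + (\<integral>\<^sup>+\<xi>. (\<integral>\<^sup>+\<eta>. ennreal ((cmod (H \<eta>))\<^sup>2 / 2) * ennreal (G n (\<xi> - \<eta>)) \<partial>lborel) \<partial>lborel)"
      by (subst nn_integral_add[symmetric]) (auto intro!: nn_integral_cong nn_integral_add)
    also have "(\<integral>\<^sup>+\<xi>. (\<integral>\<^sup>+\<eta>. ennreal ((cmod (H \<eta>))\<^sup>2 / 2) * ennreal (G n (\<xi> - \<eta>)) \<partial>lborel) \<partial>lborel)
       = (\<integral>\<^sup>+\<eta>. (\<integral>\<^sup>+\<xi>. ennreal ((cmod (H \<eta>))\<^sup>2 / 2) * ennreal (G n (\<xi> - \<eta>)) \<partial>lborel) \<partial>lborel)"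
      by (rule lborel_pair.Fubini') measurable
    also have "\<dots> = (\<integral>\<^sup>+\<xi>. ennreal ((cmod (H \<xi>))\<^sup>2 / 2) * ennreal (2 * pi) \<partial>lborel)"
      by (intro nn_integral_cong) (simp add: nn_integral_cmult Gint)
    also have "(\<integral>\<^sup>+\<xi>. (\<integral>\<^sup>+\<eta>. ennreal ((cmod (H \<xi>))\<^sup>2 / 2) * ennreal (G n (\<xi> - \<eta>)) \<partial>lborel) \<partial>lborel)
       = (\<integral>\<^sup>+\<xi>. ennreal ((cmod (H \<xi>))\<^sup>2 / 2) * ennreal (2 * pi) \<partial>lborel)"
      by (intro nn_integral_cong) (simp add: nn_integral_cmult Gint)
    also have "(\<integral>\<^sup>+\<xi>. ennreal ((cmod (H \<xi>))\<^sup>2 / 2) * ennreal (2 * pi) \<partial>lborel) = (\<integral>\<^sup>+\<xi>. ennreal (pi * (cmod (H \<xi>))\<^sup>2) \<partial>lborel)"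
      by (intro nn_integral_cong) (simp add: ennreal_mult[symmetric] mult_ac)
    also have "\<dots> = ennreal (\<integral>\<xi>. pi * (cmod (H \<xi>))\<^sup>2 \<partial>lborel)"
      by (rule nn_integral_eq_integral) (use H2 in auto)
    also have "ennreal (\<integral>\<xi>. pi * (cmod (H \<xi>))\<^sup>2 \<partial>lborel) + ennreal (\<integral>\<xi>. pi * (cmod (H \<xi>))\<^sup>2 \<partial>lborel) = ennreal (2 * pi * ?I)"
      by (simp add: ennreal_plus[symmetric] del: ennreal_plus)
    finally show "(\<integral>y. g n y * (cmod (h y))\<^sup>2 \<partial>lborel) \<le> 2 * pi * ?I" by (simp add: ennreal_le_iff)
  qed
  have lim: "(\<lambda>n. g n y * (cmod (h y))\<^sup>2) \<longlonglongrightarrow> (cmod (h y))\<^sup>2" for y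
  proof -
    have "(\<lambda>n. exp (- (y / N n)\<^sup>2 / 2) * (cmod (h y))\<^sup>2) \<longlonglongrightarrow> exp (- 0\<^sup>2 / 2) * (cmod (h y))\<^sup>2"
      by (intro tendsto_intros Ninv) auto
    then show ?thesis by (simp add: g_def)
  qed
  show "integrable lborel (\<lambda>y. (cmod (h y))\<^sup>2)"
    by (rule integrable_liminf_bound(1)[OF _ _ main(1) _ lim main(2) tendsto_const]) (use g01 in auto)
  show "(\<integral>y. (cmod (h y))\<^sup>2 \<partial>lborel) \<le> 2 * pi * (\<integral>\<xi>. (cmod (H \<xi>))\<^sup>2 \<partial>lborel)"
    by (rule integrable_liminf_bound(2)[OF _ _ main(1) _ lim main(2) tendsto_const]) (use g01 in auto)
qed

section \<open>Fourier inversion in Sobolev spaces\<close>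

lemma Hs_repD:
  assumes "Hs_rep r f F" and r: "0 \<le> r"
  shows "F \<in> borel_measurable borel" "integrable lborel (\<lambda>\<xi>. (1 + \<xi>\<^sup>2) powr r * (cmod (F \<xi>))\<^sup>2)"
    "test_fun p \<Longrightarrow> (\<integral>x. complex_of_real (f x) * fourier p x \<partial>lborel) = (\<integral>\<xi>. F \<xi> * complex_of_real (p \<xi>) \<partial>lborel)"
    "integrable lborel (\<lambda>\<xi>. (cmod (F \<xi>))\<^sup>2)"
proof -
  show m: "F \<in> borel_measurable borel" and i: "integrable lborel (\<lambda>\<xi>. (1 + \<xi>\<^sup>2) powr r * (cmod (F \<xi>))\<^sup>2)"
    and "test_fun p \<Longrightarrow> (\<integral>x. complex_of_real (f x) * fourier p x \<partial>lborel) = (\<integral>\<xi>. F \<xi> * complex_of_real (p \<xi>) \<partial>lborel)"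
    using assms(1) by (simp_all add: Hs_rep_def)
  show "integrable lborel (\<lambda>\<xi>. (cmod (F \<xi>))\<^sup>2)"
  proof (rule Bochner_Integration.integrable_bound[OF i])
    show "AE \<xi> in lborel. norm ((cmod (F \<xi>))\<^sup>2) \<le> norm ((1 + \<xi>\<^sup>2) powr r * (cmod (F \<xi>))\<^sup>2)"
    proof (rule AE_I2)
      fix \<xi> :: real
      have "1 * (cmod (F \<xi>))\<^sup>2 \<le> (1 + \<xi>\<^sup>2) powr r * (cmod (F \<xi>))\<^sup>2"
        using r by (intro mult_right_mono ge_one_powr_ge_zero) auto
      then show "norm ((cmod (F \<xi>))\<^sup>2) \<le> norm ((1 + \<xi>\<^sup>2) powr r * (cmod (F \<xi>))\<^sup>2)" by simp
    qed
  qed (use m in measurable)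
qed

text \<open>Cauchy-Schwarz after inserting the weight
  \<open>(1 + \<xi>\<^sup>2) powr (r / 2)\<close> and its inverse. Used with k = 1, d = 0 for F and
  with k = \<xi>, d = 1 for \<xi> F.\<close>

lemma weighted_L1_bound:
  fixes F :: "real \<Rightarrow> complex" and k :: "real \<Rightarrow> real"
  assumes [measurable]: "F \<in> borel_measurable borel" "k \<in> borel_measurable borel"
    and w: "integrable lborel (\<lambda>\<xi>. (1 + \<xi>\<^sup>2) powr r * (cmod (F \<xi>))\<^sup>2)"
    and k: "\<And>\<xi>. (k \<xi>)\<^sup>2 \<le> (1 + \<xi>\<^sup>2) powr d" and d: "r - d > 1 / 2"
  shows "integrable lborel (\<lambda>\<xi>. \<bar>k \<xi>\<bar> * cmod (F \<xi>))"
    "(\<integral>\<xi>. \<bar>k \<xi>\<bar> * cmod (F \<xi>) \<partial>lborel)\<^sup>2 \<le> (\<integral>\<xi>. (1 + \<xi>\<^sup>2) powr (- (r - d)) \<partial>lborel) * (\<integral>\<xi>. (1 + \<xi>\<^sup>2) powr r * (cmod (F \<xi>))\<^sup>2 \<partial>lborel)"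
proof -
  let ?a = "\<lambda>\<xi>. \<bar>k \<xi>\<bar> * (1 + \<xi>\<^sup>2) powr (- (r / 2))" and ?b = "\<lambda>\<xi>. (1 + \<xi>\<^sup>2) powr (r / 2) * cmod (F \<xi>)"
  have p0: "0 < 1 + \<xi>\<^sup>2" for \<xi> :: real by (simp add: add_pos_nonneg)
  have ab: "?a \<xi> * ?b \<xi> = \<bar>k \<xi>\<bar> * cmod (F \<xi>)" for \<xi>
  proof -
    have "?a \<xi> * ?b \<xi> = \<bar>k \<xi>\<bar> * cmod (F \<xi>) * ((1 + \<xi>\<^sup>2) powr (- (r / 2)) * (1 + \<xi>\<^sup>2) powr (r / 2))" by (simp only: mult_ac)
    also have "(1 + \<xi>\<^sup>2) powr (- (r / 2)) * (1 + \<xi>\<^sup>2) powr (r / 2) = 1"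
      using p0[of \<xi>] by (simp add: powr_add[symmetric])
    finally show ?thesis by simp
  qed
  have sq: "((1 + \<xi>\<^sup>2) powr s)\<^sup>2 = (1 + \<xi>\<^sup>2) powr (2 * s)" for \<xi> s :: real
    by (simp add: power2_eq_square powr_add[symmetric])
  have b2: "(?b \<xi>)\<^sup>2 = (1 + \<xi>\<^sup>2) powr r * (cmod (F \<xi>))\<^sup>2" for \<xi> by (simp add: power_mult_distrib sq)
  have a2: "(?a \<xi>)\<^sup>2 \<le> (1 + \<xi>\<^sup>2) powr (- (r - d))" for \<xi>
  proof -
    have "(?a \<xi>)\<^sup>2 = (k \<xi>)\<^sup>2 * (1 + \<xi>\<^sup>2) powr (- r)" by (simp add: power_mult_distrib sq)
    also have "\<dots> \<le> (1 + \<xi>\<^sup>2) powr d * (1 + \<xi>\<^sup>2) powr (- r)" by (intro mult_right_mono k) simp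
    also have "\<dots> = (1 + \<xi>\<^sup>2) powr (- (r - d))" by (simp add: powr_add[symmetric])
    finally show ?thesis .
  qed
  note wi = integrable_powr_weight[OF d]
  have ai: "integrable lborel (\<lambda>\<xi>. (?a \<xi>)\<^sup>2)"
  proof (rule Bochner_Integration.integrable_bound[OF wi])
    show "AE \<xi> in lborel. norm ((?a \<xi>)\<^sup>2) \<le> norm ((1 + \<xi>\<^sup>2) powr (- (r - d)))"
      using a2 by (intro AE_I2) (simp only: real_norm_def abs_of_nonneg zero_le_power2 powr_ge_zero)
  qed measurable
  have bi: "integrable lborel (\<lambda>\<xi>. (?b \<xi>)\<^sup>2)" unfolding b2 by (rule w)
  have am: "?a \<in> borel_measurable lborel" "?b \<in> borel_measurable lborel" by measurable
  show "integrable lborel (\<lambda>\<xi>. \<bar>k \<xi>\<bar> * cmod (F \<xi>))"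
    using integrable_mult_of_square[OF am ai bi] unfolding ab .
  have "(\<integral>\<xi>. \<bar>k \<xi>\<bar> * cmod (F \<xi>) \<partial>lborel)\<^sup>2 \<le> (\<integral>\<xi>. (?a \<xi>)\<^sup>2 \<partial>lborel) * (\<integral>\<xi>. (?b \<xi>)\<^sup>2 \<partial>lborel)"
    using Cauchy_Schwarz_integral[OF am ai bi] unfolding ab .
  also have "\<dots> \<le> (\<integral>\<xi>. (1 + \<xi>\<^sup>2) powr (- (r - d)) \<partial>lborel) * (\<integral>\<xi>. (?b \<xi>)\<^sup>2 \<partial>lborel)"
    by (intro mult_right_mono integral_mono ai wi a2) simp
  finally show "(\<integral>\<xi>. \<bar>k \<xi>\<bar> * cmod (F \<xi>) \<partial>lborel)\<^sup>2 \<le> (\<integral>\<xi>. (1 + \<xi>\<^sup>2) powr (- (r - d)) \<partial>lborel) * (\<integral>\<xi>. (1 + \<xi>\<^sup>2) powr r * (cmod (F \<xi>))\<^sup>2 \<partial>lborel)"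
    unfolding b2 .
qed

lemma Hs_rep_L1:
  assumes "Hs_rep r f F" "r > 1 / 2"
  shows "integrable lborel F" "(\<integral>\<xi>. cmod (F \<xi>) \<partial>lborel)\<^sup>2 \<le> (\<integral>\<xi>. (1 + \<xi>\<^sup>2) powr (- r) \<partial>lborel) * (\<integral>\<xi>. (1 + \<xi>\<^sup>2) powr r * (cmod (F \<xi>))\<^sup>2 \<partial>lborel)"
proof -
  have r: "0 \<le> r" using assms(2) by simp
  note H = Hs_repD[OF assms(1) r]
  have k: "1\<^sup>2 \<le> (1 + \<xi>\<^sup>2) powr 0" for \<xi> :: real using add_pos_nonneg[of 1 "\<xi>\<^sup>2"] by simp
  have d: "r - 0 > 1 / 2" using assms(2) by simp
  note W = weighted_L1_bound[OF H(1) borel_measurable_const H(2) k d]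
  show "integrable lborel F" using W(1) H(1) integrable_norm_iff[of F lborel] by simp
  show "(\<integral>\<xi>. cmod (F \<xi>) \<partial>lborel)\<^sup>2 \<le> (\<integral>\<xi>. (1 + \<xi>\<^sup>2) powr (- r) \<partial>lborel) * (\<integral>\<xi>. (1 + \<xi>\<^sup>2) powr r * (cmod (F \<xi>))\<^sup>2 \<partial>lborel)"
    using W(2) by simp
qed

lemma Hs_rep_xi_L1:
  assumes "Hs_rep r f F" "r > 3 / 2"
  shows "integrable lborel (\<lambda>\<xi>. \<bar>\<xi>\<bar> * cmod (F \<xi>))" "(\<integral>\<xi>. \<bar>\<xi>\<bar> * cmod (F \<xi>) \<partial>lborel)\<^sup>2 \<le> (\<integral>\<xi>. (1 + \<xi>\<^sup>2) powr (- (r - 1)) \<partial>lborel) * (\<integral>\<xi>. (1 + \<xi>\<^sup>2) powr r * (cmod (F \<xi>))\<^sup>2 \<partial>lborel)"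
proof -
  have r: "0 \<le> r" using assms(2) by simp
  note H = Hs_repD[OF assms(1) r]
  have k: "\<xi>\<^sup>2 \<le> (1 + \<xi>\<^sup>2) powr 1" for \<xi> :: real using add_pos_nonneg[of 1 "\<xi>\<^sup>2"] by simp
  have d: "r - 1 > 1 / 2" using assms(2) by simp
  have m: "(\<lambda>\<xi>::real. \<xi>) \<in> borel_measurable borel" by simp
  note W = weighted_L1_bound[OF H(1) m H(2) k d]
  show "integrable lborel (\<lambda>\<xi>. \<bar>\<xi>\<bar> * cmod (F \<xi>))" by (rule W(1))
  show "(\<integral>\<xi>. \<bar>\<xi>\<bar> * cmod (F \<xi>) \<partial>lborel)\<^sup>2 \<le> (\<integral>\<xi>. (1 + \<xi>\<^sup>2) powr (- (r - 1)) \<partial>lborel) * (\<integral>\<xi>. (1 + \<xi>\<^sup>2) powr r * (cmod (F \<xi>))\<^sup>2 \<partial>lborel)"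
    by (rule W(2))
qed

lemma integrable_complex_mult_of_square:
  fixes a b :: "real \<Rightarrow> complex"
  assumes [measurable]: "a \<in> borel_measurable borel" "b \<in> borel_measurable borel"
    and "integrable lborel (\<lambda>x. (cmod (a x))\<^sup>2)" "integrable lborel (\<lambda>x. (cmod (b x))\<^sup>2)"
  shows "integrable lborel (\<lambda>x. a x * b x)"
proof -
  have "integrable lborel (\<lambda>x. cmod (a x) * cmod (b x))" by (rule integrable_mult_of_square) (use assms in auto)
  then have "integrable lborel (\<lambda>x. norm (a x * b x))" by (simp only: norm_mult)
  then show ?thesis by (subst (asm) integrable_norm_iff) measurable
qed

text \<open>F is given only weakly. Testing with \<open>bump (\<xi> / N) * cis (y * \<xi>)\<close>
  produces a truncated inversion integral on the side of F and, on the side of f, a kernel that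
  concentrates at y as N grows.\<close>

lemma sampling_identity:
  assumes H: "Hs_rep r f F" "0 \<le> r" and [measurable]: "f \<in> borel_measurable borel" and f2: "integrable lborel (\<lambda>x. (f x)\<^sup>2)"
    and N: "0 < N"
  shows "(\<integral>x. complex_of_real (f x) * (N * fourier bump (N * (x - y))) \<partial>lborel)
     = (\<integral>\<xi>. F \<xi> * (complex_of_real (bump (\<xi> / N)) * cis (y * \<xi>)) \<partial>lborel)"
proof -
  note D = Hs_repD[OF H]
  note [measurable] = D(1)
  define pc where "pc \<xi> = bump (\<xi> / N) * (1 * cos (y * \<xi>) + 0 * sin (y * \<xi>))" for \<xi>
  define ps where "ps \<xi> = bump (\<xi> / N) * (0 * cos (y * \<xi>) + 1 * sin (y * \<xi>))" for \<xi>
  have t: "test_fun pc" "test_fun ps" unfolding pc_def ps_def by (rule test_fun_modulated_bump[OF N])+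
  note C = test_fun_props[OF t(1)] fourier_integrable[OF t(1)] fourier_measurable[OF test_fun_props(2)[OF t(1)]]
    and S = test_fun_props[OF t(2)] fourier_integrable[OF t(2)] fourier_measurable[OF test_fun_props(2)[OF t(2)]]
  have e: "complex_of_real (pc \<xi>) + \<i> * complex_of_real (ps \<xi>) = complex_of_real (bump (\<xi> / N)) * cis (y * \<xi>)" for \<xi>
    by (simp add: pc_def ps_def complex_eq_iff)
  have tr: "fourier pc x + \<i> * fourier ps x = N * fourier bump (N * (x - y))" for x
  proof -
    have "fourier pc x + \<i> * fourier ps x = (\<integral>\<xi>. complex_of_real (pc \<xi>) * cis (- (\<xi> * x)) + \<i> * (complex_of_real (ps \<xi>) * cis (- (\<xi> * x))) \<partial>lborel)"
      unfolding fourier_def using integrable_complex_cis[OF C(3)] integrable_complex_cis[OF S(3)] by simp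
    also have "\<dots> = (\<integral>\<xi>. complex_of_real (bump (\<xi> / N)) * cis (- (\<xi> / N * (N * (x - y)))) \<partial>lborel)"
    proof (rule Bochner_Integration.integral_cong[OF refl])
      fix \<xi>
      have "complex_of_real (pc \<xi>) * cis (- (\<xi> * x)) + \<i> * (complex_of_real (ps \<xi>) * cis (- (\<xi> * x)))
         = (complex_of_real (pc \<xi>) + \<i> * complex_of_real (ps \<xi>)) * cis (- (\<xi> * x))" by (simp add: algebra_simps)
      also have "\<dots> = complex_of_real (bump (\<xi> / N)) * (cis (y * \<xi>) * cis (- (\<xi> * x)))" unfolding e by (simp only: mult.assoc)
      also have "cis (y * \<xi>) * cis (- (\<xi> * x)) = cis (- (\<xi> / N * (N * (x - y))))"
        using N by (simp add: cis_mult algebra_simps)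
      finally show "complex_of_real (pc \<xi>) * cis (- (\<xi> * x)) + \<i> * (complex_of_real (ps \<xi>) * cis (- (\<xi> * x)))
         = complex_of_real (bump (\<xi> / N)) * cis (- (\<xi> / N * (N * (x - y))))" .
    qed
    also have "\<dots> = \<bar>N\<bar> *\<^sub>R (\<integral>\<eta>. complex_of_real (bump ((0 + N * \<eta>) / N)) * cis (- ((0 + N * \<eta>) / N * (N * (x - y)))) \<partial>lborel)"
      by (rule lborel_integral_real_affine) (use N in simp)
    also have "\<dots> = N * fourier bump (N * (x - y))"
      using N unfolding fourier_def by (simp add: scaleR_conv_of_real)
    finally show ?thesis .
  qed
  have f2': "integrable lborel (\<lambda>x. (cmod (complex_of_real (f x)))\<^sup>2)" using f2 by simp
  have fm: "(\<lambda>x. complex_of_real (f x)) \<in> borel_measurable borel" by measurable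
  have pm: "(\<lambda>x. complex_of_real (pc x)) \<in> borel_measurable borel" "(\<lambda>x. complex_of_real (ps x)) \<in> borel_measurable borel"
    using C(2) S(2) by measurable
  have i: "integrable lborel (\<lambda>x. complex_of_real (f x) * fourier pc x)" "integrable lborel (\<lambda>x. complex_of_real (f x) * fourier ps x)"
    by (rule integrable_complex_mult_of_square[OF fm C(7) f2' C(6)] integrable_complex_mult_of_square[OF fm S(7) f2' S(6)])+
  have pi: "integrable lborel (\<lambda>x. (cmod (complex_of_real (pc x)))\<^sup>2)" "integrable lborel (\<lambda>x. (cmod (complex_of_real (ps x)))\<^sup>2)"
    using C(4) S(4) by simp_all
  have j: "integrable lborel (\<lambda>\<xi>. F \<xi> * complex_of_real (pc \<xi>))" "integrable lborel (\<lambda>\<xi>. F \<xi> * complex_of_real (ps \<xi>))"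
    by (rule integrable_complex_mult_of_square[OF D(1) pm(1) D(4) pi(1)] integrable_complex_mult_of_square[OF D(1) pm(2) D(4) pi(2)])+
  have "(\<integral>x. complex_of_real (f x) * (N * fourier bump (N * (x - y))) \<partial>lborel)
     = (\<integral>x. complex_of_real (f x) * fourier pc x + \<i> * (complex_of_real (f x) * fourier ps x) \<partial>lborel)"
    unfolding tr[symmetric] by (rule Bochner_Integration.integral_cong) (simp_all add: algebra_simps)
  also have "\<dots> = (\<integral>x. complex_of_real (f x) * fourier pc x \<partial>lborel) + \<i> * (\<integral>x. complex_of_real (f x) * fourier ps x \<partial>lborel)"
    using i by simp
  also have "\<dots> = (\<integral>\<xi>. F \<xi> * complex_of_real (pc \<xi>) \<partial>lborel) + \<i> * (\<integral>\<xi>. F \<xi> * complex_of_real (ps \<xi>) \<partial>lborel)"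
    unfolding D(3)[OF t(1)] D(3)[OF t(2)] ..
  also have "\<dots> = (\<integral>\<xi>. F \<xi> * complex_of_real (pc \<xi>) + \<i> * (F \<xi> * complex_of_real (ps \<xi>)) \<partial>lborel)"
    using j by simp
  also have "\<dots> = (\<integral>\<xi>. F \<xi> * (complex_of_real (bump (\<xi> / N)) * cis (y * \<xi>)) \<partial>lborel)"
    unfolding e[symmetric] by (rule Bochner_Integration.integral_cong) (simp_all add: algebra_simps)
  finally show ?thesis .
qed

lemma test_fun_bump: "test_fun bump"
  using test_fun_modulated_bump[of 1 1 0 0] by simp

text \<open>The kernel has mass 2 pi by \<open>integral_fourier\<close> and
  \<open>bump 0 = 1\<close>. As f is only assumed continuous and square integrable, it may be
  unbounded: near y domination applies, and far from y the quadratic decay of the kernel is paired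
  with the L^2 norm.\<close>

lemma approximate_identity:
  assumes f: "continuous_on UNIV f" and f2: "integrable lborel (\<lambda>x. (f x)\<^sup>2)"
  shows "(\<lambda>n. \<integral>x. complex_of_real (f x) * (real (Suc n) * fourier bump (real (Suc n) * (x - y))) \<partial>lborel) \<longlonglongrightarrow> complex_of_real (2 * pi * f y)"
proof -
  define N where "N n = real (Suc n)" for n
  have N: "0 < N n" "1 \<le> N n" for n by (simp_all add: N_def)
  have Ninv: "(\<lambda>n. x / N n) \<longlonglongrightarrow> 0" for x
    using tendsto_mult_left[OF LIMSEQ_Suc[OF lim_1_over_n], of x] by (simp add: N_def)
  have fm[measurable]: "f \<in> borel_measurable borel" using f by (rule borel_measurable_continuous_onI)
  define K where "K = fourier bump"
  have [measurable]: "K \<in> borel_measurable borel" unfolding K_def by (rule fourier_measurable[OF test_fun_props(2)[OF test_fun_bump]])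
  have Ki: "integrable lborel K" "integrable lborel (\<lambda>x. (cmod (K x))\<^sup>2)" unfolding K_def by (rule fourier_integrable[OF test_fun_bump])+
  obtain C where C: "0 \<le> C" "\<And>x. cmod (K x) \<le> C / (1 + x\<^sup>2)" unfolding K_def using fourier_decay[OF test_fun_bump] by metis
  let ?ind = "\<lambda>x. indicat_real {y - 1..y + 1} x"
  define f1 where "f1 x = ?ind x * f x" for x
  define f2 where "f2 x = (1 - ?ind x) * f x" for x
  have [measurable]: "f1 \<in> borel_measurable borel" "f2 \<in> borel_measurable borel" unfolding f1_def f2_def by measurable
  have f12: "f x = f1 x + f2 x" for x by (simp add: f1_def f2_def algebra_simps)
  have sq: "integrable lborel (\<lambda>x. (f1 x)\<^sup>2)" "integrable lborel (\<lambda>x. (f2 x)\<^sup>2)"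
    unfolding f1_def f2_def by (rule integrable_square_bounded_mult[OF _ _ assms(2), of _ 1]; auto split: split_indicator)+
  have KN: "integrable lborel (\<lambda>x. (cmod (N n * K (N n * (x - y))))\<^sup>2)" for n
  proof -
    have "integrable lborel (\<lambda>x. (cmod (K (- N n * y + N n * x)))\<^sup>2)"
      by (rule lborel_integrable_real_affine[OF Ki(2)]) (use N(1)[of n] in simp)
    then have "integrable lborel (\<lambda>x. (N n)\<^sup>2 * (cmod (K (- N n * y + N n * x)))\<^sup>2)" by (rule integrable_mult_right)
    moreover have "- N n * y + N n * x = N n * (x - y)" for x by (simp add: algebra_simps)
    ultimately show ?thesis by (simp add: norm_mult power_mult_distrib)
  qed
  have i: "integrable lborel (\<lambda>x. complex_of_real (g x) * (N n * K (N n * (x - y))))"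
    if "g \<in> borel_measurable borel" "integrable lborel (\<lambda>x. (g x)\<^sup>2)" for g n
    by (rule integrable_complex_mult_of_square) (use that KN in auto)
  have l2: "(\<lambda>n. \<integral>x. complex_of_real (f2 x) * (N n * K (N n * (x - y))) \<partial>lborel) \<longlonglongrightarrow> 0"
  proof (rule Lim_null_comparison)
    \<comment> \<open>A fixed square-integrable weight that carries the decay of the kernel on the
      far part, up to a factor 1/N.\<close>
    define q where "q x = 1 / (1 + (x - y)\<^sup>2)" for x
    have q01: "0 \<le> q x" "q x \<le> 1" for x unfolding q_def using add_pos_nonneg[of 1 "(x - y)\<^sup>2"] by simp_all
    have qm[measurable]: "q \<in> borel_measurable borel" unfolding q_def by measurable
    have qi: "integrable lborel q"
      using lborel_integrable_real_affine[OF integrable_inverse_quadratic, of 1 "- y"] unfolding q_def by (simp add: add.commute)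
    have q2i: "integrable lborel (\<lambda>x. (q x)\<^sup>2)"
      unfolding power2_eq_square by (rule integrable_bounded_mult[OF _ qi, of _ 1]) (use q01 in auto)
    have fqi: "integrable lborel (\<lambda>x. \<bar>f2 x\<bar> * q x)" by (rule integrable_mult_of_square) (use sq q2i in auto)
    let ?J = "\<integral>x. \<bar>f2 x\<bar> * q x \<partial>lborel"
    show "(\<lambda>n. 2 * C * ?J / N n) \<longlonglongrightarrow> 0" by (rule Ninv)
    show "\<forall>\<^sub>F n in sequentially. norm (\<integral>x. complex_of_real (f2 x) * (N n * K (N n * (x - y))) \<partial>lborel) \<le> 2 * C * ?J / N n"
    proof (rule always_eventually, rule allI)
      fix n
      have pw: "norm (complex_of_real (f2 x) * (N n * K (N n * (x - y)))) \<le> 2 * C / N n * (\<bar>f2 x\<bar> * q x)" for x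
      proof (cases "x \<in> {y - 1..y + 1}")
        case True
        then have "f2 x = 0" by (simp add: f2_def)
        then show ?thesis by simp
      next
        case False
        then have "1 \<le> \<bar>x - y\<bar>" by auto
        then have d1: "1 \<le> (x - y)\<^sup>2" using power_mono[of 1 "\<bar>x - y\<bar>" 2] by simp
        have d0: "0 < 1 + (x - y)\<^sup>2" "0 < 1 + (N n * (x - y))\<^sup>2" by (auto simp: add_pos_nonneg)
        have "cmod (K (N n * (x - y))) \<le> C / (1 + (N n * (x - y))\<^sup>2)" by (rule C(2))
        \<comment> \<open>Away from y one has 1 + (x - y)^2 \<le> 2 (x - y)^2. Of the two powers of
          N gained here, one is used up by the factor N of the kernel and the other gives the
          decay.\<close>
        also have "\<dots> \<le> C / ((N n)\<^sup>2 * (1 + (x - y)\<^sup>2) / 2)"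
        proof (rule divide_left_mono)
          have "(N n)\<^sup>2 * (1 + (x - y)\<^sup>2) \<le> (N n)\<^sup>2 * (2 * (x - y)\<^sup>2)" using d1 by (intro mult_left_mono) auto
          then show "(N n)\<^sup>2 * (1 + (x - y)\<^sup>2) / 2 \<le> 1 + (N n * (x - y))\<^sup>2" by (simp add: power_mult_distrib)
        qed (use C(1) d0 N(1)[of n] in auto)
        also have "\<dots> = 2 * C / (N n)\<^sup>2 * q x" by (simp add: q_def)
        finally have "\<bar>f2 x\<bar> * (N n * cmod (K (N n * (x - y)))) \<le> \<bar>f2 x\<bar> * (N n * (2 * C / (N n)\<^sup>2 * q x))"
          using N(1)[of n] by (intro mult_left_mono) auto
        also have "\<dots> = 2 * C / N n * (\<bar>f2 x\<bar> * q x)" using N(1)[of n] by (simp add: power2_eq_square)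
        finally show ?thesis using N(1)[of n] by (simp add: norm_mult)
      qed
      have "norm (\<integral>x. complex_of_real (f2 x) * (N n * K (N n * (x - y))) \<partial>lborel) \<le> (\<integral>x. 2 * C / N n * (\<bar>f2 x\<bar> * q x) \<partial>lborel)"
        by (rule Bochner_Integration.integral_norm_bound_integral[OF i _ pw]) (use sq fqi in \<open>auto intro: integrable_mult_right\<close>)
      then show "norm (\<integral>x. complex_of_real (f2 x) * (N n * K (N n * (x - y))) \<partial>lborel) \<le> 2 * C * ?J / N n"
        unfolding integral_mult_right_zero by simp
    qed
  qed
  have l1: "(\<lambda>n. \<integral>x. complex_of_real (f1 x) * (N n * K (N n * (x - y))) \<partial>lborel) \<longlonglongrightarrow> complex_of_real (2 * pi * f y)"
  proof -
    have "compact (f ` {y - 1..y + 1})" by (intro compact_continuous_image continuous_on_subset[OF f]) auto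
    then obtain B where "\<forall>z\<in>f ` {y - 1..y + 1}. norm z \<le> B" using compact_imp_bounded bounded_iff by metis
    then have B: "\<bar>f1 x\<bar> \<le> \<bar>B\<bar>" for x by (cases "x \<in> {y - 1..y + 1}") (force simp: f1_def)+
    have eq: "(\<integral>x. complex_of_real (f1 x) * (N n * K (N n * (x - y))) \<partial>lborel) = (\<integral>z. complex_of_real (f1 (y + z / N n)) * K z \<partial>lborel)" for n
    proof -
      have "(\<integral>x. complex_of_real (f1 x) * (N n * K (N n * (x - y))) \<partial>lborel)
        = \<bar>1 / N n\<bar> *\<^sub>R (\<integral>z. complex_of_real (f1 (y + 1 / N n * z)) * (N n * K (N n * (y + 1 / N n * z - y))) \<partial>lborel)"
        by (rule lborel_integral_real_affine) (use N(1)[of n] in simp)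
      also have "\<dots> = complex_of_real (1 / N n) * (\<integral>z. complex_of_real (f1 (y + 1 / N n * z)) * (N n * K (N n * (y + 1 / N n * z - y))) \<partial>lborel)"
        by (simp only: scaleR_conv_of_real abs_of_pos[OF divide_pos_pos[OF zero_less_one N(1)]])
      also have "\<dots> = (\<integral>z. complex_of_real (1 / N n) * (complex_of_real (f1 (y + 1 / N n * z)) * (N n * K (N n * (y + 1 / N n * z - y)))) \<partial>lborel)"
        by (rule integral_mult_right_zero[symmetric])
      also have "\<dots> = (\<integral>z. complex_of_real (f1 (y + z / N n)) * K z \<partial>lborel)"
        by (rule Bochner_Integration.integral_cong) (use N(1)[of n] in \<open>simp_all\<close>)
      finally show ?thesis .
    qed
    have "(\<lambda>n. \<integral>z. complex_of_real (f1 (y + z / N n)) * K z \<partial>lborel) \<longlonglongrightarrow> (\<integral>z. complex_of_real (f y) * K z \<partial>lborel)"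
    proof (rule integral_dominated_convergence[where w = "\<lambda>z. \<bar>B\<bar> * cmod (K z)"])
      show "AE z in lborel. (\<lambda>n. complex_of_real (f1 (y + z / N n)) * K z) \<longlonglongrightarrow> complex_of_real (f y) * K z"
      proof (rule AE_I2)
        fix z
        have yl: "(\<lambda>n. y + z / N n) \<longlonglongrightarrow> y" using tendsto_add[OF tendsto_const Ninv, of y z] by simp
        have "(\<lambda>n. f (y + z / N n)) \<longlonglongrightarrow> f y"
          using continuous_on_tendsto_compose[OF f yl] by simp
        moreover have "eventually (\<lambda>n. y + z / N n \<in> {y - 1<..<y + 1}) sequentially"
          by (rule topological_tendstoD[OF yl]) auto
        then have "eventually (\<lambda>n. f (y + z / N n) = f1 (y + z / N n)) sequentially"
          by eventually_elim (simp add: f1_def)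
        ultimately have "(\<lambda>n. f1 (y + z / N n)) \<longlonglongrightarrow> f y" by (rule Lim_transform_eventually)
        then show "(\<lambda>n. complex_of_real (f1 (y + z / N n)) * K z) \<longlonglongrightarrow> complex_of_real (f y) * K z"
          by (intro tendsto_intros)
      qed
      show "AE z in lborel. norm (complex_of_real (f1 (y + z / N n)) * K z) \<le> \<bar>B\<bar> * cmod (K z)" for n
        using B by (auto simp: norm_mult intro!: mult_right_mono)
    qed (use Ki in auto)
    also have "(\<integral>z. complex_of_real (f y) * K z \<partial>lborel) = complex_of_real (2 * pi * f y)"
      unfolding integral_mult_right_zero unfolding K_def integral_fourier[OF test_fun_bump] bump_simps by simp
    finally show ?thesis unfolding eq .
  qed
  have "(\<integral>x. complex_of_real (f x) * (N n * K (N n * (x - y))) \<partial>lborel)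
    = (\<integral>x. complex_of_real (f1 x) * (N n * K (N n * (x - y))) \<partial>lborel) + (\<integral>x. complex_of_real (f2 x) * (N n * K (N n * (x - y))) \<partial>lborel)" for n
    unfolding f12 of_real_add distrib_right by (rule Bochner_Integration.integral_add[OF i i]) (use sq in auto)
  then show ?thesis using tendsto_add[OF l1 l2] unfolding N_def K_def by simp
qed

text \<open>Both sides are limits of \<open>sampling_identity\<close>: the kernel side tends to the
  value of f, the cutoff side to the full integral because \<open>r > 1 / 2\<close> makes F
  integrable.\<close>

lemma Hs_inversion:
  assumes H: "Hs_rep r f F" and r: "r > 1 / 2" and f: "continuous_on UNIV f" and f2: "integrable lborel (\<lambda>x. (f x)\<^sup>2)"
  shows "complex_of_real (2 * pi * f y) = (\<integral>\<xi>. F \<xi> * cis (y * \<xi>) \<partial>lborel)"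
proof (rule LIMSEQ_unique[OF approximate_identity[OF f f2]])
  have r0: "0 \<le> r" using r by simp
  have fm: "f \<in> borel_measurable borel" using f by (rule borel_measurable_continuous_onI)
  note Fi = Hs_rep_L1(1)[OF H r]
  have [measurable]: "F \<in> borel_measurable borel" by (rule Hs_repD(1)[OF H r0])
  have [measurable]: "bump \<in> borel_measurable borel" by (rule test_fun_props(2)[OF test_fun_bump])
  obtain B where B: "\<And>x. \<bar>bump x\<bar> \<le> B" using test_fun_bounded[OF test_fun_bump] by metis
  define N where "N n = real (Suc n)" for n
  have N: "0 < N n" for n by (simp add: N_def)
  have Ninv: "(\<lambda>n. x / N n) \<longlonglongrightarrow> 0" for x
    using tendsto_mult_left[OF LIMSEQ_Suc[OF lim_1_over_n], of x] by (simp add: N_def)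
  have "(\<lambda>n. \<integral>\<xi>. F \<xi> * (complex_of_real (bump (\<xi> / N n)) * cis (y * \<xi>)) \<partial>lborel) \<longlonglongrightarrow> (\<integral>\<xi>. F \<xi> * cis (y * \<xi>) \<partial>lborel)"
  proof (rule integral_dominated_convergence[where w = "\<lambda>\<xi>. B * cmod (F \<xi>)"])
    show "AE \<xi> in lborel. (\<lambda>n. F \<xi> * (complex_of_real (bump (\<xi> / N n)) * cis (y * \<xi>))) \<longlonglongrightarrow> F \<xi> * cis (y * \<xi>)"
    proof (rule AE_I2)
      fix \<xi>
      have "(\<lambda>n. bump (\<xi> / N n)) \<longlonglongrightarrow> bump 0"
        using continuous_on_tendsto_compose[OF test_fun_props(1)[OF test_fun_bump] Ninv] by simp
      then have "(\<lambda>n. F \<xi> * (complex_of_real (bump (\<xi> / N n)) * cis (y * \<xi>))) \<longlonglongrightarrow> F \<xi> * (complex_of_real (bump 0) * cis (y * \<xi>))"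
        by (intro tendsto_intros)
      then show "(\<lambda>n. F \<xi> * (complex_of_real (bump (\<xi> / N n)) * cis (y * \<xi>))) \<longlonglongrightarrow> F \<xi> * cis (y * \<xi>)"
        by (simp add: bump_simps)
    qed
    show "AE \<xi> in lborel. norm (F \<xi> * (complex_of_real (bump (\<xi> / N n)) * cis (y * \<xi>))) \<le> B * cmod (F \<xi>)" for n
      using B by (auto simp: norm_mult mult.commute[of "cmod (F _)"] intro!: mult_right_mono)
  qed (use Fi in auto)
  then show "(\<lambda>n. \<integral>x. complex_of_real (f x) * (real (Suc n) * fourier bump (real (Suc n) * (x - y))) \<partial>lborel) \<longlonglongrightarrow> (\<integral>\<xi>. F \<xi> * cis (y * \<xi>) \<partial>lborel)"
    using sampling_identity[OF H r0 fm f2 N] unfolding N_def by (simp only:)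
qed

text \<open>A chord of the unit circle is no longer than its arc, via the half-angle
  formula.\<close>

lemma cis_lipschitz: "cmod (cis a - cis b) \<le> \<bar>a - b\<bar>"
proof -
  have "cmod (cis a - cis b) = cmod (cis (a - b) - 1)"
  proof -
    have "cis a - cis b = cis b * (cis (a - b) - 1)" by (simp add: right_diff_distrib cis_mult)
    then show ?thesis by (simp add: norm_mult)
  qed
  also have "\<dots> = 2 * \<bar>sin ((a - b) / 2)\<bar>"
  proof -
    let ?t = "(a - b) / 2"
    have t: "2 * ?t = a - b" by simp
    have c: "cos (a - b) = 1 - 2 * (sin ?t)\<^sup>2" using cos_double_sin[of ?t] unfolding t .
    have "(cmod (cis (a - b) - 1))\<^sup>2 = (cos (a - b) - 1)\<^sup>2 + (sin (a - b))\<^sup>2" by (simp add: cmod_power2)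
    also have "\<dots> = 2 - 2 * cos (a - b)" using sin_cos_squared_add[of "a - b"] by (simp add: power2_diff)
    also have "\<dots> = (2 * \<bar>sin ?t\<bar>)\<^sup>2" unfolding c by (simp add: power_mult_distrib)
    finally show ?thesis by (rule power2_eq_imp_eq) auto
  qed
  also have "\<dots> \<le> 2 * \<bar>(a - b) / 2\<bar>" by (intro mult_left_mono abs_sin_x_le_abs_x) simp
  finally show ?thesis by simp
qed

text \<open>Difference quotients of the inversion formula, dominated by |\<xi>| |F|, which is
  integrable since \<open>r > 3 / 2\<close>.\<close>

lemma Hs_inversion_deriv:
  assumes H: "Hs_rep r f F" and r: "r > 3 / 2" and d: "\<And>x. f differentiable (at x)" and f2: "integrable lborel (\<lambda>x. (f x)\<^sup>2)"
  shows "complex_of_real (2 * pi * deriv f y) = (\<integral>\<xi>. F \<xi> * (\<i> * \<xi> * cis (y * \<xi>)) \<partial>lborel)"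
proof (rule LIMSEQ_unique)
  have r0: "0 \<le> r" "r > 1 / 2" using r by simp_all
  have fd: "(f has_real_derivative deriv f x) (at x)" for x using d by (simp add: DERIV_deriv_iff_real_differentiable)
  note fc = DERIV_everywhere_continuous[OF fd]
  have Fm[measurable]: "F \<in> borel_measurable borel" by (rule Hs_repD(1)[OF H r0(1)])
  note F1 = Hs_rep_L1(1)[OF H r0(2)] and Fx = Hs_rep_xi_L1(1)[OF H r]
  note inv = Hs_inversion[OF H r0(2) fc f2]
  define \<epsilon> where "\<epsilon> n = 1 / real (Suc n)" for n
  have e: "0 < \<epsilon> n" for n by (simp add: \<epsilon>_def)
  let ?q = "\<lambda>n \<xi>. (cis ((y + \<epsilon> n) * \<xi>) - cis (y * \<xi>)) / \<epsilon> n"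
  have Fc: "integrable lborel (\<lambda>\<xi>. F \<xi> * cis (z * \<xi>))" for z
    by (rule Bochner_Integration.integrable_bound[OF F1]) (auto simp: norm_mult)
  have eq: "complex_of_real (2 * pi * diffq (\<epsilon> n) f y) = (\<integral>\<xi>. F \<xi> * ?q n \<xi> \<partial>lborel)" for n
  proof -
    have "complex_of_real (2 * pi * diffq (\<epsilon> n) f y) = (complex_of_real (2 * pi * f (y + \<epsilon> n)) - complex_of_real (2 * pi * f y)) / \<epsilon> n"
      by (simp add: diffq_def right_diff_distrib)
    also have "\<dots> = (\<integral>\<xi>. F \<xi> * cis ((y + \<epsilon> n) * \<xi>) - F \<xi> * cis (y * \<xi>) \<partial>lborel) / \<epsilon> n"
      unfolding inv using Bochner_Integration.integral_diff[OF Fc Fc] by simp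
    also have "\<dots> = (\<integral>\<xi>. (F \<xi> * cis ((y + \<epsilon> n) * \<xi>) - F \<xi> * cis (y * \<xi>)) / \<epsilon> n \<partial>lborel)"
      by (rule integral_divide_zero[symmetric])
    finally show ?thesis by (simp add: right_diff_distrib)
  qed
  show "(\<lambda>n. \<integral>\<xi>. F \<xi> * ?q n \<xi> \<partial>lborel) \<longlonglongrightarrow> complex_of_real (2 * pi * deriv f y)"
  proof -
    have "(\<lambda>n. complex_of_real (2 * pi * diffq (\<epsilon> n) f y)) \<longlonglongrightarrow> complex_of_real (2 * pi * deriv f y)"
      unfolding \<epsilon>_def by (intro tendsto_of_real tendsto_mult_left diffq_tendsto fd)
    then show ?thesis by (simp only: eq)
  qed
  show "(\<lambda>n. \<integral>\<xi>. F \<xi> * ?q n \<xi> \<partial>lborel) \<longlonglongrightarrow> (\<integral>\<xi>. F \<xi> * (\<i> * \<xi> * cis (y * \<xi>)) \<partial>lborel)"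
  proof (rule integral_dominated_convergence[where w = "\<lambda>\<xi>. \<bar>\<xi>\<bar> * cmod (F \<xi>)"])
    show "AE \<xi> in lborel. (\<lambda>n. F \<xi> * ?q n \<xi>) \<longlonglongrightarrow> F \<xi> * (\<i> * \<xi> * cis (y * \<xi>))"
    proof (intro AE_I2 tendsto_mult_left)
      fix \<xi> :: real
      \<comment> \<open>\<open>diffq\<close> takes real functions, so the wave is differentiated
        through its real and imaginary parts.\<close>
      have "((\<lambda>t. cos (t * \<xi>)) has_real_derivative - \<xi> * sin (y * \<xi>)) (at y)" "((\<lambda>t. sin (t * \<xi>)) has_real_derivative \<xi> * cos (y * \<xi>)) (at y)"
        by (auto intro!: derivative_eq_intros)
      then have "(\<lambda>n. complex_of_real (diffq (\<epsilon> n) (\<lambda>t. cos (t * \<xi>)) y) + \<i> * complex_of_real (diffq (\<epsilon> n) (\<lambda>t. sin (t * \<xi>)) y))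
         \<longlonglongrightarrow> complex_of_real (- \<xi> * sin (y * \<xi>)) + \<i> * complex_of_real (\<xi> * cos (y * \<xi>))"
        unfolding \<epsilon>_def by (intro tendsto_intros diffq_tendsto)
      moreover have "complex_of_real (diffq (\<epsilon> n) (\<lambda>t. cos (t * \<xi>)) y) + \<i> * complex_of_real (diffq (\<epsilon> n) (\<lambda>t. sin (t * \<xi>)) y) = ?q n \<xi>" for n
        by (simp add: complex_eq_iff diffq_def)
      moreover have "complex_of_real (- \<xi> * sin (y * \<xi>)) + \<i> * complex_of_real (\<xi> * cos (y * \<xi>)) = \<i> * \<xi> * cis (y * \<xi>)"
        by (simp add: complex_eq_iff)
      ultimately show "(\<lambda>n. ?q n \<xi>) \<longlonglongrightarrow> \<i> * \<xi> * cis (y * \<xi>)" by (simp only:)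
    qed
    show "AE \<xi> in lborel. norm (F \<xi> * ?q n \<xi>) \<le> \<bar>\<xi>\<bar> * cmod (F \<xi>)" for n
    proof (rule AE_I2)
      fix \<xi>
      have "cmod (cis ((y + \<epsilon> n) * \<xi>) - cis (y * \<xi>)) \<le> \<epsilon> n * \<bar>\<xi>\<bar>"
        using cis_lipschitz[of "(y + \<epsilon> n) * \<xi>" "y * \<xi>"] e[of n] by (simp add: distrib_right abs_mult)
      then have "cmod (?q n \<xi>) \<le> \<bar>\<xi>\<bar>" using e[of n] by (simp add: norm_divide divide_le_eq mult.commute)
      then have "cmod (F \<xi>) * cmod (?q n \<xi>) \<le> cmod (F \<xi>) * \<bar>\<xi>\<bar>" by (intro mult_left_mono) auto
      then show "norm (F \<xi> * ?q n \<xi>) \<le> \<bar>\<xi>\<bar> * cmod (F \<xi>)" by (simp only: norm_mult mult.commute)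
    qed
  qed (use Fx in auto)
qed

text \<open>Difference quotients, because for \<open>r = 1\<close> the function \<open>\<xi> F(\<xi>)\<close> need not be integrable.\<close>
lemma Hs_energy_le:
  assumes H: "Hs_rep r f F" and r: "1 \<le> r" and d: "\<And>x. f differentiable (at x)" and f2: "integrable lborel (\<lambda>x. (f x)\<^sup>2)"
  shows "integrable lborel (\<lambda>x. (deriv f x)\<^sup>2)"
    "(\<integral>x. (f x)\<^sup>2 \<partial>lborel) + (\<integral>x. (deriv f x)\<^sup>2 \<partial>lborel) \<le> (\<integral>\<xi>. (1 + \<xi>\<^sup>2) powr r * (cmod (F \<xi>))\<^sup>2 \<partial>lborel) / (2 * pi)"
proof -
  have r0: "0 \<le> r" "r > 1 / 2" using r by simp_all
  have fd: "(f has_real_derivative deriv f x) (at x)" for x using d by (simp add: DERIV_deriv_iff_real_differentiable)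
  note fc = DERIV_everywhere_continuous[OF fd]
  have fm[measurable]: "f \<in> borel_measurable borel" using fc by (rule borel_measurable_continuous_onI)
  note D = Hs_repD[OF H r0(1)]
  note [measurable] = D(1)
  note F1 = Hs_rep_L1(1)[OF H r0(2)]
  note inv = Hs_inversion[OF H r0(2) fc f2]
  have Fc: "integrable lborel (\<lambda>\<xi>. F \<xi> * cis (z * \<xi>))" for z
    by (rule Bochner_Integration.integrable_bound[OF F1]) (auto simp: norm_mult)
  define \<epsilon> where "\<epsilon> n = 1 / real (Suc n)" for n
  have e: "0 < \<epsilon> n" for n by (simp add: \<epsilon>_def)
  have dm: "diffq (\<epsilon> n) f \<in> borel_measurable borel" for n using fm by (rule diffq_measurable)
  have derm: "deriv f \<in> borel_measurable borel"
    by (rule borel_measurable_LIMSEQ_real[where u = "\<lambda>n. diffq (1 / real (Suc n)) f"]) (use diffq_tendsto[OF fd] fm in auto)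
  define W where "W = (\<integral>\<xi>. (1 + \<xi>\<^sup>2) powr r * (cmod (F \<xi>))\<^sup>2 \<partial>lborel)"
  have sq: "(cmod (complex_of_real (2 * pi * t)))\<^sup>2 = 4 * pi\<^sup>2 * t\<^sup>2" for t
    unfolding norm_of_real by (simp add: power_mult_distrib)
  have bound: "(\<integral>x. (f x)\<^sup>2 + (diffq (\<epsilon> n) f x)\<^sup>2 \<partial>lborel) \<le> W / (2 * pi)"
    and di: "integrable lborel (\<lambda>x. (f x)\<^sup>2 + (diffq (\<epsilon> n) f x)\<^sup>2)" for n
  proof -
    define q where "q \<xi> = (cis (\<epsilon> n * \<xi>) - 1) / \<epsilon> n" for \<xi>
    have [measurable]: "q \<in> borel_measurable borel" unfolding q_def by measurable
    have qb: "cmod (q \<xi>) \<le> \<bar>\<xi>\<bar>" for \<xi>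
    proof -
      have "cmod (cis (\<epsilon> n * \<xi>) - 1) \<le> \<epsilon> n * \<bar>\<xi>\<bar>"
        using cis_lipschitz[of "\<epsilon> n * \<xi>" 0] e[of n] by (simp add: abs_mult)
      then show ?thesis using e[of n] by (simp add: q_def norm_divide divide_le_eq mult.commute)
    qed
    have qb2: "cmod (q \<xi>) \<le> 2 / \<epsilon> n" for \<xi>
    proof -
      have "cmod (cis (\<epsilon> n * \<xi>) - 1) \<le> 2" using norm_triangle_ineq4[of "cis (\<epsilon> n * \<xi>)" 1] by simp
      then show ?thesis using e[of n] by (simp add: q_def norm_divide divide_right_mono)
    qed
    \<comment> \<open>The multiplier q of the difference quotient is at most |\<xi>|, so 1 + |q|^2
      is at most 1 + \<xi>^2, and \<open>1 \<le> r\<close> raises the power.\<close>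
    have qq: "(cmod (F \<xi>))\<^sup>2 + (cmod (F \<xi> * q \<xi>))\<^sup>2 \<le> (1 + \<xi>\<^sup>2) powr r * (cmod (F \<xi>))\<^sup>2" for \<xi>
    proof -
      have p1: "1 \<le> 1 + \<xi>\<^sup>2" by simp
      have "(cmod (q \<xi>))\<^sup>2 \<le> \<xi>\<^sup>2" using power_mono[OF qb, of \<xi> 2] by simp
      moreover have "1 + \<xi>\<^sup>2 \<le> (1 + \<xi>\<^sup>2) powr r" using powr_mono[OF r p1] by (simp add: add_pos_nonneg)
      ultimately have "(1 + (cmod (q \<xi>))\<^sup>2) * (cmod (F \<xi>))\<^sup>2 \<le> (1 + \<xi>\<^sup>2) powr r * (cmod (F \<xi>))\<^sup>2"
        by (intro mult_right_mono) auto
      then show ?thesis by (simp add: norm_mult power_mult_distrib algebra_simps)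
    qed
    have H1: "integrable lborel (\<lambda>\<xi>. F \<xi> * q \<xi>)"
    proof (rule Bochner_Integration.integrable_bound)
      show "integrable lborel (\<lambda>\<xi>. 2 / \<epsilon> n * cmod (F \<xi>))" using F1 by simp
      show "AE \<xi> in lborel. norm (F \<xi> * q \<xi>) \<le> norm (2 / \<epsilon> n * cmod (F \<xi>))"
      proof (rule AE_I2)
        fix \<xi>
        have "cmod (q \<xi>) * cmod (F \<xi>) \<le> 2 / \<epsilon> n * cmod (F \<xi>)" by (intro mult_right_mono qb2) simp
        also have "\<dots> \<le> norm (2 / \<epsilon> n * cmod (F \<xi>))" unfolding real_norm_def by (rule abs_ge_self)
        finally show "norm (F \<xi> * q \<xi>) \<le> norm (2 / \<epsilon> n * cmod (F \<xi>))" by (simp only: norm_mult mult.commute)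
      qed
    qed measurable
    have H2: "integrable lborel (\<lambda>\<xi>. (cmod (F \<xi> * q \<xi>))\<^sup>2)"
    proof (rule Bochner_Integration.integrable_bound[OF D(2)])
      show "AE \<xi> in lborel. norm ((cmod (F \<xi> * q \<xi>))\<^sup>2) \<le> norm ((1 + \<xi>\<^sup>2) powr r * (cmod (F \<xi>))\<^sup>2)"
      proof (rule AE_I2)
        fix \<xi>
        have "(cmod (F \<xi> * q \<xi>))\<^sup>2 \<le> (1 + \<xi>\<^sup>2) powr r * (cmod (F \<xi>))\<^sup>2"
          using qq[of \<xi>] zero_le_power2[of "cmod (F \<xi>)"] by linarith
        then show "norm ((cmod (F \<xi> * q \<xi>))\<^sup>2) \<le> norm ((1 + \<xi>\<^sup>2) powr r * (cmod (F \<xi>))\<^sup>2)" by simp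
      qed
    qed measurable
    have h1: "(\<integral>\<xi>. F \<xi> * cis (y * \<xi>) \<partial>lborel) = complex_of_real (2 * pi * f y)" for y by (rule inv[symmetric])
    have h2: "(\<integral>\<xi>. (F \<xi> * q \<xi>) * cis (y * \<xi>) \<partial>lborel) = complex_of_real (2 * pi * diffq (\<epsilon> n) f y)" for y
    proof -
      have "complex_of_real (2 * pi * diffq (\<epsilon> n) f y) = (complex_of_real (2 * pi * f (y + \<epsilon> n)) - complex_of_real (2 * pi * f y)) / \<epsilon> n"
        by (simp add: diffq_def right_diff_distrib)
      also have "\<dots> = (\<integral>\<xi>. F \<xi> * cis ((y + \<epsilon> n) * \<xi>) - F \<xi> * cis (y * \<xi>) \<partial>lborel) / \<epsilon> n"
        unfolding inv using Bochner_Integration.integral_diff[OF Fc Fc] by simp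
      also have "\<dots> = (\<integral>\<xi>. (F \<xi> * cis ((y + \<epsilon> n) * \<xi>) - F \<xi> * cis (y * \<xi>)) / \<epsilon> n \<partial>lborel)"
        by (rule integral_divide_zero[symmetric])
      also have "\<dots> = (\<integral>\<xi>. (F \<xi> * q \<xi>) * cis (y * \<xi>) \<partial>lborel)"
      proof (rule Bochner_Integration.integral_cong[OF refl])
        fix \<xi>
        have "cis ((y + \<epsilon> n) * \<xi>) = cis (\<epsilon> n * \<xi>) * cis (y * \<xi>)" by (simp add: cis_mult algebra_simps)
        then show "(F \<xi> * cis ((y + \<epsilon> n) * \<xi>) - F \<xi> * cis (y * \<xi>)) / \<epsilon> n = (F \<xi> * q \<xi>) * cis (y * \<xi>)"
          unfolding q_def by (simp add: algebra_simps diff_divide_distrib)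
      qed
      finally show ?thesis ..
    qed
    \<comment> \<open>Bessel's inequality for F and for \<open>F * q\<close>, whose inversion
      integrals are 2 pi times f and 2 pi times its difference quotient.\<close>
    note B1 = bessel_inequality[OF F1 D(4), unfolded h1 sq] and B2 = bessel_inequality[OF H1 H2, unfolded h2 sq]
    have d2: "integrable lborel (\<lambda>x. (diffq (\<epsilon> n) f x)\<^sup>2)" using B2(1) by simp
    show "integrable lborel (\<lambda>x. (f x)\<^sup>2 + (diffq (\<epsilon> n) f x)\<^sup>2)" using f2 d2 by (rule Bochner_Integration.integrable_add)
    have "4 * pi\<^sup>2 * ((\<integral>x. (f x)\<^sup>2 \<partial>lborel) + (\<integral>x. (diffq (\<epsilon> n) f x)\<^sup>2 \<partial>lborel))
       \<le> 2 * pi * ((\<integral>\<xi>. (cmod (F \<xi>))\<^sup>2 \<partial>lborel) + (\<integral>\<xi>. (cmod (F \<xi> * q \<xi>))\<^sup>2 \<partial>lborel))"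
      using B1(2) B2(2) unfolding integral_mult_right_zero by (simp only: distrib_left)
    also have "(\<integral>\<xi>. (cmod (F \<xi>))\<^sup>2 \<partial>lborel) + (\<integral>\<xi>. (cmod (F \<xi> * q \<xi>))\<^sup>2 \<partial>lborel) = (\<integral>\<xi>. (cmod (F \<xi>))\<^sup>2 + (cmod (F \<xi> * q \<xi>))\<^sup>2 \<partial>lborel)"
      by (rule Bochner_Integration.integral_add[OF D(4) H2, symmetric])
    also have "2 * pi * \<dots> \<le> 2 * pi * W"
      unfolding W_def by (intro mult_left_mono integral_mono Bochner_Integration.integrable_add D(4) H2 D(2) qq) simp
    finally have "(2 * pi) * ((2 * pi) * ((\<integral>x. (f x)\<^sup>2 \<partial>lborel) + (\<integral>x. (diffq (\<epsilon> n) f x)\<^sup>2 \<partial>lborel))) \<le> (2 * pi) * W"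
      by (simp add: power2_eq_square mult_ac)
    then have "(2 * pi) * ((\<integral>x. (f x)\<^sup>2 \<partial>lborel) + (\<integral>x. (diffq (\<epsilon> n) f x)\<^sup>2 \<partial>lborel)) \<le> W"
      by (rule mult_left_le_imp_le) simp
    then have "(\<integral>x. (f x)\<^sup>2 \<partial>lborel) + (\<integral>x. (diffq (\<epsilon> n) f x)\<^sup>2 \<partial>lborel) \<le> W / (2 * pi)"
      by (simp add: pos_le_divide_eq mult.commute)
    then show "(\<integral>x. (f x)\<^sup>2 + (diffq (\<epsilon> n) f x)\<^sup>2 \<partial>lborel) \<le> W / (2 * pi)"
      using f2 d2 by simp
  qed
  have lim: "(\<lambda>n. (f x)\<^sup>2 + (diffq (\<epsilon> n) f x)\<^sup>2) \<longlonglongrightarrow> (f x)\<^sup>2 + (deriv f x)\<^sup>2" for x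
    unfolding \<epsilon>_def by (intro tendsto_intros diffq_tendsto fd)
  have m1: "(\<lambda>x. (f x)\<^sup>2 + (diffq (\<epsilon> n) f x)\<^sup>2) \<in> borel_measurable lborel" for n using fm dm by measurable
  have m2: "(\<lambda>x. (f x)\<^sup>2 + (deriv f x)\<^sup>2) \<in> borel_measurable lborel" using fm derm by measurable
  note L = integrable_liminf_bound[OF m1 m2 di _ lim bound tendsto_const]
  have Li: "integrable lborel (\<lambda>x. (f x)\<^sup>2 + (deriv f x)\<^sup>2)" by (rule L(1)) simp
  then have "integrable lborel (\<lambda>x. (f x)\<^sup>2 + (deriv f x)\<^sup>2 - (f x)\<^sup>2)" using f2 by (rule Bochner_Integration.integrable_diff)
  then show d2: "integrable lborel (\<lambda>x. (deriv f x)\<^sup>2)" by simp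
  have "(\<integral>x. (f x)\<^sup>2 + (deriv f x)\<^sup>2 \<partial>lborel) \<le> W / (2 * pi)" by (rule L(2)) simp
  then show "(\<integral>x. (f x)\<^sup>2 \<partial>lborel) + (\<integral>x. (deriv f x)\<^sup>2 \<partial>lborel) \<le> (\<integral>\<xi>. (1 + \<xi>\<^sup>2) powr r * (cmod (F \<xi>))\<^sup>2 \<partial>lborel) / (2 * pi)"
    using f2 d2 unfolding W_def by simp
qed

text \<open>Unlike \<open>Hs_energy_le\<close> this reaches down to r > 1/2, the range of
  \<open>s - 1\<close>, where the time derivative lives.\<close>

lemma Hs_L2_le:
  assumes H: "Hs_rep r f F" and r: "r > 1 / 2" and fc: "continuous_on UNIV f" and f2: "integrable lborel (\<lambda>x. (f x)\<^sup>2)"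
  shows "(\<integral>x. (f x)\<^sup>2 \<partial>lborel) \<le> (\<integral>\<xi>. (1 + \<xi>\<^sup>2) powr r * (cmod (F \<xi>))\<^sup>2 \<partial>lborel) / (2 * pi)"
proof -
  have r0: "0 \<le> r" using r by simp
  note D = Hs_repD[OF H r0] and F1 = Hs_rep_L1(1)[OF H r]
  have sq: "(cmod (complex_of_real (2 * pi * t)))\<^sup>2 = 4 * pi\<^sup>2 * t\<^sup>2" for t
    unfolding norm_of_real by (simp add: power_mult_distrib)
  have "4 * pi\<^sup>2 * (\<integral>x. (f x)\<^sup>2 \<partial>lborel) \<le> 2 * pi * (\<integral>\<xi>. (cmod (F \<xi>))\<^sup>2 \<partial>lborel)"
    using bessel_inequality(2)[OF F1 D(4), unfolded Hs_inversion[OF H r fc f2, symmetric] sq integral_mult_right_zero] .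
  also have "\<dots> \<le> 2 * pi * (\<integral>\<xi>. (1 + \<xi>\<^sup>2) powr r * (cmod (F \<xi>))\<^sup>2 \<partial>lborel)"
  proof (intro mult_left_mono integral_mono D(4) D(2))
    show "(cmod (F \<xi>))\<^sup>2 \<le> (1 + \<xi>\<^sup>2) powr r * (cmod (F \<xi>))\<^sup>2" for \<xi> :: real
      using mult_right_mono[OF ge_one_powr_ge_zero[of "1 + \<xi>\<^sup>2" r], of "(cmod (F \<xi>))\<^sup>2"] r0 by simp
  qed simp
  finally have "(2 * pi) * ((2 * pi) * (\<integral>x. (f x)\<^sup>2 \<partial>lborel)) \<le> (2 * pi) * (\<integral>\<xi>. (1 + \<xi>\<^sup>2) powr r * (cmod (F \<xi>))\<^sup>2 \<partial>lborel)"
    by (simp add: power2_eq_square mult_ac)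
  then have "(2 * pi) * (\<integral>x. (f x)\<^sup>2 \<partial>lborel) \<le> (\<integral>\<xi>. (1 + \<xi>\<^sup>2) powr r * (cmod (F \<xi>))\<^sup>2 \<partial>lborel)"
    by (rule mult_left_le_imp_le) simp
  then show ?thesis by (simp add: pos_le_divide_eq mult.commute)
qed

section \<open>Sobolev spaces: norm, inclusion, linearity, equality almost everywhere\<close>

lemma in_HsE:
  assumes "in_Hs r f"
  obtains F where "Hs_rep r f F" "(Hs_norm r f)\<^sup>2 = (\<integral>\<xi>. (1 + \<xi>\<^sup>2) powr r * (cmod (F \<xi>))\<^sup>2 \<partial>lborel) / (2 * pi)"
    "f \<in> borel_measurable borel" "integrable lborel (\<lambda>x. (f x)\<^sup>2)"
proof -
  \<comment> \<open>The witness is the very representative from which \<open>Hs_norm\<close> is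
    computed.\<close>
  have F: "Hs_rep r f (SOME F. Hs_rep r f F)" using assms unfolding in_Hs_def by (metis someI_ex)
  have "0 \<le> (\<integral>\<xi>. (1 + \<xi>\<^sup>2) powr r * (cmod ((SOME F. Hs_rep r f F) \<xi>))\<^sup>2 \<partial>lborel) / (2 * pi)" by simp
  then have "(Hs_norm r f)\<^sup>2 = (\<integral>\<xi>. (1 + \<xi>\<^sup>2) powr r * (cmod ((SOME F. Hs_rep r f F) \<xi>))\<^sup>2 \<partial>lborel) / (2 * pi)"
    unfolding Hs_norm_def by (rule real_sqrt_pow2)
  then show thesis using that[OF F] assms by (simp add: in_Hs_def)
qed

lemma Hs_norm_nonneg: "0 \<le> Hs_norm r f"
  unfolding Hs_norm_def by simp

lemma in_Hs_mono:
  assumes f: "in_Hs r f" and r: "r' \<le> r" "0 \<le> r'"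
  shows "in_Hs r' f"
proof -
  obtain F where F: "Hs_rep r f F" using f unfolding in_Hs_def by blast
  have r0: "0 \<le> r" using r by simp
  note D = Hs_repD[OF F r0]
  have "integrable lborel (\<lambda>\<xi>. (1 + \<xi>\<^sup>2) powr r' * (cmod (F \<xi>))\<^sup>2)"
  proof (rule Bochner_Integration.integrable_bound[OF D(2)])
    show "AE \<xi> in lborel. norm ((1 + \<xi>\<^sup>2) powr r' * (cmod (F \<xi>))\<^sup>2) \<le> norm ((1 + \<xi>\<^sup>2) powr r * (cmod (F \<xi>))\<^sup>2)"
    proof (rule AE_I2)
      fix \<xi> :: real
      have "(1 + \<xi>\<^sup>2) powr r' * (cmod (F \<xi>))\<^sup>2 \<le> (1 + \<xi>\<^sup>2) powr r * (cmod (F \<xi>))\<^sup>2"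
        using r by (intro mult_right_mono powr_mono) auto
      then show "norm ((1 + \<xi>\<^sup>2) powr r' * (cmod (F \<xi>))\<^sup>2) \<le> norm ((1 + \<xi>\<^sup>2) powr r * (cmod (F \<xi>))\<^sup>2)" by simp
    qed
  qed (use D(1) in measurable)
  then have "Hs_rep r' f F" using F unfolding Hs_rep_def by blast
  then show ?thesis using f unfolding in_Hs_def by blast
qed

lemma in_Hs_linear:
  assumes f: "in_Hs r f" and g: "in_Hs r g" and r: "0 \<le> r"
  shows "in_Hs r (\<lambda>x. a * f x + b * g x)"
proof -
  obtain F G where F: "Hs_rep r f F" and G: "Hs_rep r g G" using f g unfolding in_Hs_def by blast
  note D = Hs_repD[OF F r] and E = Hs_repD[OF G r]
  have fm[measurable]: "f \<in> borel_measurable borel" "g \<in> borel_measurable borel" using f g by (simp_all add: in_Hs_def)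
  have f2: "integrable lborel (\<lambda>x. (f x)\<^sup>2)" "integrable lborel (\<lambda>x. (g x)\<^sup>2)" using f g by (simp_all add: in_Hs_def)
  note [measurable] = D(1) E(1)
  let ?H = "\<lambda>\<xi>. a * F \<xi> + b * G \<xi>"
  have "integrable lborel (\<lambda>\<xi>. (1 + \<xi>\<^sup>2) powr r * (cmod (?H \<xi>))\<^sup>2)"
  proof (rule Bochner_Integration.integrable_bound)
    show "integrable lborel (\<lambda>\<xi>. 2 * a\<^sup>2 * ((1 + \<xi>\<^sup>2) powr r * (cmod (F \<xi>))\<^sup>2) + 2 * b\<^sup>2 * ((1 + \<xi>\<^sup>2) powr r * (cmod (G \<xi>))\<^sup>2))"
      using D(2) E(2) by simp
    show "AE \<xi> in lborel. norm ((1 + \<xi>\<^sup>2) powr r * (cmod (?H \<xi>))\<^sup>2) \<le> norm (2 * a\<^sup>2 * ((1 + \<xi>\<^sup>2) powr r * (cmod (F \<xi>))\<^sup>2) + 2 * b\<^sup>2 * ((1 + \<xi>\<^sup>2) powr r * (cmod (G \<xi>))\<^sup>2))"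
    proof (rule AE_I2)
      fix \<xi> :: real
      have "cmod (?H \<xi>) \<le> \<bar>a\<bar> * cmod (F \<xi>) + \<bar>b\<bar> * cmod (G \<xi>)"
        by (rule order_trans[OF norm_triangle_ineq]) (simp add: norm_mult)
      then have "(cmod (?H \<xi>))\<^sup>2 \<le> (\<bar>a\<bar> * cmod (F \<xi>) + \<bar>b\<bar> * cmod (G \<xi>))\<^sup>2" by (intro power_mono) auto
      also have "\<dots> \<le> 2 * (\<bar>a\<bar> * cmod (F \<xi>))\<^sup>2 + 2 * (\<bar>b\<bar> * cmod (G \<xi>))\<^sup>2" by (rule square_add_le)
      finally have "(1 + \<xi>\<^sup>2) powr r * (cmod (?H \<xi>))\<^sup>2 \<le> (1 + \<xi>\<^sup>2) powr r * (2 * (\<bar>a\<bar> * cmod (F \<xi>))\<^sup>2 + 2 * (\<bar>b\<bar> * cmod (G \<xi>))\<^sup>2)"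
        by (intro mult_left_mono) auto
      also have "\<dots> = 2 * a\<^sup>2 * ((1 + \<xi>\<^sup>2) powr r * (cmod (F \<xi>))\<^sup>2) + 2 * b\<^sup>2 * ((1 + \<xi>\<^sup>2) powr r * (cmod (G \<xi>))\<^sup>2)"
        by (simp add: power_mult_distrib algebra_simps)
      finally show "norm ((1 + \<xi>\<^sup>2) powr r * (cmod (?H \<xi>))\<^sup>2) \<le> norm (2 * a\<^sup>2 * ((1 + \<xi>\<^sup>2) powr r * (cmod (F \<xi>))\<^sup>2) + 2 * b\<^sup>2 * ((1 + \<xi>\<^sup>2) powr r * (cmod (G \<xi>))\<^sup>2))"
        by simp
    qed
  qed measurable
  moreover have "(\<integral>x. complex_of_real (a * f x + b * g x) * fourier p x \<partial>lborel) = (\<integral>\<xi>. ?H \<xi> * complex_of_real (p \<xi>) \<partial>lborel)"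
    if p: "test_fun p" for p
  proof -
    have fp: "integrable lborel (\<lambda>x. complex_of_real (f x) * fourier p x)" "integrable lborel (\<lambda>x. complex_of_real (g x) * fourier p x)"
      by (rule integrable_complex_mult_of_square; use f2 fourier_integrable[OF p] fourier_measurable[OF test_fun_props(2)[OF p]] in simp)+
    have Fp: "integrable lborel (\<lambda>x. F x * complex_of_real (p x))" "integrable lborel (\<lambda>x. G x * complex_of_real (p x))"
      by (rule integrable_complex_mult_of_square; use D(4) E(4) test_fun_props[OF p] in simp)+
    have "(\<integral>x. complex_of_real (a * f x + b * g x) * fourier p x \<partial>lborel) = (\<integral>x. a * (complex_of_real (f x) * fourier p x) + b * (complex_of_real (g x) * fourier p x) \<partial>lborel)"
      by (rule Bochner_Integration.integral_cong) (simp_all add: algebra_simps)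
    also have "\<dots> = a * (\<integral>x. complex_of_real (f x) * fourier p x \<partial>lborel) + b * (\<integral>x. complex_of_real (g x) * fourier p x \<partial>lborel)"
      using fp by simp
    also have "\<dots> = a * (\<integral>\<xi>. F \<xi> * complex_of_real (p \<xi>) \<partial>lborel) + b * (\<integral>\<xi>. G \<xi> * complex_of_real (p \<xi>) \<partial>lborel)"
      unfolding D(3)[OF p] E(3)[OF p] ..
    also have "\<dots> = (\<integral>\<xi>. a * (F \<xi> * complex_of_real (p \<xi>)) + b * (G \<xi> * complex_of_real (p \<xi>)) \<partial>lborel)"
      using Fp by simp
    also have "\<dots> = (\<integral>\<xi>. ?H \<xi> * complex_of_real (p \<xi>) \<partial>lborel)"
      by (rule Bochner_Integration.integral_cong) (simp_all add: algebra_simps)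
    finally show ?thesis .
  qed
  ultimately have "Hs_rep r (\<lambda>x. a * f x + b * g x) ?H" unfolding Hs_rep_def by simp
  moreover have "integrable lborel (\<lambda>x. (a * f x + b * g x)\<^sup>2)"
    by (rule integrable_square_add) (use f2 in \<open>auto simp: power_mult_distrib\<close>)
  ultimately show ?thesis unfolding in_Hs_def by auto
qed

lemma Hs_rep_cong_AE:
  assumes [measurable]: "f \<in> borel_measurable borel" "g \<in> borel_measurable borel" and ae: "AE x in lborel. f x = g x"
  shows "Hs_rep r f = Hs_rep r g"
proof -
  have "(\<integral>x. complex_of_real (f x) * fourier p x \<partial>lborel) = (\<integral>x. complex_of_real (g x) * fourier p x \<partial>lborel)" if "test_fun p" for p
  proof (rule integral_cong_AE)
    note [measurable] = fourier_measurable[OF test_fun_props(2)[OF that]]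
    show "(\<lambda>x. complex_of_real (f x) * fourier p x) \<in> borel_measurable lborel" "(\<lambda>x. complex_of_real (g x) * fourier p x) \<in> borel_measurable lborel"
      by measurable
    show "AE x in lborel. complex_of_real (f x) * fourier p x = complex_of_real (g x) * fourier p x"
      using ae by eventually_elim simp
  qed
  then show ?thesis unfolding Hs_rep_def fun_eq_iff by (auto cong: conj_cong)
qed

text \<open>Functions equal almost everywhere have the same representatives F, so
  \<open>SOME\<close> picks the same one and the norms agree.\<close>

lemma in_Hs_cong_AE:
  assumes f: "in_Hs r f" and g[measurable]: "g \<in> borel_measurable borel" and ae: "AE x in lborel. f x = g x"
  shows "in_Hs r g" "Hs_norm r g = Hs_norm r f"
proof -
  have fm[measurable]: "f \<in> borel_measurable borel" using f by (simp add: in_Hs_def)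
  note e = Hs_rep_cong_AE[OF fm g ae, of r]
  have "integrable lborel (\<lambda>x. (g x)\<^sup>2) = integrable lborel (\<lambda>x. (f x)\<^sup>2)"
    by (rule integrable_cong_AE) (use ae in \<open>auto elim!: eventually_mono\<close>)
  then show "in_Hs r g" using f unfolding in_Hs_def e by simp
  show "Hs_norm r g = Hs_norm r f" unfolding Hs_norm_def e ..
qed

section \<open>Strong solutions\<close>

text \<open>Sobolev embedding into bounded C^1 functions, through the L^1 norms of F and \<xi> F.
  With C independent of f, the bound also applies to differences \<open>c t' - c t\<close>.\<close>

lemma Hs_sup_bounds:
  assumes r: "r > 3 / 2"
  obtains C where "0 \<le> C"
    "\<And>f. in_Hs r f \<Longrightarrow> (\<And>x. f differentiable (at x)) \<Longrightarrow> continuous_on UNIV (deriv f) \<and> (\<forall>x. \<bar>f x\<bar> \<le> C * Hs_norm r f \<and> \<bar>deriv f x\<bar> \<le> C * Hs_norm r f)"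
proof -
  define W0 where "W0 = (\<integral>\<xi>. (1 + (\<xi>::real)\<^sup>2) powr (- r) \<partial>lborel)"
  define W1 where "W1 = (\<integral>\<xi>. (1 + (\<xi>::real)\<^sup>2) powr (- (r - 1)) \<partial>lborel)"
  define C where "C = sqrt (W0 * (2 * pi)) + sqrt (W1 * (2 * pi))"
  have W: "0 \<le> W0" "0 \<le> W1" unfolding W0_def W1_def by simp_all
  have C: "0 \<le> C" "sqrt (W0 * (2 * pi)) \<le> C" "sqrt (W1 * (2 * pi)) \<le> C" unfolding C_def using W by simp_all
  have key: "continuous_on UNIV (deriv f) \<and> (\<forall>x. \<bar>f x\<bar> \<le> C * Hs_norm r f \<and> \<bar>deriv f x\<bar> \<le> C * Hs_norm r f)"
    if f: "in_Hs r f" and d: "\<And>x. f differentiable (at x)" for f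
  proof -
    obtain F where F: "Hs_rep r f F" and n: "(Hs_norm r f)\<^sup>2 = (\<integral>\<xi>. (1 + \<xi>\<^sup>2) powr r * (cmod (F \<xi>))\<^sup>2 \<partial>lborel) / (2 * pi)"
      and fm: "f \<in> borel_measurable borel" and f2: "integrable lborel (\<lambda>x. (f x)\<^sup>2)" by (rule in_HsE[OF f])
    have r0: "0 \<le> r" "r > 1 / 2" using r by simp_all
    have fd: "(f has_real_derivative deriv f x) (at x)" for x using d by (simp add: DERIV_deriv_iff_real_differentiable)
    note fc = DERIV_everywhere_continuous[OF fd]
    have [measurable]: "F \<in> borel_measurable borel" by (rule Hs_repD(1)[OF F r0(1)])
    note L0 = Hs_rep_L1[OF F r0(2)] and L1 = Hs_rep_xi_L1[OF F r]
    note inv = Hs_inversion[OF F r0(2) fc f2] and dinv = Hs_inversion_deriv[OF F r d f2]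
    have w: "(\<integral>\<xi>. (1 + \<xi>\<^sup>2) powr r * (cmod (F \<xi>))\<^sup>2 \<partial>lborel) = 2 * pi * (Hs_norm r f)\<^sup>2" using n by simp
    have b: "I \<le> C * Hs_norm r f" if "I\<^sup>2 \<le> V * (2 * pi * (Hs_norm r f)\<^sup>2)" "sqrt (V * (2 * pi)) \<le> C" "0 \<le> V" for I V
    proof -
      have "I \<le> sqrt (V * (2 * pi * (Hs_norm r f)\<^sup>2))" using that(1) by (rule real_le_rsqrt)
      also have "\<dots> = sqrt (V * (2 * pi)) * Hs_norm r f" using Hs_norm_nonneg[of r f] by (simp add: real_sqrt_mult)
      also have "\<dots> \<le> C * Hs_norm r f" by (rule mult_right_mono[OF that(2) Hs_norm_nonneg])
      finally show ?thesis .
    qed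
    have I0: "(\<integral>\<xi>. cmod (F \<xi>) \<partial>lborel) \<le> C * Hs_norm r f"
      by (rule b[OF _ C(2) W(1)]) (use L0(2) w in \<open>simp only: W0_def\<close>)
    have I1: "(\<integral>\<xi>. \<bar>\<xi>\<bar> * cmod (F \<xi>) \<partial>lborel) \<le> C * Hs_norm r f"
      by (rule b[OF _ C(3) W(2)]) (use L1(2) w in \<open>simp only: W1_def\<close>)
    \<comment> \<open>Disposes of the factor 2 pi in the inversion formulas.\<close>
    have pi1: "\<bar>t\<bar> \<le> \<bar>2 * pi * t\<bar>" for t :: real
      using mult_right_mono[of 1 "2 * pi" "\<bar>t\<bar>"] pi_gt3 by (simp add: abs_mult)
    have "\<bar>f x\<bar> \<le> C * Hs_norm r f" for x
    proof -
      have "\<bar>2 * pi * f x\<bar> = cmod (\<integral>\<xi>. F \<xi> * cis (x * \<xi>) \<partial>lborel)" unfolding inv[symmetric] norm_of_real ..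
      also have "\<dots> \<le> (\<integral>\<xi>. cmod (F \<xi> * cis (x * \<xi>)) \<partial>lborel)" by (rule integral_norm_bound)
      also have "\<dots> = (\<integral>\<xi>. cmod (F \<xi>) \<partial>lborel)" by (simp add: norm_mult)
      finally show ?thesis using I0 pi1[of "f x"] by linarith
    qed
    moreover have "\<bar>deriv f x\<bar> \<le> C * Hs_norm r f" for x
    proof -
      have "\<bar>2 * pi * deriv f x\<bar> = cmod (\<integral>\<xi>. F \<xi> * (\<i> * \<xi> * cis (x * \<xi>)) \<partial>lborel)" unfolding dinv[symmetric] norm_of_real ..
      also have "\<dots> \<le> (\<integral>\<xi>. cmod (F \<xi> * (\<i> * \<xi> * cis (x * \<xi>))) \<partial>lborel)" by (rule integral_norm_bound)
      also have "\<dots> = (\<integral>\<xi>. \<bar>\<xi>\<bar> * cmod (F \<xi>) \<partial>lborel)" by (simp add: norm_mult mult.commute)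
      finally show ?thesis using I1 pi1[of "deriv f x"] by linarith
    qed
    moreover have "continuous_on UNIV (deriv f)"
    proof -
      have "continuous_on UNIV (\<lambda>y. \<integral>\<xi>. F \<xi> * (\<i> * \<xi> * cis (y * \<xi>)) \<partial>lborel)"
        unfolding continuous_on_sequentially
      proof (intro allI ballI impI, elim conjE)
        fix y :: "nat \<Rightarrow> real" and a assume y: "y \<longlonglongrightarrow> a"
        have "(\<lambda>n. \<integral>\<xi>. F \<xi> * (\<i> * \<xi> * cis (y n * \<xi>)) \<partial>lborel) \<longlonglongrightarrow> (\<integral>\<xi>. F \<xi> * (\<i> * \<xi> * cis (a * \<xi>)) \<partial>lborel)"
        proof (rule integral_dominated_convergence[where w = "\<lambda>\<xi>. \<bar>\<xi>\<bar> * cmod (F \<xi>)"])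
          show "AE \<xi> in lborel. (\<lambda>n. F \<xi> * (\<i> * \<xi> * cis (y n * \<xi>))) \<longlonglongrightarrow> F \<xi> * (\<i> * \<xi> * cis (a * \<xi>))"
            by (intro AE_I2 tendsto_intros y)
        qed (use L1(1) in \<open>auto simp: norm_mult mult.commute\<close>)
        then show "((\<lambda>y. \<integral>\<xi>. F \<xi> * (\<i> * \<xi> * cis (y * \<xi>)) \<partial>lborel) \<circ> y) \<longlonglongrightarrow> (\<integral>\<xi>. F \<xi> * (\<i> * \<xi> * cis (a * \<xi>)) \<partial>lborel)"
          by (simp add: o_def)
      qed
      then have "continuous_on UNIV (\<lambda>y. complex_of_real (2 * pi * deriv f y))" unfolding dinv .
      then have "continuous_on UNIV (\<lambda>y. Re (complex_of_real (2 * pi * deriv f y)))" by (rule continuous_on_Re)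
      then have "continuous_on UNIV (\<lambda>y. 2 * pi * deriv f y)" by (simp only: Re_complex_of_real)
      then have "continuous_on UNIV (\<lambda>y. 1 / (2 * pi) * (2 * pi * deriv f y))" by (rule continuous_on_mult_left)
      moreover have "1 / (2 * pi) * (2 * pi * deriv f y) = deriv f y" for y by simp
      ultimately show ?thesis by (simp only:)
    qed
    ultimately show ?thesis by blast
  qed
  show thesis by (rule that[OF C(1) key])
qed

lemma Hs_norm_L2:
  assumes "in_Hs r f" "r > 1 / 2" "continuous_on UNIV f"
  shows "(\<integral>x. (f x)\<^sup>2 \<partial>lborel) \<le> (Hs_norm r f)\<^sup>2"
proof -
  obtain F where F: "Hs_rep r f F" and n: "(Hs_norm r f)\<^sup>2 = (\<integral>\<xi>. (1 + \<xi>\<^sup>2) powr r * (cmod (F \<xi>))\<^sup>2 \<partial>lborel) / (2 * pi)"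
      and "f \<in> borel_measurable borel" and f2: "integrable lborel (\<lambda>x. (f x)\<^sup>2)" by (rule in_HsE[OF assms(1)])
  show ?thesis unfolding n by (rule Hs_L2_le[OF F assms(2,3) f2])
qed

lemma Hs_norm_energy:
  assumes f: "in_Hs r f" and r: "1 \<le> r" and d: "\<And>x. f differentiable (at x)"
  shows "integrable lborel (\<lambda>x. (deriv f x)\<^sup>2)" "(\<integral>x. (f x)\<^sup>2 \<partial>lborel) + (\<integral>x. (deriv f x)\<^sup>2 \<partial>lborel) \<le> (Hs_norm r f)\<^sup>2"
proof -
  obtain F where F: "Hs_rep r f F" and n: "(Hs_norm r f)\<^sup>2 = (\<integral>\<xi>. (1 + \<xi>\<^sup>2) powr r * (cmod (F \<xi>))\<^sup>2 \<partial>lborel) / (2 * pi)"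
      and "f \<in> borel_measurable borel" and f2: "integrable lborel (\<lambda>x. (f x)\<^sup>2)" by (rule in_HsE[OF f])
  show "integrable lborel (\<lambda>x. (deriv f x)\<^sup>2)" "(\<integral>x. (f x)\<^sup>2 \<partial>lborel) + (\<integral>x. (deriv f x)\<^sup>2 \<partial>lborel) \<le> (Hs_norm r f)\<^sup>2"
    unfolding n by (rule Hs_energy_le[OF F r d f2])+
qed

lemma Hs_regular:
  assumes r: "r > 3 / 2"
  obtains C where "0 \<le> C"
    "\<And>f. in_Hs r f \<Longrightarrow> (\<And>x. f differentiable (at x)) \<Longrightarrow> regular (C * Hs_norm r f + (Hs_norm r f)\<^sup>2) f (deriv f)"
proof -
  obtain C where C: "0 \<le> C"
    "\<And>f. in_Hs r f \<Longrightarrow> (\<And>x. f differentiable (at x)) \<Longrightarrow> continuous_on UNIV (deriv f) \<and> (\<forall>x. \<bar>f x\<bar> \<le> C * Hs_norm r f \<and> \<bar>deriv f x\<bar> \<le> C * Hs_norm r f)"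
    by (rule Hs_sup_bounds[OF r]) blast
  have "regular (C * Hs_norm r f + (Hs_norm r f)\<^sup>2) f (deriv f)" if f: "in_Hs r f" and d: "\<And>x. f differentiable (at x)" for f
  proof -
    have r1: "1 \<le> r" using r by simp
    note E = Hs_norm_energy[OF f r1 d]
    have s: "continuous_on UNIV (deriv f)" "\<bar>f x\<bar> \<le> C * Hs_norm r f" "\<bar>deriv f x\<bar> \<le> C * Hs_norm r f" for x using C(2)[OF f d] by auto
    have n0: "0 \<le> C * Hs_norm r f" using C(1) Hs_norm_nonneg by simp
    have i0: "0 \<le> (\<integral>x. (f x)\<^sup>2 \<partial>lborel)" "0 \<le> (\<integral>x. (deriv f x)\<^sup>2 \<partial>lborel)" by simp_all
    have f2: "integrable lborel (\<lambda>x. (f x)\<^sup>2)" using f by (simp add: in_Hs_def)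
    show ?thesis unfolding regular_def
    proof (intro conjI allI)
      show "(f has_real_derivative deriv f x) (at x)" for x using d by (simp add: DERIV_deriv_iff_real_differentiable)
      show "\<bar>f x\<bar> \<le> C * Hs_norm r f + (Hs_norm r f)\<^sup>2" "\<bar>deriv f x\<bar> \<le> C * Hs_norm r f + (Hs_norm r f)\<^sup>2" for x
        using s(2,3)[of x] zero_le_power2[of "Hs_norm r f"] by linarith+
      show "(\<integral>x. (f x)\<^sup>2 \<partial>lborel) \<le> C * Hs_norm r f + (Hs_norm r f)\<^sup>2" "(\<integral>x. (deriv f x)\<^sup>2 \<partial>lborel) \<le> C * Hs_norm r f + (Hs_norm r f)\<^sup>2"
        using E(2) i0 n0 by linarith+
    qed (fact s(1) f2 E(1))+
  qed
  then show thesis using that C(1) by blast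
qed

lemma regular_add:
  assumes f: "regular A f f'" and g: "regular B g g'"
  shows "regular (2 * A + 2 * B) (\<lambda>x. f x + g x) (\<lambda>x. f' x + g' x)"
proof -
  note F = regularD[OF f] and G = regularD[OF g]
  have le: "(\<integral>x. (p x + q x)\<^sup>2 \<partial>lborel) \<le> 2 * A + 2 * B" if m: "p \<in> borel_measurable borel" "q \<in> borel_measurable borel"
    and i: "integrable lborel (\<lambda>x. (p x)\<^sup>2)" "integrable lborel (\<lambda>x. (q x)\<^sup>2)"
    and b: "(\<integral>x. (p x)\<^sup>2 \<partial>lborel) \<le> A" "(\<integral>x. (q x)\<^sup>2 \<partial>lborel) \<le> B" for p q
  proof -
    have "(\<integral>x. (p x + q x)\<^sup>2 \<partial>lborel) \<le> (\<integral>x. 2 * (p x)\<^sup>2 + 2 * (q x)\<^sup>2 \<partial>lborel)"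
      by (rule integral_mono[OF integrable_square_add _ square_add_le]) (use m i in auto)
    then show ?thesis using i b by simp
  qed
  show ?thesis unfolding regular_def
  proof (intro conjI allI)
    show "((\<lambda>x. f x + g x) has_real_derivative f' x + g' x) (at x)" for x by (intro DERIV_add F(1) G(1))
    show "continuous_on UNIV (\<lambda>x. f' x + g' x)" by (intro continuous_intros F(2) G(2))
    show "\<bar>f x + g x\<bar> \<le> 2 * A + 2 * B" "\<bar>f' x + g' x\<bar> \<le> 2 * A + 2 * B" for x
      using F(3,4)[of x] G(3,4)[of x] F(12) G(12) by linarith+
    show "integrable lborel (\<lambda>x. (f x + g x)\<^sup>2)" "integrable lborel (\<lambda>x. (f' x + g' x)\<^sup>2)"
      by (rule integrable_square_add; use F G in simp)+
    show "(\<integral>x. (f x + g x)\<^sup>2 \<partial>lborel) \<le> 2 * A + 2 * B" "(\<integral>x. (f' x + g' x)\<^sup>2 \<partial>lborel) \<le> 2 * A + 2 * B"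
      by (rule le; use F G in simp)+
  qed
qed

text \<open>Continuity in the H^s norm gives a bound near each time, and bisection makes it uniform
  on the compact interval. The local bound is composed at the level of \<open>regular\<close>: that
  of \<open>c t\<close> plus that of the difference, whose norm is below 1.\<close>

lemma uniform_regular:
  assumes s: "s > 3 / 2" and c: "Hs_continuous s T c" and t1: "0 \<le> t1" "t1 < T"
    and H: "\<And>t. t \<in> {0..<T} \<Longrightarrow> in_Hs s (c t)" and d: "\<And>t x. t \<in> {0..<T} \<Longrightarrow> c t differentiable (at x)"
  obtains M where "\<forall>t\<in>{0..t1}. regular M (c t) (deriv (c t))"
proof -
  obtain C where C: "0 \<le> C"
    "\<And>f. in_Hs s f \<Longrightarrow> (\<And>x. f differentiable (at x)) \<Longrightarrow> regular (C * Hs_norm s f + (Hs_norm s f)\<^sup>2) f (deriv f)"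
    by (rule Hs_regular[OF s]) blast
  let ?P = "\<lambda>a b. \<exists>M. \<forall>t\<in>{a..b} \<inter> {0..t1}. regular M (c t) (deriv (c t))"
  have "?P 0 t1"
  \<comment> \<open>Case 1 glues bounds on adjacent intervals by their maximum; case 2 is the local
    bound near one time.\<close>
  proof (induction rule: Bolzano[OF t1(1), where P = ?P])
    case (1 a b e)
    obtain M where M0: "\<forall>t\<in>{a..b} \<inter> {0..t1}. regular M (c t) (deriv (c t))" using 1(1) by (elim exE)
    obtain N where N0: "\<forall>t\<in>{b..e} \<inter> {0..t1}. regular N (c t) (deriv (c t))" using 1(2) by (elim exE)
    note M = bspec[OF M0] and N = bspec[OF N0]
    have "regular (max M N) (c t) (deriv (c t))" if t: "t \<in> {a..e} \<inter> {0..t1}" for t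
    proof (cases "t \<le> b")
      case True
      then have "regular M (c t) (deriv (c t))" using t by (intro M) auto
      then show ?thesis by (rule regular_mono) simp
    next
      case False
      then have "regular N (c t) (deriv (c t))" using t by (intro N) auto
      then show ?thesis by (rule regular_mono) simp
    qed
    then show ?case by (intro exI[of _ "max M N"] ballI)
  next
    case (2 t)
    then have t: "t \<in> {0..<T}" using t1 by auto
    have "((\<lambda>t'. Hs_norm s (\<lambda>x. c t' x - c t x)) \<longlongrightarrow> 0) (at t within {0..<T})" using c t unfolding Hs_continuous_def by blast
    then have "eventually (\<lambda>t'. dist (Hs_norm s (\<lambda>x. c t' x - c t x)) 0 < 1) (at t within {0..<T})" by (rule tendstoD) simp
    then obtain \<delta> where \<delta>0: "0 < \<delta> \<and> (\<forall>t'\<in>{0..<T}. t' \<noteq> t \<and> dist t' t < \<delta> \<longrightarrow> dist (Hs_norm s (\<lambda>x. c t' x - c t x)) 0 < 1)"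
      unfolding eventually_at by (elim exE)
    note \<delta> = \<delta>0[THEN conjunct1] \<delta>0[THEN conjunct2, rule_format, OF _ conjI]
    define N where "N = C * Hs_norm s (c t) + (Hs_norm s (c t))\<^sup>2"
    have rt: "regular N (c t) (deriv (c t))" unfolding N_def by (rule C(2)[OF H[OF t] d[OF t]])
    have N0: "0 \<le> N" by (rule regularD(12)[OF rt])
    have loc: "regular (2 * N + 2 * (C + 1)) (c t') (deriv (c t'))" if t': "t' \<in> {0..<T}" "dist t' t < \<delta>" for t'
    proof (cases "t' = t")
      case True
      then show ?thesis using regular_mono[OF rt, of "2 * N + 2 * (C + 1)"] N0 C(1) by simp
    next
      case False
      let ?k = "\<lambda>x. c t' x - c t x"
      have n1: "Hs_norm s ?k \<le> 1" using \<delta>(2)[OF t'(1) False t'(2)] Hs_norm_nonneg[of s ?k] by (simp add: dist_real_def)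
      have s0: "0 \<le> s" using s by simp
      have kH: "in_Hs s ?k" using in_Hs_linear[OF H[OF t'(1)] H[OF t] s0, of 1 "-1"] by simp
      have dk: "(?k has_real_derivative deriv (c t') x - deriv (c t) x) (at x)" for x
        by (intro DERIV_diff) (use d[OF t'(1)] d[OF t] in \<open>simp_all add: DERIV_deriv_iff_real_differentiable\<close>)
      then have kd: "?k differentiable (at x)" for x by (auto simp: real_differentiable_def)
      have "C * Hs_norm s ?k \<le> C" using mult_left_mono[OF n1 C(1)] by simp
      moreover have "(Hs_norm s ?k)\<^sup>2 \<le> 1" using power_mono[OF n1 Hs_norm_nonneg, of 2] by simp
      ultimately have "C * Hs_norm s ?k + (Hs_norm s ?k)\<^sup>2 \<le> C + 1" by linarith
      then have "regular (C + 1) ?k (deriv ?k)" by (rule regular_mono[OF C(2)[OF kH kd]])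
      moreover have "deriv ?k = (\<lambda>x. deriv (c t') x - deriv (c t) x)" by (rule ext) (rule DERIV_imp_deriv[OF dk])
      ultimately have "regular (C + 1) ?k (\<lambda>x. deriv (c t') x - deriv (c t) x)" by (simp only:)
      from regular_add[OF rt this] show ?thesis by simp
    qed
    have loc': "?P a b" if ab: "a \<le> t \<and> t \<le> b \<and> b - a < \<delta>" for a b
    proof (intro exI ballI)
      fix t' assume "t' \<in> {a..b} \<inter> {0..t1}"
      then have "t' \<in> {0..<T}" "dist t' t < \<delta>" using ab t1(2) by (auto simp: dist_real_def abs_less_iff)
      then show "regular (2 * N + 2 * (C + 1)) (c t') (deriv (c t'))" by (rule loc)
    qed
    show ?case by (rule exI[of _ \<delta>]) (intro conjI allI impI \<delta>(1), rule loc')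
  qed
  then obtain M where M0: "\<forall>t\<in>{0..t1} \<inter> {0..t1}. regular M (c t) (deriv (c t))" by (elim exE)
  then have "\<forall>t\<in>{0..t1}. regular M (c t) (deriv (c t))" by (simp only: Int_absorb)
  then show thesis by (rule that)
qed

text \<open>As s - 1 > 1/2, the norm of H^(s-1) dominates the L^2 norm of continuous functions. The
  equation fixes \<open>ct t\<close> only almost everywhere, so it is first replaced by the
  continuous \<open>- R\<close>, which leaves the Sobolev norm unchanged.\<close>

lemma L2_time_derivative:
  assumes s: "s > 3 / 2" and T: "Hs_time_deriv (s - 1) T c ct" and t1: "0 \<le> t1" "t1 < T"
    and H: "\<And>t. t \<in> {0..<T} \<Longrightarrow> in_Hs s (c t)" and Ht: "\<And>t. t \<in> {0..<T} \<Longrightarrow> in_Hs (s - 1) (ct t)"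
    and cc: "\<And>t. t \<in> {0..<T} \<Longrightarrow> continuous_on UNIV (c t)" and t: "t \<in> {0..t1}"
    and Rc: "continuous_on UNIV R" and ae: "AE x in lborel. ct t x = - R x"
  shows "((\<lambda>s'. \<integral>x. ((c s' x - c t x) / (s' - t) + R x)\<^sup>2 \<partial>lborel) \<longlongrightarrow> 0) (at t within {0..t1})"
proof -
  have tT: "t \<in> {0..<T}" using t t1 by auto
  have s1: "0 \<le> s - 1" "s - 1 > 1 / 2" "s - 1 \<le> s" using s by auto
  let ?k = "\<lambda>s' x. (c s' x - c t x) / (s' - t) + R x" and ?h = "\<lambda>s' x. (c s' x - c t x) / (s' - t) - ct t x"
  have b: "(\<integral>x. (?k s' x)\<^sup>2 \<partial>lborel) \<le> (Hs_norm (s - 1) (?h s'))\<^sup>2" if s': "s' \<in> {0..<T}" "s' \<noteq> t" for s'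
  proof -
    have 1: "in_Hs (s - 1) (c s')" "in_Hs (s - 1) (c t)" using in_Hs_mono[OF H s1(3,1)] s'(1) tT by auto
    have "in_Hs (s - 1) (\<lambda>x. 1 * ((1 / (s' - t)) * c s' x + (- 1 / (s' - t)) * c t x) + (-1) * ct t x)"
      by (intro in_Hs_linear 1 Ht tT s1(1))
    moreover have "(\<lambda>x. 1 * ((1 / (s' - t)) * c s' x + (- 1 / (s' - t)) * c t x) + (-1) * ct t x) = ?h s'"
      by (simp add: fun_eq_iff diff_divide_distrib)
    ultimately have hH: "in_Hs (s - 1) (?h s')" by (simp only:)
    have kc: "continuous_on UNIV (?k s')" using s'(2) by (intro continuous_intros cc s'(1) tT Rc) auto
    have "AE x in lborel. ?h s' x = ?k s' x" using ae by eventually_elim simp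
    note e = in_Hs_cong_AE[OF hH borel_measurable_continuous_onI[OF kc] this]
    show ?thesis using Hs_norm_L2[OF e(1) s1(2) kc] unfolding e(2) .
  qed
  have "((\<lambda>s'. Hs_norm (s - 1) (?h s')) \<longlongrightarrow> 0) (at t within {0..<T})" using T tT unfolding Hs_time_deriv_def by blast
  then have "((\<lambda>s'. (Hs_norm (s - 1) (?h s'))\<^sup>2) \<longlongrightarrow> 0\<^sup>2) (at t within {0..<T})" by (rule tendsto_power)
  then have l: "((\<lambda>s'. (Hs_norm (s - 1) (?h s'))\<^sup>2) \<longlongrightarrow> 0) (at t within {0..<T})" by simp
  have "((\<lambda>s'. \<integral>x. (?k s' x)\<^sup>2 \<partial>lborel) \<longlongrightarrow> 0) (at t within {0..<T})"
    by (rule Lim_null_comparison[OF _ l]) (use b in \<open>auto simp: eventually_at_filter\<close>)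
  then show ?thesis by (rule tendsto_within_subset) (use t1 in auto)
qed

lemma regular_rhs_continuous:
  assumes p: "regular M p px" and q: "regular M q qx" and r: "regular M r rx" and S: "continuous_on UNIV S"
  shows "continuous_on UNIV (\<lambda>x. S x * px x + nonlocal_part p q r px qx rx x)"
  by (intro continuous_intros S regularD(2)[OF p] regularD(9)[OF regular_nonlocal_part[OF p q r]])

lemma strong_solution_ch_flow:
  assumes s: "s > 3 / 2" and sol: "strong_solution s u0 v0 w0 T u v w" and t1: "0 \<le> t1" "t1 < T"
  obtains M where "ch_flow t1 M u (\<lambda>t. deriv (u t)) v (\<lambda>t. deriv (v t)) w (\<lambda>t. deriv (w t))"
proof -
  note sol' = sol[unfolded strong_solution_def Let_def]
  note c1 = sol'[THEN conjunct2, THEN conjunct1, rule_format] and c2 = sol'[THEN conjunct2, THEN conjunct2]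
  have Hs: "in_Hs s (u t)" "in_Hs s (v t)" "in_Hs s (w t)" if "t \<in> {0..<T}" for t using c1[OF that] by simp_all
  have df: "u t differentiable (at x)" "v t differentiable (at x)" "w t differentiable (at x)" if "t \<in> {0..<T}" for t x
    using c1[OF that] by simp_all
  note ct = c2[THEN conjunct1] c2[THEN conjunct2, THEN conjunct1] c2[THEN conjunct2, THEN conjunct2, THEN conjunct1]
  note ex = c2[THEN conjunct2, THEN conjunct2, THEN conjunct2, THEN conjunct1]
  obtain ut vt wt where X: "(\<forall>t\<in>{0..<T}. in_Hs (s - 1) (ut t) \<and> in_Hs (s - 1) (vt t) \<and> in_Hs (s - 1) (wt t)) \<and>
      Hs_continuous (s - 1) T ut \<and> Hs_continuous (s - 1) T vt \<and> Hs_continuous (s - 1) T wt \<and>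
      Hs_time_deriv (s - 1) T u ut \<and> Hs_time_deriv (s - 1) T v vt \<and> Hs_time_deriv (s - 1) T w wt \<and>
      (\<forall>t\<in>{0..<T}. AE x in lborel.
        ut t x + (u t x + v t x + w t x) * deriv (u t) x + Gconv (\<lambda>y. u t y * deriv (v t) y + u t y * deriv (w t) y) x
          + Gxconv (\<lambda>y. fnl (u t y) (v t y) (w t y) (deriv (u t) y) (deriv (v t) y) (deriv (w t) y)) x = 0 \<and>
        vt t x + (u t x + v t x + w t x) * deriv (v t) x + Gconv (\<lambda>y. v t y * deriv (u t) y + v t y * deriv (w t) y) x
          + Gxconv (\<lambda>y. gnl (u t y) (v t y) (w t y) (deriv (u t) y) (deriv (v t) y) (deriv (w t) y)) x = 0 \<and>
        wt t x + (u t x + v t x + w t x) * deriv (w t) x + Gconv (\<lambda>y. w t y * deriv (u t) y + w t y * deriv (v t) y) x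
          + Gxconv (\<lambda>y. hnl (u t y) (v t y) (w t y) (deriv (u t) y) (deriv (v t) y) (deriv (w t) y)) x = 0)"
    using ex by (elim exE) (rule that)
  note Ht = X[THEN conjunct1, rule_format] and X1 = X[THEN conjunct2, THEN conjunct2, THEN conjunct2, THEN conjunct2]
  note td = X1[THEN conjunct1] X1[THEN conjunct2, THEN conjunct1] X1[THEN conjunct2, THEN conjunct2, THEN conjunct1]
  note eq = X1[THEN conjunct2, THEN conjunct2, THEN conjunct2, rule_format]
  have Ht': "in_Hs (s - 1) (ut t)" "in_Hs (s - 1) (vt t)" "in_Hs (s - 1) (wt t)" if "t \<in> {0..<T}" for t using Ht[OF that] by simp_all
  obtain Mu where "\<forall>t\<in>{0..t1}. regular Mu (u t) (deriv (u t))" by (rule uniform_regular[OF s ct(1) t1 Hs(1) df(1)])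
  note Mu = this[rule_format]
  obtain Mv where "\<forall>t\<in>{0..t1}. regular Mv (v t) (deriv (v t))" by (rule uniform_regular[OF s ct(2) t1 Hs(2) df(2)])
  note Mv = this[rule_format]
  obtain Mw where "\<forall>t\<in>{0..t1}. regular Mw (w t) (deriv (w t))" by (rule uniform_regular[OF s ct(3) t1 Hs(3) df(3)])
  note Mw = this[rule_format]
  define M where "M = max Mu (max Mv Mw)"
  have R: "regular M (u t) (deriv (u t))" "regular M (v t) (deriv (v t))" "regular M (w t) (deriv (w t))" if "t \<in> {0..t1}" for t
    by (rule regular_mono[OF Mu[OF that]] regular_mono[OF Mv[OF that]] regular_mono[OF Mw[OF that]]; simp add: M_def)+
  have cont: "continuous_on UNIV f" if "\<And>x. f differentiable (at x)" for f :: "real \<Rightarrow> real"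
    by (rule DERIV_everywhere_continuous[of f "deriv f"]) (use that in \<open>simp add: DERIV_deriv_iff_real_differentiable\<close>)
  have cc: "continuous_on UNIV (u t)" "continuous_on UNIV (v t)" "continuous_on UNIV (w t)" if "t \<in> {0..<T}" for t
    by (rule cont[OF df(1)[OF that]] cont[OF df(2)[OF that]] cont[OF df(3)[OF that]])+
  have "ch_flow t1 M u (\<lambda>t. deriv (u t)) v (\<lambda>t. deriv (v t)) w (\<lambda>t. deriv (w t))"
  proof
    fix t assume t: "t \<in> {0..t1}"
    then have tT: "t \<in> {0..<T}" using t1 by auto
    note r = R[OF t]
    have S: "continuous_on UNIV (\<lambda>x. u t x + v t x + w t x)" by (intro continuous_intros cc tT)
    note ae = eq[OF tT]
    have ae1: "AE x in lborel. ut t x = - ((u t x + v t x + w t x) * deriv (u t) x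
        + nonlocal_part (u t) (v t) (w t) (deriv (u t)) (deriv (v t)) (deriv (w t)) x)"
      using ae by eventually_elim (simp add: nonlocal_part_def)
    have ae2: "AE x in lborel. vt t x = - ((u t x + v t x + w t x) * deriv (v t) x
        + nonlocal_part (v t) (u t) (w t) (deriv (v t)) (deriv (u t)) (deriv (w t)) x)"
      using ae by eventually_elim (simp add: nonlocal_part_def gnl_fnl)
    have ae3: "AE x in lborel. wt t x = - ((u t x + v t x + w t x) * deriv (w t) x
        + nonlocal_part (w t) (u t) (v t) (deriv (w t)) (deriv (u t)) (deriv (v t)) x)"
      using ae by eventually_elim (simp add: nonlocal_part_def hnl_fnl)
    show "((\<lambda>s'. \<integral>x. ((u s' x - u t x) / (s' - t) + ((u t x + v t x + w t x) * deriv (u t) x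
        + nonlocal_part (u t) (v t) (w t) (deriv (u t)) (deriv (v t)) (deriv (w t)) x))\<^sup>2 \<partial>lborel) \<longlongrightarrow> 0) (at t within {0..t1})"
      by (rule L2_time_derivative[OF s td(1) t1 Hs(1) Ht'(1) cc(1) t regular_rhs_continuous[OF r(1) r(2) r(3) S] ae1])
    show "((\<lambda>s'. \<integral>x. ((v s' x - v t x) / (s' - t) + ((u t x + v t x + w t x) * deriv (v t) x
        + nonlocal_part (v t) (u t) (w t) (deriv (v t)) (deriv (u t)) (deriv (w t)) x))\<^sup>2 \<partial>lborel) \<longlongrightarrow> 0) (at t within {0..t1})"
      by (rule L2_time_derivative[OF s td(2) t1 Hs(2) Ht'(2) cc(2) t regular_rhs_continuous[OF r(2) r(1) r(3) S] ae2])
    show "((\<lambda>s'. \<integral>x. ((w s' x - w t x) / (s' - t) + ((u t x + v t x + w t x) * deriv (w t) x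
        + nonlocal_part (w t) (u t) (v t) (deriv (w t)) (deriv (u t)) (deriv (v t)) x))\<^sup>2 \<partial>lborel) \<longlongrightarrow> 0) (at t within {0..t1})"
      by (rule L2_time_derivative[OF s td(3) t1 Hs(3) Ht'(3) cc(3) t regular_rhs_continuous[OF r(3) r(1) r(2) S] ae3])
  qed (use t1 R in auto)
  then show thesis by (rule that)
qed

theorem theorem2p1:
  fixes s E0 Q0 :: real and u0 v0 w0 :: "real \<Rightarrow> real"
  assumes "s > 3/2"
    and "in_Hs s u0" and "in_Hs s v0" and "in_Hs s w0"
    and "\<forall>x. u0 differentiable (at x) \<and> v0 differentiable (at x) \<and> w0 differentiable (at x)"
    and "E0 = (Hs_norm 1 u0)\<^sup>2 + (Hs_norm 1 v0)\<^sup>2 + (Hs_norm 1 w0)\<^sup>2"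
    and "Q0 = integral\<^sup>L lborel (\<lambda>x. (deriv u0 x + deriv v0 x + deriv w0 x) ^ 3)"
    and "Q0 < - 9 * E0 * sqrt (2 * E0)"
  shows "lifespan s u0 v0 w0 < \<infinity> \<and>
         lifespan s u0 v0 w0 \<le> ereal (sqrt (2 * E0) / (3 * E0) *
            ln ((Q0 - 9 * E0 * sqrt (2 * E0)) / (Q0 + 9 * E0 * sqrt (2 * E0))))"
proof -
  let ?B = "sqrt (2 * E0) / (3 * E0) * ln ((Q0 - 9 * E0 * sqrt (2 * E0)) / (Q0 + 9 * E0 * sqrt (2 * E0)))"
  have d0: "u0 differentiable (at x)" "v0 differentiable (at x)" "w0 differentiable (at x)" for x using assms(5) by blast+
  have H1: "in_Hs 1 u0" "in_Hs 1 v0" "in_Hs 1 w0" using in_Hs_mono[of s _ 1] assms(1-4) by auto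
  note eu = Hs_norm_energy[OF H1(1) order_refl d0(1)] and ev = Hs_norm_energy[OF H1(2) order_refl d0(2)]
    and ew = Hs_norm_energy[OF H1(3) order_refl d0(3)]
  define e0 where "e0 = (\<integral>x. (u0 x)\<^sup>2 \<partial>lborel) + (\<integral>x. (deriv u0 x)\<^sup>2 \<partial>lborel)
     + ((\<integral>x. (v0 x)\<^sup>2 \<partial>lborel) + (\<integral>x. (deriv v0 x)\<^sup>2 \<partial>lborel)) + ((\<integral>x. (w0 x)\<^sup>2 \<partial>lborel) + (\<integral>x. (deriv w0 x)\<^sup>2 \<partial>lborel))"
  \<comment> \<open>The flow sees the energy \<open>e0\<close> of the data, the hypotheses speak of
    the Fourier-side \<open>E0\<close>.\<close>
  have e0: "e0 \<le> E0" unfolding e0_def assms(6) using eu(2) ev(2) ew(2) by linarith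
  \<comment> \<open>If E0 were 0, all three derivatives would vanish, hence Q0 = 0, and the strict
    hypothesis on Q0 would read 0 < 0.\<close>
  have E0: "0 < E0"
  proof (rule ccontr)
    assume "\<not> 0 < E0"
    moreover have nn: "0 \<le> (\<integral>x. (f x)\<^sup>2 \<partial>lborel)" for f :: "real \<Rightarrow> real" by simp
    ultimately have z: "(\<integral>x. (deriv u0 x)\<^sup>2 \<partial>lborel) = 0" "(\<integral>x. (deriv v0 x)\<^sup>2 \<partial>lborel) = 0" "(\<integral>x. (deriv w0 x)\<^sup>2 \<partial>lborel) = 0"
      using e0 nn[of u0] nn[of v0] nn[of w0] nn[of "deriv u0"] nn[of "deriv v0"] nn[of "deriv w0"] unfolding e0_def by linarith+
    obtain C where C: "\<And>f. in_Hs s f \<Longrightarrow> (\<And>x. f differentiable (at x)) \<Longrightarrow> regular (C * Hs_norm s f + (Hs_norm s f)\<^sup>2) f (deriv f)"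
      by (rule Hs_regular[OF assms(1)]) blast
    have "\<And>x. deriv f x = 0" if "in_Hs s f" "\<And>x. f differentiable (at x)" "(\<integral>x. (deriv f x)\<^sup>2 \<partial>lborel) = 0" for f
    proof -
      fix x
      note r = regularD[OF C[OF that(1,2)]]
      have "(deriv f x)\<^sup>2 = 0"
        by (rule continuous_nonneg_integral_zero[OF _ r(6) _ that(3)]) (auto intro!: continuous_intros r(2))
      then show "deriv f x = 0" by simp
    qed
    note z0 = this[OF assms(2) d0(1) z(1)] this[OF assms(3) d0(2) z(2)] this[OF assms(4) d0(3) z(3)]
    have "Q0 = 0" unfolding assms(7) z0 by simp
    moreover have "E0 = 0" using \<open>\<not> 0 < E0\<close> unfolding assms(6) by (smt (verit) zero_le_power2)
    ultimately show False using assms(8) by simp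
  qed
  have a0: "0 < 9 * E0 * sqrt (2 * E0)" using E0 by simp
  \<comment> \<open>Numerator and denominator are both negative and the numerator is larger in
    modulus, so the logarithm is nonnegative. Consequently any time beyond the bound is
    nonnegative.\<close>
  have B0: "0 \<le> ?B"
  proof -
    have "(Q0 - 9 * E0 * sqrt (2 * E0)) / (Q0 + 9 * E0 * sqrt (2 * E0)) \<ge> 1"
      using assms(8) a0 by (simp add: le_divide_eq)
    then show ?thesis using E0 by simp
  qed
  have "T \<le> ?B" if sol: "strong_solution s u0 v0 w0 T u v w" for T u v w
  proof (rule ccontr)
    assume "\<not> T \<le> ?B"
    \<comment> \<open>A solution on \<open>[0, T)\<close> is uniformly bounded only on compact
      subintervals, hence a time strictly between the bound and T.\<close>
    then obtain t1 where t1: "?B < t1" "t1 < T" using dense[of ?B T] by auto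
    then have t0: "0 \<le> t1" using B0 by linarith
    obtain M where M: "ch_flow t1 M u (\<lambda>t. deriv (u t)) v (\<lambda>t. deriv (v t)) w (\<lambda>t. deriv (w t))"
      by (rule strong_solution_ch_flow[OF assms(1) sol t0 t1(2)])
    note sol' = sol[unfolded strong_solution_def]
    have T: "0 \<in> {0..<T}" using t0 t1(2) by simp
    have dT: "u 0 differentiable (at x)" "v 0 differentiable (at x)" "w 0 differentiable (at x)" for x
      using sol'[THEN conjunct2, THEN conjunct1, rule_format, OF T] by simp_all
    have cont: "continuous_on UNIV f" if "\<And>x. f differentiable (at x)" for f :: "real \<Rightarrow> real"
      by (rule DERIV_everywhere_continuous[of f "deriv f"]) (use that in \<open>simp add: DERIV_deriv_iff_real_differentiable\<close>)
    note ae0 = sol'[THEN conjunct2, THEN conjunct2, THEN conjunct2, THEN conjunct2, THEN conjunct2, THEN conjunct2]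
    have ae: "AE x in lborel. u 0 x = u0 x" "AE x in lborel. v 0 x = v0 x" "AE x in lborel. w 0 x = w0 x"
      using ae0 by (eventually_elim, simp)+
    \<comment> \<open>The data are attained almost everywhere and both sides are continuous, so
      equality holds pointwise and the derivatives agree as well.\<close>
    have init: "u 0 = u0" "v 0 = v0" "w 0 = w0"
      by (rule ext, rule continuous_AE_eq[OF cont[OF dT(1)] cont[OF d0(1)] ae(1)] continuous_AE_eq[OF cont[OF dT(2)] cont[OF d0(2)] ae(2)]
          continuous_AE_eq[OF cont[OF dT(3)] cont[OF d0(3)] ae(3)])+
    have "t1 \<le> ?B"
    proof (rule ch_flow_time_bound[OF M E0 _ _ assms(8)])
      show "ch_flow.energy u (\<lambda>t. deriv (u t)) v (\<lambda>t. deriv (v t)) w (\<lambda>t. deriv (w t)) 0 \<le> E0"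
        unfolding ch_flow.energy_def[OF M] init using e0 unfolding e0_def .
      show "Q0 = (\<integral>x. (deriv (u 0) x + deriv (v 0) x + deriv (w 0) x) ^ 3 \<partial>lborel)" unfolding init by (rule assms(7))
    qed
    then show False using t1(1) by simp
  qed
  then have "lifespan s u0 v0 w0 \<le> ereal ?B" unfolding lifespan_def by (intro Sup_least) auto
  then show ?thesis by (auto intro: le_less_trans)
qed

end
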